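(* Every $D(4)$-quadruple $\{a,b,c,d\}$ in $\mathbb{Q}(i)[X]$ containing at least one non-constant polynomial is regular, that is, it satisfies $$(a+b-c-d)^2=(ab+4)(cd+4).$$
   Context: A $D(4)$-quadruple in $\mathbb{Q}(i)[X]$ is a set $\{a,b,c,d\}$ of four distinct non-zero elements of $\mathbb{Q}(i)[X]$ such that the product of any two distinct elements of the set, increased by $4$, is the square of an element of $\mathbb{Q}(i)[X]$. Here $i^2=-1$. A set $\{a,b,c,d\}$ is a $D(4)$-quadruple in $\mathbb{Q}(i)[X]$ if and only if $\{a/2,b/2,c/2,d/2\}$ is a $D(1)$-quadruple in $\mathbb{Q}(i)[X]$ (same definition with $4$ replaced by $1$). A $D(1)$-quadruple $\{a',b',c',d'\}$ is regular if $(a'+b'-c'-d')^2=4(a'b'+1)(c'd'+1)$; correspondingly, a $D(4)$-quadruple $\{a,b,c,d\}$ is regular if $(a+b-c-d)^2=(ab+4)(cd+4)$. *)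

theory Defs
  imports Complex_Main "HOL-Computational_Algebra.Polynomial"
begin

text \<open>The field \<open>\<rat>(\<i>)\<close> is realised as a subfield of \<^typ>\<open>complex\<close>, and \<open>\<rat>(\<i>)[X]\<close> as the
  subring of \<^typ>\<open>complex poly\<close> of polynomials all of whose coefficients lie in it.\<close>

definition gauss_rats :: "complex set" where
  "gauss_rats = {x + y * \<i> | x y. x \<in> \<rat> \<and> y \<in> \<rat>}"

definition gauss_rat_polys :: "complex poly set" where
  "gauss_rat_polys = {p. \<forall>k. coeff p k \<in> gauss_rats}"

text \<open>The square root is required to lie in \<open>\<rat>(\<i>)[X]\<close>, not merely in \<open>\<complex>[X]\<close>.\<close>

definition D_quadruple :: "int \<Rightarrow> complex poly set \<Rightarrow> bool" where
  "D_quadruple n S \<longleftrightarrow>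
     S \<subseteq> gauss_rat_polys \<and> card S = 4 \<and> 0 \<notin> S \<and>
     (\<forall>p\<in>S. \<forall>q\<in>S. p \<noteq> q \<longrightarrow> (\<exists>r\<in>gauss_rat_polys. p * q + of_int n = r\<^sup>2))"

definition D4_regular :: "complex poly \<Rightarrow> complex poly \<Rightarrow> complex poly \<Rightarrow> complex poly \<Rightarrow> bool" where
  "D4_regular a b c d \<longleftrightarrow> (a + b - c - d)\<^sup>2 = (a * b + 4) * (c * d + 4)"

end

theory Submission imports Defs
begin

text \<open>Halving the four polynomials turns the claim into one about products increased by 1. Let
  \<open>r, s, t, x, y, z\<close> be roots of \<open>ab+1, ac+1, bc+1, ad+1, bd+1, cd+1\<close>, where \<open>c\<close> has at least the
  degrees of \<open>a\<close> and \<open>b\<close>. Regularity is a quadratic equation for \<open>d\<close> with the two solutions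
  \<open>a+b+c+2abc \<plusminus> 2rst\<close>, the regular extensions of the triple \<open>{a, b, c}\<close>. It has to be shown
  that \<open>d\<close> is one of them; the proof is an induction on the sum of the four degrees.

  Eliminating \<open>d\<close> gives two Pell equations \<open>a z\<^sup>2 - c x\<^sup>2 = a - c\<close> and
  \<open>b z\<^sup>2 - c y\<^sup>2 = b - c\<close>. Their solutions fall into orbits under the powers of \<open>s + \<surd>(ac)\<close>
  and of \<open>t + \<surd>(bc)\<close>, and every orbit contains a solution of small degree, which belongs to an
  extension \<open>d0\<close> with a degree below that of \<open>c\<close> (lemma \<open>descent\<close>). If \<open>z\<close> lies at an even
  position in both orbits, the two small solutions agree modulo \<open>c\<close>, hence are equal, and \<open>d0\<close>
  extends the whole triple; by induction \<open>d0\<close> is \<open>0\<close>, or a constant \<open>a\<close>, or the smaller of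
  the regular extensions, called \<open>e\<close>. At odd positions only \<open>0\<close> and a constant \<open>a\<close> occur. So \<open>z\<close> is, up
  to sign, the member with some exponent \<open>M\<close> of one of finitely many orbits over \<open>{a, c}\<close>, and the member with
  exponent \<open>N\<close> of an orbit over \<open>{b, c}\<close>.

  Expanding both representations modulo \<open>c\<^sup>2\<close> and comparing the terms linear in \<open>c\<close> gives a
  congruence modulo \<open>c\<close> between expressions that are quadratic in \<open>M\<close> and \<open>N\<close>. There are three situations.

  If the degree of \<open>c\<close> exceeds that of \<open>b\<close> (\<open>regular_if_lt\<close>), both sides have smaller degree than
  \<open>c\<close> and the congruence is an identity. Two nonconstant squares never differ by a nonzero
  constant, even after scaling by constants (\<open>no_square_shift\<close>); together with the identity this forces relations between
  constants, which are Diophantine equations for \<open>M\<close> and \<open>N\<close>. They have no solution except those at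
  which \<open>d\<close> is a regular extension.

  If \<open>b\<close> and \<open>c\<close> have equal degree and \<open>e = 0\<close>, then \<open>c = a+b\<plusminus>2r\<close>, and \<open>t\<close> and \<open>b\<close> can be expressed
  by \<open>a\<close>, \<open>c\<close> and \<open>s\<close>. The congruence is an identity if \<open>a\<close> has smaller degree than \<open>c\<close>; otherwise a count
  of degrees along the orbits shows \<open>\<bar>M\<bar> = \<bar>N\<bar>\<close> first.

  If \<open>b\<close> and \<open>c\<close> have equal degree and \<open>e \<noteq> 0\<close>, then \<open>a\<close> is constant, \<open>e = a\<close> and
  \<open>c = \<theta>\<^sup>2 b + 2\<theta>\<close> with a constant \<open>\<theta>\<close> satisfying \<open>\<theta>\<^sup>2 = 1 + 2a\<theta>\<close>. The congruence leaves some
  irregular possibilities, each of which prescribes \<open>\<theta>\<close> by an exponent. Here the field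
  matters: one family is excluded because \<open>5 - 8n\<close> is not a square in \<open>\<rat>(\<i>)\<close>. Exchanging \<open>b\<close> and \<open>c\<close> replaces
  \<open>\<theta>\<close> by \<open>-1/\<theta>\<close> with the same exponent, and the two prescriptions contradict each other.\<close>

section \<open>Squares and degrees of complex polynomials\<close>

lemma degree_square_complex: "degree ((p::complex poly)\<^sup>2) = 2 * degree p"
  by (cases "p = 0") (simp_all add: power2_eq_square degree_mult_eq)

lemma degree_numeral_mult [simp]: "degree (numeral n * p) = degree p" for p :: "complex poly"
  by (cases "p = 0") (simp_all add: degree_mult_eq)

lemma deg0_add: "degree p = 0 \<Longrightarrow> degree q = 0 \<Longrightarrow> degree (p + q) = 0" for p q :: "complex poly"
  using degree_add_le_max[of p q] by simp

lemma deg0_diff: "degree p = 0 \<Longrightarrow> degree q = 0 \<Longrightarrow> degree (p - q) = 0" for p q :: "complex poly"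
  using degree_diff_le_max[of p q] by simp

lemma deg0_mult: "degree p = 0 \<Longrightarrow> degree q = 0 \<Longrightarrow> degree (p * q) = 0" for p q :: "complex poly"
  using degree_mult_le[of p q] by simp

lemma deg0_power: "degree p = 0 \<Longrightarrow> degree (p ^ n) = 0" for p :: "complex poly"
  using degree_power_le[of p n] by simp

lemmas deg0_simps = deg0_add deg0_diff deg0_mult deg0_power degree_of_int degree_numeral

lemma deg0_sqrt:
  fixes l :: "complex poly" assumes "degree l = 0" obtains k where "degree k = 0" "k\<^sup>2 = l"
proof -
  obtain l0 where "l = [:l0:]" using assms degree_eq_zeroE by blast
  moreover have "csqrt l0 * csqrt l0 = l0" using power2_csqrt[of l0] unfolding power2_eq_square .
  ultimately have "[:csqrt l0:]\<^sup>2 = l" by (simp add: power2_eq_square)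
  thus ?thesis using that[of "[:csqrt l0:]"] by simp
qed

lemma unit_factors_deg0:
  fixes p q :: "complex poly" assumes "p * q = m" "degree m = 0" "m \<noteq> 0"
  shows "degree p = 0" "degree q = 0"
  using assms degree_mult_eq[of p q] by fastforce+

text \<open>If \<open>k\<^sup>2 = l\<close>, then \<open>m = (q - kp)(q + kp)\<close>. Were \<open>m\<close> a nonzero constant, both factors would be
  constant, and with them their difference \<open>2kp\<close>.\<close>
lemma no_square_shift:
  fixes p q :: "complex poly"
  assumes "degree l = 0" "degree m = 0" "l \<noteq> 0" "degree p > 0" "l * p\<^sup>2 + m = q\<^sup>2"
  shows "m = 0"
proof (rule ccontr)
  assume m: "m \<noteq> 0"
  obtain k where k: "degree k = 0" "k\<^sup>2 = l" using assms(1) deg0_sqrt by blast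
  have "k \<noteq> 0" using k assms by auto
  have "(q - k*p) * (q + k*p) = m" using assms(5) k(2) by algebra
  from unit_factors_deg0[OF this assms(2) m]
  have "degree ((q + k*p) - (q - k*p)) = 0" using deg0_diff by blast
  moreover have "(q + k*p) - (q - k*p) = 2 * k * p" by simp
  ultimately have "degree (2*k*p) = 0" by simp
  thus False using \<open>k \<noteq> 0\<close> assms(4) by (cases "p = 0") (simp_all add: degree_mult_eq)
qed

text \<open>Completing the square: \<open>4A\<close> times the quadratic is \<open>(2Ap + B)\<^sup>2 + (4AC - B\<^sup>2)\<close>, and \<open>4A\<close> is itself
  the square of a constant.\<close>
lemma quadratic_square:
  fixes p q :: "complex poly"
  assumes "degree A = 0" "degree B = 0" "degree C = 0" "A \<noteq> 0" "degree p > 0"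
    and eq: "A * p\<^sup>2 + B * p + C = q\<^sup>2"
  shows "B\<^sup>2 = 4 * A * C"
proof -
  obtain k where k: "degree k = 0" "k\<^sup>2 = 4*A" using deg0_sqrt[of "4*A"] assms
    by (auto simp: deg0_simps)
  have 1: "1 * (2*A*p + B)\<^sup>2 + (4*A*C - B\<^sup>2) = (k*q)\<^sup>2" using eq k(2) by algebra
  have "degree (2*A*p + B) > 0"
  proof -
    have "degree (2*A*p) = degree p" using assms by (cases "p = 0") (simp_all add: degree_mult_eq)
    thus ?thesis using assms degree_add_eq_left[of B "2*A*p"] by simp
  qed
  from no_square_shift[OF _ _ _ this 1] have "4*A*C - B\<^sup>2 = 0"
    using assms by (simp add: deg0_simps)
  thus ?thesis by simp
qed

text \<open>Powers of a nonconstant polynomial are linearly independent over the constants.\<close>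
lemma quadratic_zero:
  fixes p :: "complex poly"
  assumes "degree A = 0" "degree B = 0" "degree C = 0" "degree p > 0"
    and eq: "A * p\<^sup>2 + B * p + C = 0"
  shows "A = 0" "B = 0" "C = 0"
proof -
  show A: "A = 0"
  proof (rule ccontr)
    assume "A \<noteq> 0"
    have "degree (B*p + C) < degree (A * p\<^sup>2)"
    proof -
      have "degree (B*p+C) \<le> degree p"
        using degree_add_le_max[of "B*p" C] degree_mult_le[of B p] assms by simp
      also have "\<dots> < degree (A*p\<^sup>2)" using assms \<open>A \<noteq> 0\<close>
        by (cases "p=0") (auto simp: degree_mult_eq degree_square_complex)
      finally show ?thesis .
    qed
    hence "degree (A*p\<^sup>2 + (B*p+C)) = degree (A*p\<^sup>2)" by (rule degree_add_eq_left)
    thus False using eq assms \<open>A\<noteq>0\<close>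
      by (cases "p=0") (auto simp: degree_mult_eq degree_square_complex add.assoc)
  qed
  show B: "B = 0"
  proof (rule ccontr)
    assume "B \<noteq> 0"
    have "degree (B*p + C) = degree (B*p)" using assms \<open>B\<noteq>0\<close>
      by (intro degree_add_eq_left) (cases "p=0"; auto simp: degree_mult_eq)
    thus False using eq A assms \<open>B\<noteq>0\<close> by (cases "p=0") (auto simp: degree_mult_eq)
  qed
  show "C = 0" using eq A B by simp
qed

lemma deg0_scale:
  fixes p m :: "complex poly" assumes "degree m = 0"
  shows "degree (m * p) \<le> degree p" "degree (p * m) \<le> degree p"
  using degree_mult_le[of m p] degree_mult_le[of p m] assms by auto

lemma deg0_scale_less:
  fixes p m :: "complex poly" assumes "degree m = 0" "degree p < n"
  shows "degree (m * p) < n" "degree (p * m) < n"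
  using deg0_scale[OF assms(1), of p] assms(2) by auto

lemma deg0_scale_le:
  fixes p m :: "complex poly" assumes "degree m = 0" "degree p \<le> n"
  shows "degree (m * p) \<le> n" "degree (p * m) \<le> n"
  using deg0_scale[OF assms(1), of p] assms(2) by auto

lemma deg0_scale_eq:
  fixes p m :: "complex poly" assumes "degree m = 0" "m \<noteq> 0"
  shows "degree (m * p) = degree p" "degree (p * m) = degree p"
  using assms by (cases "p = 0"; simp add: degree_mult_eq)+

lemma deg0_inverse:
  fixes q :: "complex poly" assumes "degree q = 0" "q \<noteq> 0"
  obtains q' where "degree q' = 0" "q * q' = 1"
proof -
  obtain q0 where "q = [:q0:]" using assms degree_eq_zeroE by blast
  thus ?thesis using that[of "[:inverse q0:]"] assms by (simp add: one_pCons)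
qed

lemma small_multiple_zero:
  fixes c p :: "complex poly" assumes "c dvd p" "degree p < degree c" shows "p = 0"
  using assms dvd_imp_degree_le[of c p] by auto

lemma cong_eq:
  fixes c p q z :: "complex poly"
  assumes "c dvd z - p" "c dvd z - q" "degree p < degree c" "degree q < degree c"
  shows "p = q"
proof -
  have "c dvd (z - q) - (z - p)" using assms dvd_diff by blast
  hence "c dvd p - q" by simp
  moreover have "degree (p - q) < degree c" using assms by (intro degree_diff_less)
  ultimately show ?thesis using small_multiple_zero by fastforce
qed

text \<open>How expansions modulo \<open>c\<^sup>2\<close> are compared: once the constant terms agree, so do the linear
  terms modulo \<open>c\<close>.\<close>
lemma cong_quotient:
  fixes c p q u v :: "complex poly"
  assumes "c\<^sup>2 dvd p - (q + c*u)" "c\<^sup>2 dvd p - (q + c*v)" "c \<noteq> 0"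
  shows "c dvd u - v"
proof -
  have "c\<^sup>2 dvd (p - (q + c*v)) - (p - (q + c*u))" using assms dvd_diff by blast
  hence "c * c dvd c * (u - v)" by (simp add: algebra_simps power2_eq_square)
  thus ?thesis using assms(3) by simp
qed

lemma dvd_twice: "c dvd 2 * p \<Longrightarrow> c dvd p" for c p :: "complex poly"
proof -
  assume "c dvd 2 * p"
  hence "c dvd [:1/2:] * (2 * p)" by (rule dvd_mult)
  moreover have "[:1/2:] * (2 * p) = p" by (simp add: numeral_poly)
  ultimately show "c dvd p" by simp
qed

text \<open>For \<open>u = 0\<close> the equation exhibits \<open>a\<close> as a factor of a nonzero constant. Otherwise completing the square in \<open>b\<close>
  makes a constant multiple of \<open>a\<^sup>2\<close> plus a nonzero constant a square; the multiple vanishes exactly when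
  \<open>\<kappa>\<^sup>2 = uv\<close>.\<close>
lemma dependence_const:
  fixes a b \<kappa> u v :: "complex poly"
  assumes eq: "4 * \<kappa>\<^sup>2 * (a * b + 1) = (u*b + v*a)\<^sup>2"
    and d: "degree \<kappa> = 0" "degree u = 0" "degree v = 0" and k: "\<kappa> \<noteq> 0" and uv: "\<kappa>\<^sup>2 \<noteq> u * v"
  shows "degree a = 0"
proof (rule ccontr)
  assume a: "degree a \<noteq> 0"
  show False
  proof (cases "u = 0")
    case True
    have "a * (v\<^sup>2 * a - 4*\<kappa>\<^sup>2*b) = 4*\<kappa>\<^sup>2" using eq True by algebra
    from unit_factors_deg0(1)[OF this] a d k show False by (simp add: deg0_simps)
  next
    case False
    have 1: "(16 * \<kappa>\<^sup>2 * (\<kappa>\<^sup>2 - u*v)) * a\<^sup>2 + 16 * u\<^sup>2*\<kappa>\<^sup>2 = (2*u\<^sup>2*b + (2*u*v - 4*\<kappa>\<^sup>2)*a)\<^sup>2"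
      using eq by algebra
    from no_square_shift[OF _ _ _ _ 1] have "16 * u\<^sup>2*\<kappa>\<^sup>2 = 0"
      using a d k uv by (simp add: deg0_simps)
    thus False using False k by simp
  qed
qed

lemma square_eq_cases: "(p::complex poly)\<^sup>2 = q\<^sup>2 \<Longrightarrow> p = q \<or> p = -q"
  by (rule power2_eq_iff[THEN iffD1])

lemma sign_cases: "(p::complex poly)\<^sup>2 = q\<^sup>2 \<Longrightarrow> \<exists>\<sigma>. (\<sigma> = 1 \<or> \<sigma> = -1) \<and> p = \<sigma>*q"
proof -
  assume "p\<^sup>2 = q\<^sup>2"
  hence "p = 1*q \<or> p = (-1)*q" using square_eq_cases by simp
  thus ?thesis by blast
qed

lemma sign_cancel:
  fixes u :: "complex poly"
  assumes "\<sigma> = 1 \<or> \<sigma> = -1" "\<sigma>' = 1 \<or> \<sigma>' = -1" "\<sigma>*u = \<sigma>'*u" "u \<noteq> 0"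
  shows "\<sigma> = \<sigma>'"
  using assms by auto

lemma sign_sq: "\<sigma> = 1 \<or> \<sigma> = -1 \<Longrightarrow> (\<sigma>*z)\<^sup>2 = (z::complex poly)\<^sup>2" by auto

lemma sign_deg: "\<sigma> = 1 \<or> \<sigma> = -1 \<Longrightarrow> degree (\<sigma>*z) = degree (z::complex poly)" by auto

text \<open>Eliminating \<open>p\<close> gives \<open>b u\<^sup>2 + (a - b) = a v\<^sup>2\<close>, and a constant \<open>a\<close> is a square.\<close>
lemma const_partner_unique:
  fixes p :: "complex poly"
  assumes "degree a = 0" "degree b = 0" "a \<noteq> 0" "b \<noteq> 0" "degree p > 0" "u\<^sup>2 = a*p+1" "v\<^sup>2 = b*p+1"
  shows "a = b"
proof -
  have du: "degree u > 0"
  proof (rule ccontr)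
    assume "\<not> degree u > 0"
    hence "degree (u\<^sup>2 - 1) = 0" by (simp add: deg0_simps)
    moreover have "u\<^sup>2 - 1 = a * p" using assms(6) by simp
    ultimately show False using assms by (cases "p=0") (auto simp: degree_mult_eq)
  qed
  obtain k where k: "degree k = 0" "k\<^sup>2 = a" using assms deg0_sqrt by blast
  have "b * u\<^sup>2 + (a - b) = (k*v)\<^sup>2" using assms(6,7) k(2) by algebra
  from no_square_shift[OF _ _ _ du this] show ?thesis using assms by (simp add: deg0_simps)
qed

lemma self_partner_const:
  fixes b :: "complex poly" assumes "q\<^sup>2 = b*b+1" shows "degree b = 0"
  using no_square_shift[of 1 1 b q] assms by (auto simp: power2_eq_square)

lemma deg_root:
  fixes a b r :: "complex poly"
  assumes "r\<^sup>2 = a*b+1" "a \<noteq> 0" "b \<noteq> 0" "degree a + degree b > 0"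
  shows "2 * degree r = degree a + degree b"
proof -
  have "degree (a*b + 1) = degree (a*b)" using assms by (intro degree_add_eq_left) (simp add: degree_mult_eq)
  thus ?thesis using assms by (simp add: degree_mult_eq flip: degree_square_complex)
qed

lemma deg_root_le:
  fixes a b r :: "complex poly"
  assumes "r\<^sup>2 = a*b+1"
  shows "2 * degree r \<le> degree a + degree b"
proof -
  have "degree (a*b + 1) \<le> degree a + degree b" using degree_add_le_max[of "a*b" 1] degree_mult_le[of a b] by simp
  thus ?thesis using assms by (simp flip: degree_square_complex)
qed

lemma degree_sum_ne:
  fixes p q :: "complex poly" assumes "degree p \<noteq> degree q"
  shows "degree (p + q) = max (degree p) (degree q)"
proof (cases "degree p < degree q")
  case True thus ?thesis by (simp add: degree_add_eq_right)
next
  case False thus ?thesis using assms by (simp add: degree_add_eq_left)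
qed

section \<open>Polynomials over the Gaussian rationals\<close>

lemma gauss_rats_closed:
  assumes "u \<in> gauss_rats" "v \<in> gauss_rats"
  shows "u + v \<in> gauss_rats" "u - v \<in> gauss_rats" "u * v \<in> gauss_rats" "-u \<in> gauss_rats"
proof -
  obtain x y x' y' where u: "u = x + y*\<i>" "x \<in> \<rat>" "y \<in> \<rat>" and v: "v = x' + y'*\<i>" "x' \<in> \<rat>" "y' \<in> \<rat>"
    using assms by (auto simp: gauss_rats_def)
  have "u + v = (x+x') + (y+y')*\<i>" "u - v = (x-x') + (y-y')*\<i>" "-u = (-x) + (-y)*\<i>"
    "u * v = (x*x' - y*y') + (x*y' + y*x')*\<i>"
    using u v by (simp_all add: algebra_simps)
  thus "u + v \<in> gauss_rats" "u - v \<in> gauss_rats" "u * v \<in> gauss_rats" "-u \<in> gauss_rats"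
    unfolding gauss_rats_def using u v by (blast intro: Rats_add Rats_diff Rats_mult Rats_minus_iff[THEN iffD2])+
qed

lemma gauss_rats_Rats: "u \<in> \<rat> \<Longrightarrow> u \<in> gauss_rats"
proof -
  assume "u \<in> \<rat>"
  moreover have "u = u + 0 * \<i>" by simp
  ultimately show ?thesis unfolding gauss_rats_def using Rats_0 by blast
qed

lemma gauss_rats_sum: "(\<And>i. i \<in> A \<Longrightarrow> f i \<in> gauss_rats) \<Longrightarrow> sum f A \<in> gauss_rats"
  by (induction A rule: infinite_finite_induct) (auto intro: gauss_rats_closed gauss_rats_Rats)

lemma gauss_polys_closed:
  assumes "p \<in> gauss_rat_polys" "q \<in> gauss_rat_polys"
  shows "p + q \<in> gauss_rat_polys" "p - q \<in> gauss_rat_polys" "p * q \<in> gauss_rat_polys" "-p \<in> gauss_rat_polys"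
  using assms by (auto simp: gauss_rat_polys_def coeff_mult intro!: gauss_rats_sum gauss_rats_closed)

lemma gauss_polys_numeral: "numeral n \<in> gauss_rat_polys" "1 \<in> gauss_rat_polys" "0 \<in> gauss_rat_polys"
  by (auto simp: gauss_rat_polys_def numeral_poly coeff_pCons intro!: gauss_rats_Rats split: nat.split)

lemma gauss_polys_const: "u \<in> gauss_rats \<Longrightarrow> [:u:] \<in> gauss_rat_polys"
  by (auto simp: gauss_rat_polys_def coeff_pCons intro!: gauss_rats_Rats split: nat.split)

lemmas gauss_polys_intros = gauss_polys_closed gauss_polys_numeral

section \<open>Orbits of a Pell equation\<close>

text \<open>The Chebyshev polynomials of both kinds at \<open>s\<close>, given by \<open>T + U \<surd>(s\<^sup>2-1) = (s + \<surd>(s\<^sup>2-1))\<^sup>n\<close>.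
  The index of the second kind is shifted by one against the usual numbering, so that \<open>U\<close> becomes odd
  when the index is extended to the integers.\<close>
fun cheb :: "complex poly \<Rightarrow> nat \<Rightarrow> complex poly \<times> complex poly" where
  "cheb s 0 = (1, 0)"
| "cheb s (Suc n) = (s * fst (cheb s n) + (s\<^sup>2 - 1) * snd (cheb s n), s * snd (cheb s n) + fst (cheb s n))"

definition cheb_T :: "complex poly \<Rightarrow> int \<Rightarrow> complex poly" where
  "cheb_T s k = fst (cheb s (nat \<bar>k\<bar>))"

definition cheb_U :: "complex poly \<Rightarrow> int \<Rightarrow> complex poly" where
  "cheb_U s k = (if k < 0 then - snd (cheb s (nat \<bar>k\<bar>)) else snd (cheb s (nat \<bar>k\<bar>)))"

lemma cheb_neg: "cheb_T s (-k) = cheb_T s k" "cheb_U s (-k) = - cheb_U s k"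
  by (auto simp: cheb_T_def cheb_U_def)

lemma cheb_zero [simp]: "cheb_T s 0 = 1" "cheb_U s 0 = 0" by (auto simp: cheb_T_def cheb_U_def)

lemma cheb_Suc:
  "cheb_T s (k+1) = s * cheb_T s k + (s\<^sup>2-1) * cheb_U s k"
  "cheb_U s (k+1) = s * cheb_U s k + cheb_T s k"
proof -
  have "cheb_T s (k+1) = s * cheb_T s k + (s\<^sup>2-1) * cheb_U s k \<and> cheb_U s (k+1) = s * cheb_U s k + cheb_T s k"
  proof (cases "k \<ge> 0")
    case True
    hence "nat \<bar>k+1\<bar> = Suc (nat \<bar>k\<bar>)" by simp
    thus ?thesis using True by (simp add: cheb_T_def cheb_U_def)
  next
    case False
    then obtain n where n: "k = - int (Suc n)" by (metis negD not_le)
    have "nat \<bar>k\<bar> = Suc n" "nat \<bar>k+1\<bar> = n" using n by auto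
    moreover have "k < 0" "k + 1 \<ge> 0 \<longleftrightarrow> n = 0" using n by auto
    ultimately show ?thesis
      by (cases n) (auto simp: cheb_T_def cheb_U_def algebra_simps power2_eq_square)
  qed
  thus "cheb_T s (k+1) = s * cheb_T s k + (s\<^sup>2-1) * cheb_U s k" "cheb_U s (k+1) = s * cheb_U s k + cheb_T s k" by auto
qed

lemma cheb_pred:
  "cheb_T s (k-1) = s * cheb_T s k - (s\<^sup>2-1) * cheb_U s k"
  "cheb_U s (k-1) = s * cheb_U s k - cheb_T s k"
  using cheb_Suc[of s "-k"] cheb_neg[of s "k-1"] cheb_neg[of s k] by (simp_all add: algebra_simps)

lemma cheb_one [simp]: "cheb_T s 1 = s" "cheb_U s 1 = 1" using cheb_Suc[of s 0] by auto

lemma cheb_add: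
  "cheb_T s (i+j) = cheb_T s i * cheb_T s j + (s\<^sup>2-1) * cheb_U s i * cheb_U s j \<and>
   cheb_U s (i+j) = cheb_T s i * cheb_U s j + cheb_U s i * cheb_T s j"
proof (induction j rule: int_induct[where k=0])
  case base thus ?case by simp
next
  case (step1 j)
  have "i + (j+1) = (i+j)+1" by simp
  thus ?case using step1 cheb_Suc[of s "i+j"] cheb_Suc[of s j] by (simp only:) (simp add: algebra_simps power2_eq_square)
next
  case (step2 j)
  have "i + (j-1) = (i+j)-1" by simp
  thus ?case using step2 cheb_pred[of s "i+j"] cheb_pred[of s j] by (simp only:) (simp add: algebra_simps power2_eq_square)
qed

lemma cheb_pell: "(cheb_T s k)\<^sup>2 - (s\<^sup>2-1) * (cheb_U s k)\<^sup>2 = 1"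
  using cheb_add[of s k "-k"] cheb_neg[of s k] by (simp add: power2_eq_square algebra_simps)

text \<open>Since \<open>s\<^sup>2 - 1 = ac\<close>, both polynomials can be expanded in powers of \<open>c\<close>. The factor 2 keeps the
  coefficients integral.\<close>
lemma cheb_mod:
  assumes ac: "s\<^sup>2 = a * c + 1"
  shows "(even k \<longrightarrow> (c\<^sup>2 dvd 2 * cheb_T s k - (2 + a*c*of_int (k\<^sup>2)) \<and> c dvd cheb_U s k - of_int k * s))
       \<and> (odd k \<longrightarrow> (c\<^sup>2 dvd 2 * cheb_T s k - s*(2 + a*c*of_int (k\<^sup>2-1)) \<and> c dvd cheb_U s k - of_int k))"
    (is "?P k")
proof -
  have step: "?P (k+1)" if P: "?P k" for k
  proof (cases "even k")
    case True
    then obtain f g where "2 * cheb_T s k - (2 + a*c*of_int (k\<^sup>2)) = c\<^sup>2*f" and "cheb_U s k - of_int k * s = c*g"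
      using P by (auto elim!: dvdE)
    hence f: "2 * cheb_T s k = (2 + a*c*(of_int k)\<^sup>2) + c\<^sup>2*f" and g: "cheb_U s k = of_int k * s + c*g"
      by (simp_all add: algebra_simps)
    have TS: "cheb_T s (k+1) = s * cheb_T s k + a*c * cheb_U s k" "cheb_U s (k+1) = s * cheb_U s k + cheb_T s k"
      using cheb_Suc[of s k] ac by auto
    have "2*cheb_T s (k+1) - s*(2 + a*c*((of_int k+1)\<^sup>2-1)) = c\<^sup>2 * (s*f + 2*a*g)"
      using f g TS(1) by algebra
    moreover have "2*(cheb_U s (k+1) - (of_int k+1)) = c * (2*a*of_int k + 2*s*g + a*(of_int k)\<^sup>2 + c*f)"
      using f g ac TS(2) by algebra
    ultimately show ?thesis using True
      by (auto intro!: dvd_twice[of c "cheb_U s (k+1) - (of_int k+1)"])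
  next
    case False
    then obtain f g where "2 * cheb_T s k - s*(2 + a*c*of_int (k\<^sup>2-1)) = c\<^sup>2*f" and "cheb_U s k - of_int k = c*g"
      using P by (auto elim!: dvdE)
    hence f: "2 * cheb_T s k = s*(2 + a*c*((of_int k)\<^sup>2-1)) + c\<^sup>2*f" and g: "cheb_U s k = of_int k + c*g"
      by (simp_all add: algebra_simps)
    have TS: "cheb_T s (k+1) = s * cheb_T s k + a*c * cheb_U s k" "cheb_U s (k+1) = s * cheb_U s k + cheb_T s k"
      using cheb_Suc[of s k] ac by auto
    have "2*cheb_T s (k+1) - (2 + a*c*(of_int k+1)\<^sup>2) = c\<^sup>2 * (s*f + 2*a*g + a\<^sup>2*((of_int k)\<^sup>2-1))"
      using f g ac TS(1) by algebra
    moreover have "2*(cheb_U s (k+1) - (of_int k+1)*s) = c * (2*s*g + s*a*((of_int k)\<^sup>2-1) + c*f)"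
      using f g ac TS(2) by algebra
    ultimately show ?thesis using False
      by (auto intro!: dvd_twice[of c "cheb_U s (k+1) - (of_int k+1)*s"])
  qed
  \<comment> \<open>The expansions are even in \<open>k\<close> for \<open>T\<close> and odd for \<open>U\<close>, so downward steps reduce to upward ones.\<close>
  have neg: "?P (-k)" if "?P k" for k
  proof -
    have "c dvd cheb_U s (-k) - of_int (-k) * s" if "c dvd cheb_U s k - of_int k * s"
      using that dvd_minus_iff[of c "cheb_U s k - of_int k * s"] by (simp add: cheb_neg algebra_simps)
    moreover have "c dvd cheb_U s (-k) - of_int (-k)" if "c dvd cheb_U s k - of_int k"
      using that dvd_minus_iff[of c "cheb_U s k - of_int k"] by (simp add: cheb_neg algebra_simps)
    ultimately show ?thesis using \<open>?P k\<close> by (simp add: cheb_neg)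
  qed
  show ?thesis
  proof (induction k rule: int_induct[where k=0])
    case base show ?case by simp
  next
    case (step1 i) thus ?case using step by blast
  next
    case (step2 i)
    have "?P (- ((-i) + 1))" using step2(2) neg[of i] step[of "-i"] neg[of "-i+1"] by blast
    thus ?case by (simp only: minus_add_distrib minus_minus diff_conv_add_uminus)
  qed
qed

text \<open>The coordinates of \<open>(z0 \<surd>a + x0 \<surd>c) (s + \<surd>(ac))\<^sup>k\<close> with respect to \<open>\<surd>a\<close> and \<open>\<surd>c\<close>, where
  \<open>s\<^sup>2 = ac + 1\<close>.\<close>
definition orbit_z where "orbit_z s c z0 x0 k = cheb_T s k * z0 + c * cheb_U s k * x0"

definition orbit_x where "orbit_x s a z0 x0 k = cheb_T s k * x0 + a * cheb_U s k * z0"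

lemma orbit_z_shift:
  assumes "s'\<^sup>2 = a'*c'+1"
  shows "orbit_z s' c' z0 x0 (k+j) = orbit_z s' c' (orbit_z s' c' z0 x0 j) (orbit_x s' a' z0 x0 j) k"
proof -
  have "cheb_T s' (k+j) = cheb_T s' k * cheb_T s' j + (s'\<^sup>2-1) * cheb_U s' k * cheb_U s' j"
       "cheb_U s' (k+j) = cheb_T s' k * cheb_U s' j + cheb_U s' k * cheb_T s' j" using cheb_add by auto
  moreover have "s'\<^sup>2 - 1 = a'*c'" using assms by simp
  ultimately show ?thesis unfolding orbit_z_def orbit_x_def by (simp add: algebra_simps)
qed

lemma orbit_z_neg: "orbit_z s c z0 x0 (-k) = orbit_z s c z0 (-x0) k" by (simp add: orbit_z_def cheb_neg)

lemma orbit_z_minus: "orbit_z s c (-z0) x0 k = - orbit_z s c z0 (-x0) k" by (simp add: orbit_z_def)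

lemma orbit_z_flip:
  assumes "x0\<^sup>2 = v\<^sup>2" shows "\<exists>M'. even M' = even M \<and> orbit_z s c z0 x0 M = orbit_z s c z0 v M'"
  using square_eq_cases[OF assms]
proof
  assume "x0 = -v" thus ?thesis using orbit_z_neg[of s c z0 v M] by (intro exI[of _ "-M"]) simp
qed blast

text \<open>A starting point is known up to two signs by its squares. The sign of \<open>x0\<close> is absorbed by reversing
  the orbit, which keeps the parity of the exponent, and the common sign by passing to \<open>-z\<close>.\<close>
lemma orbit_start_sign:
  assumes "z = orbit_z s c z0 x0 M" "x0\<^sup>2 = v\<^sup>2" "z0\<^sup>2 = u\<^sup>2"
  obtains \<sigma> M' where "\<sigma> = 1 \<or> \<sigma> = -1" "even M' = even M" "z0 = \<sigma>*u" "\<sigma>*z = orbit_z s c u v M'"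
  using square_eq_cases[OF assms(3)]
proof
  assume "z0 = u"
  then obtain M' where "even M' = even M" "z = orbit_z s c u v M'" using orbit_z_flip[OF assms(2)] assms(1) by metis
  thus ?thesis using that[of 1 M'] \<open>z0 = u\<close> by simp
next
  assume z0: "z0 = -u"
  have "(-x0)\<^sup>2 = v\<^sup>2" using assms by simp
  then obtain M' where "even M' = even M" "orbit_z s c u (-x0) M = orbit_z s c u v M'" using orbit_z_flip by metis
  thus ?thesis using that[of "-1" M'] z0 assms(1) orbit_z_minus by simp
qed

lemma orbit_start_fixed_sign:
  assumes "z = orbit_z s' c z0 x0 M" "x0\<^sup>2 = v\<^sup>2" "z0 = \<sigma>*u" "\<sigma> = 1 \<or> \<sigma> = -1" "u \<noteq> 0"
  shows "\<exists>M'. even M' = even M \<and> \<sigma>*z = orbit_z s' c u v M'"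
proof -
  have "z0\<^sup>2 = u\<^sup>2" using assms(3,4) sign_sq by auto
  then obtain \<sigma>' M' where 1: "\<sigma>' = 1 \<or> \<sigma>' = -1" "even M' = even M" "z0 = \<sigma>'*u" "\<sigma>'*z = orbit_z s' c u v M'"
    by (rule orbit_start_sign[OF assms(1,2)]) (rule that, assumption+)
  have "\<sigma>' = \<sigma>" using 1 assms sign_cancel by blast
  thus ?thesis using 1 by blast
qed

text \<open>The Pell equation that arises from \<open>z\<^sup>2 = cd+1\<close> and \<open>x\<^sup>2 = ad+1\<close> by eliminating \<open>d\<close>.\<close>
locale pell_pair =
  fixes a c s z x :: "complex poly"
  assumes ss: "s\<^sup>2 = a*c + 1" and nz: "a \<noteq> 0" "c \<noteq> 0" "a \<noteq> c"
    and deg: "degree a \<le> degree c" "0 < degree c"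
    and norm: "a * z\<^sup>2 - c * x\<^sup>2 = a - c"
begin

lemma deg_s: "2 * degree s = degree a + degree c"
proof -
  have "degree (a*c + 1) = degree (a*c)" using nz deg by (intro degree_add_eq_left) (simp add: degree_mult_eq)
  thus ?thesis using ss nz by (simp add: degree_mult_eq flip: degree_square_complex)
qed

lemma orbit_Suc: "orbit_z s c z x (k+1) = s * orbit_z s c z x k + c * orbit_x s a z x k"
  "orbit_x s a z x (k+1) = s * orbit_x s a z x k + a * orbit_z s c z x k"
  unfolding orbit_z_def orbit_x_def cheb_Suc using ss by algebra+

lemma orbit_pred: "orbit_z s c z x (k-1) = s * orbit_z s c z x k - c * orbit_x s a z x k"
  "orbit_x s a z x (k-1) = s * orbit_x s a z x k - a * orbit_z s c z x k"
  unfolding orbit_z_def orbit_x_def cheb_pred using ss by algebra+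

lemma orbit_z_rec: "orbit_z s c z x (k+1) + orbit_z s c z x (k-1) = 2 * s * orbit_z s c z x k"
  by (simp add: orbit_Suc orbit_pred)

lemma orbit_norm: "a * (orbit_z s c z x k)\<^sup>2 - c * (orbit_x s a z x k)\<^sup>2 = a - c"
proof -
  have "a * (orbit_z s c z x k)\<^sup>2 - c * (orbit_x s a z x k)\<^sup>2 = ((cheb_T s k)\<^sup>2 - (s\<^sup>2-1)*(cheb_U s k)\<^sup>2) * (a * z\<^sup>2 - c * x\<^sup>2)"
    using ss unfolding orbit_z_def orbit_x_def by algebra
  thus ?thesis using cheb_pell[of s k] norm by simp
qed

lemma orbit_z_prod: "orbit_z s c z x (k+1) * orbit_z s c z x (k-1) = (orbit_z s c z x k)\<^sup>2 + c * (a - c)"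
  using orbit_norm[of k] ss unfolding orbit_Suc orbit_pred by algebra

end

lemma orbit_inverse:
  assumes "s\<^sup>2 = a*c + 1"
  shows "orbit_z s c (orbit_z s c z x k) (orbit_x s a z x k) (-k) = z" "orbit_x s a (orbit_z s c z x k) (orbit_x s a z x k) (-k) = x"
proof -
  have "orbit_z s c (orbit_z s c z x k) (orbit_x s a z x k) (-k) = ((cheb_T s k)\<^sup>2 - (s\<^sup>2-1)*(cheb_U s k)\<^sup>2) * z"
    using assms unfolding orbit_z_def orbit_x_def cheb_neg by algebra
  moreover have "orbit_x s a (orbit_z s c z x k) (orbit_x s a z x k) (-k) = ((cheb_T s k)\<^sup>2 - (s\<^sup>2-1)*(cheb_U s k)\<^sup>2) * x"
    using assms unfolding orbit_z_def orbit_x_def cheb_neg by algebra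
  ultimately show "orbit_z s c (orbit_z s c z x k) (orbit_x s a z x k) (-k) = z" "orbit_x s a (orbit_z s c z x k) (orbit_x s a z x k) (-k) = x"
    using cheb_pell[of s k] by auto
qed

context pell_pair begin

text \<open>Among the even exponents let \<open>k\<close> be one at which \<open>z\<close> has least degree. The two neighbours of
  \<open>z\<^sub>k\<close> in the orbit have the sum \<open>2 s z\<^sub>k\<close> and the product \<open>z\<^sub>k\<^sup>2 + c(a-c)\<close>. If \<open>z\<^sub>k\<close> is not already
  smaller than \<open>c\<close>, the sum makes one neighbour large, and the product then makes the other one small.\<close>
lemma descent_aux:
  obtains k where "even k" "degree (orbit_z s c z x k) < degree c"
   | k where "odd k" "2 * degree (orbit_z s c z x k) + degree a \<le> degree c"
proof -
  let ?z = "orbit_z s c z x"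
  obtain k where k: "even k" and min: "\<And>j. even j \<Longrightarrow> degree (?z k) \<le> degree (?z j)"
    using ex_has_least_nat[of even 0 "\<lambda>k. degree (?z k)"] by auto
  show ?thesis
  proof (cases "degree (?z k) < degree c")
    case True thus ?thesis using that k by blast
  next
    case False
    define g where "g = degree (?z k)"
    have g: "g \<ge> degree c" using False g_def by simp
    have zk: "?z k \<noteq> 0" "s \<noteq> 0" using False deg deg_s by auto
    have dsz: "degree (2 * s * ?z k) = degree s + g" using zk by (simp add: degree_mult_eq g_def)
    have prod: "degree (?z (k+1) * ?z (k-1)) \<le> 2*g"
    proof -
      have "degree (c*(a-c)) \<le> 2*degree c"
        using degree_mult_le[of c "a-c"] degree_diff_le_max[of a c] deg by simp
      thus ?thesis unfolding orbit_z_prod using g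
        by (intro degree_add_le) (auto simp: degree_square_complex g_def)
    qed
    \<comment> \<open>If one neighbour of position \<open>k\<close> is as large as the sum of the neighbours, then the product
      bounds the other one; minimality of \<open>k\<close>, applied two steps away, makes the bound sharp.\<close>
    have core: "2 * degree (?z (k-\<tau>)) + degree a \<le> degree c"
      if \<tau>: "\<tau> = 1 \<or> \<tau> = -1" and big: "degree (?z (k+\<tau>)) \<ge> degree s + g" for \<tau>
    proof (cases "?z (k-\<tau>) = 0")
      case True
      have "?z (k-\<tau>+1) * ?z (k-\<tau>-1) = c*(a-c)" using True orbit_z_prod[of "k-\<tau>"] by simp
      hence *: "?z k * ?z (k-\<tau>-\<tau>) = c*(a-c)" using \<tau> by (auto simp: algebra_simps)
      hence "?z (k-\<tau>-\<tau>) \<noteq> 0" using nz by auto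
      hence "g + degree (?z (k-\<tau>-\<tau>)) \<le> 2 * degree c"
        using arg_cong[OF *, of degree] zk degree_diff_le_max[of a c] deg nz by (simp add: degree_mult_eq g_def)
      thus ?thesis using True deg by simp
    next
      case False
      have "?z (k+\<tau>) \<noteq> 0" using big g deg by auto
      hence "degree (?z (k+\<tau>)) + degree (?z (k-\<tau>)) \<le> 2*g"
        using prod \<tau> False by (auto simp: degree_mult_eq add.commute)
      hence small: "degree (?z (k-\<tau>)) + degree s \<le> g" using big by simp
      have "?z (k-\<tau>+1) * ?z (k-\<tau>-1) = (?z (k-\<tau>))\<^sup>2 + c*(a-c)" by (rule orbit_z_prod)
      hence *: "?z k * ?z (k-\<tau>-\<tau>) = (?z (k-\<tau>))\<^sup>2 + c*(a-c)" using \<tau> by (auto simp: algebra_simps)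
      have ge: "degree (?z (k-\<tau>-\<tau>)) \<ge> g" unfolding g_def using \<tau> k by (intro min) auto
      hence "?z (k-\<tau>-\<tau>) \<noteq> 0" using g deg by auto
      hence "degree ((?z (k-\<tau>))\<^sup>2 + c*(a-c)) \<ge> 2*g" using ge zk * by (simp add: degree_mult_eq g_def flip: *)
      moreover have "degree ((?z (k-\<tau>))\<^sup>2 + c*(a-c)) \<le> max (2 * degree (?z (k-\<tau>))) (2*degree c)"
        using degree_add_le_max[of "(?z (k-\<tau>))\<^sup>2" "c*(a-c)"] degree_mult_le[of c "a-c"] degree_diff_le_max[of a c] deg
        by (simp add: degree_square_complex)
      ultimately have "g = degree c" using small g deg deg_s by auto
      thus ?thesis using small deg_s by simp
    qed
    have "degree (?z (k+1)) \<ge> degree s + g \<or> degree (?z (k-1)) \<ge> degree s + g"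
    proof (rule ccontr)
      assume "\<not> ?thesis"
      hence "degree (?z (k+1) + ?z (k-1)) < degree s + g" by (intro degree_add_less) auto
      thus False using orbit_z_rec[of k] dsz by simp
    qed
    thus ?thesis
    proof
      assume "degree (?z (k+1)) \<ge> degree s + g"
      from core[of 1] this have "2 * degree (?z (k-1)) + degree a \<le> degree c" by simp
      thus ?thesis using that(2)[of "k-1"] k by simp
    next
      assume "degree (?z (k-1)) \<ge> degree s + g"
      from core[of "-1"] this have "2 * degree (?z (k+1)) + degree a \<le> degree c" by simp
      thus ?thesis using that(2)[of "k+1"] k by simp
    qed
  qed
qed

text \<open>One step along an orbit replaces \<open>d'\<close> by a regular extension \<open>a+c+d'+2acd' \<plusminus> 2szx\<close> of
  \<open>{a, c, d'}\<close>.\<close>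
lemma orbit_gauss:
  assumes gp: "a \<in> gauss_rat_polys" "c \<in> gauss_rat_polys" "s \<in> gauss_rat_polys"
    "z \<in> gauss_rat_polys" "x \<in> gauss_rat_polys" "d \<in> gauss_rat_polys"
   and zx: "z\<^sup>2 = c*d+1" "x\<^sup>2 = a*d+1"
  shows "\<exists>d'\<in>gauss_rat_polys. orbit_z s c z x k \<in> gauss_rat_polys \<and> orbit_x s a z x k \<in> gauss_rat_polys
    \<and> (orbit_z s c z x k)\<^sup>2 = c*d'+1 \<and> (orbit_x s a z x k)\<^sup>2 = a*d'+1"
proof (induction k rule: int_induct[where k=0])
  case base thus ?case using assms by (auto simp: orbit_z_def orbit_x_def)
next
  case (step1 k)
  then obtain d' where d': "d'\<in>gauss_rat_polys" "orbit_z s c z x k \<in> gauss_rat_polys" "orbit_x s a z x k \<in> gauss_rat_polys"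
    "(orbit_z s c z x k)\<^sup>2 = c*d'+1" "(orbit_x s a z x k)\<^sup>2 = a*d'+1" by auto
  let ?d = "a + c + d' + 2*a*c*d' + 2*s*orbit_z s c z x k*orbit_x s a z x k"
  have "(orbit_z s c z x (k+1))\<^sup>2 = c * ?d + 1" "(orbit_x s a z x (k+1))\<^sup>2 = a * ?d + 1"
    unfolding orbit_Suc using d'(4,5) ss by algebra+
  moreover have "?d \<in> gauss_rat_polys" "orbit_z s c z x (k+1) \<in> gauss_rat_polys" "orbit_x s a z x (k+1) \<in> gauss_rat_polys"
    unfolding orbit_Suc using d'(1-3) gp by (auto intro!: gauss_polys_intros)
  ultimately show ?case by blast
next
  case (step2 k)
  then obtain d' where d': "d'\<in>gauss_rat_polys" "orbit_z s c z x k \<in> gauss_rat_polys" "orbit_x s a z x k \<in> gauss_rat_polys"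
    "(orbit_z s c z x k)\<^sup>2 = c*d'+1" "(orbit_x s a z x k)\<^sup>2 = a*d'+1" by auto
  let ?d = "a + c + d' + 2*a*c*d' - 2*s*orbit_z s c z x k*orbit_x s a z x k"
  have "(orbit_z s c z x (k-1))\<^sup>2 = c * ?d + 1" "(orbit_x s a z x (k-1))\<^sup>2 = a * ?d + 1"
    unfolding orbit_pred using d'(4,5) ss by algebra+
  moreover have "?d \<in> gauss_rat_polys" "orbit_z s c z x (k-1) \<in> gauss_rat_polys" "orbit_x s a z x (k-1) \<in> gauss_rat_polys"
    unfolding orbit_pred using d'(1-3) gp by (auto intro!: gauss_polys_intros)
  ultimately show ?case by blast
qed

end

text \<open>As soon as one step does not lower the degree, the recurrence \<open>z\<^sub>k\<^sub>+\<^sub>1 = 2 s z\<^sub>k - z\<^sub>k\<^sub>-\<^sub>1\<close> adds the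
  degree of \<open>s\<close> at every further step.\<close>
lemma orbit_z_degree_pos:
  assumes ss: "s\<^sup>2 = a*c+1" and s: "degree s > 0"
    and le: "degree z0 \<le> degree (s*z0 + c*x0)" "s*z0 + c*x0 \<noteq> 0" and k: "k \<ge> 1"
  shows "degree (orbit_z s c z0 x0 k) = degree (s*z0+c*x0) + nat (k-1) * degree s"
proof -
  have rec: "orbit_z s c z0 x0 (k+1) = 2*s*orbit_z s c z0 x0 k - orbit_z s c z0 x0 (k-1)" for k
    unfolding orbit_z_def cheb_Suc cheb_pred by algebra
  have "degree (orbit_z s c z0 x0 k) = degree (s*z0+c*x0) + nat (k-1) * degree s \<and> orbit_z s c z0 x0 k \<noteq> 0
     \<and> degree (orbit_z s c z0 x0 (k-1)) \<le> degree (orbit_z s c z0 x0 k)"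
    using k
  proof (induction k rule: int_ge_induct)
    case base thus ?case using le by (simp add: orbit_z_def)
  next
    case (step k)
    have "degree (2*s*orbit_z s c z0 x0 k) = degree s + degree (orbit_z s c z0 x0 k)"
      using step s by (cases "s = 0") (auto simp: degree_mult_eq mult.assoc)
    moreover have "degree (2*s*orbit_z s c z0 x0 k - orbit_z s c z0 x0 (k-1)) = degree (2*s*orbit_z s c z0 x0 k)"
      using step s calculation degree_add_eq_left[of "- orbit_z s c z0 x0 (k-1)" "2*s*orbit_z s c z0 x0 k"] by simp
    ultimately have "degree (orbit_z s c z0 x0 (k+1)) = degree s + degree (orbit_z s c z0 x0 k)" using rec by simp
    moreover have "orbit_z s c z0 x0 (k+1) \<noteq> 0" using calculation s by auto
    moreover have "nat (k + 1 - 1) = Suc (nat (k-1))" using step by simp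
    ultimately show ?case using step s by simp
  qed
  thus ?thesis by blast
qed

lemma orbit_z_degree_neg:
  assumes ss: "s\<^sup>2 = a*c+1" and s: "degree s > 0"
    and le: "degree z0 \<le> degree (s*z0 - c*x0)" "s*z0 - c*x0 \<noteq> 0" and k: "k \<le> -1"
  shows "degree (orbit_z s c z0 x0 k) = degree (s*z0-c*x0) + nat (-k-1) * degree s"
  using orbit_z_degree_pos[OF ss s, of z0 "-x0" "-k"] le k orbit_z_neg[of s c z0 x0 "-k"] by simp

text \<open>The term linear in \<open>c\<close> carries the exponent. Comparing it for two orbits through the same
  polynomial ties their exponents to each other.\<close>
lemma orbit_z_mod:
  assumes ss: "s\<^sup>2 = a*c+1"
  shows "even k \<Longrightarrow> c\<^sup>2 dvd 2*orbit_z s c z0 x0 k - (2*z0 + c*(a*z0*(of_int k)\<^sup>2 + 2*of_int k*s*x0))"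
    "odd k \<Longrightarrow> c\<^sup>2 dvd 2*orbit_z s c z0 x0 k - (2*s*z0 + c*(a*s*z0*((of_int k)\<^sup>2-1) + 2*of_int k*x0))"
proof -
  assume "even k"
  then obtain f g where "2 * cheb_T s k - (2 + a*c*of_int (k\<^sup>2)) = c\<^sup>2*f" and "cheb_U s k - of_int k * s = c*g"
    using cheb_mod[OF ss, of k] by (auto elim!: dvdE)
  hence "2*orbit_z s c z0 x0 k - (2*z0 + c*(a*z0*(of_int k)\<^sup>2 + 2*of_int k*s*x0)) = c\<^sup>2 * (f*z0 + 2*g*x0)"
    unfolding orbit_z_def of_int_power by algebra
  thus "c\<^sup>2 dvd 2*orbit_z s c z0 x0 k - (2*z0 + c*(a*z0*(of_int k)\<^sup>2 + 2*of_int k*s*x0))" by simp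
next
  assume "odd k"
  then obtain f g where "2 * cheb_T s k - s*(2 + a*c*of_int (k\<^sup>2-1)) = c\<^sup>2*f" and "cheb_U s k - of_int k = c*g"
    using cheb_mod[OF ss, of k] by (auto elim!: dvdE)
  hence "2*orbit_z s c z0 x0 k - (2*s*z0 + c*(a*s*z0*((of_int k)\<^sup>2-1) + 2*of_int k*x0)) = c\<^sup>2 * (f*z0 + 2*g*x0)"
    unfolding orbit_z_def of_int_power of_int_diff of_int_1 by algebra
  thus "c\<^sup>2 dvd 2*orbit_z s c z0 x0 k - (2*s*z0 + c*(a*s*z0*((of_int k)\<^sup>2-1) + 2*of_int k*x0))" by simp
qed

text \<open>The solution supplied by \<open>descent_aux\<close> belongs to some \<open>d0\<close>, and unless \<open>d0 = 0\<close> its degree is given by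
  \<open>degree c + degree d0 = 2 * degree z0\<close>. At an odd position the bound on \<open>z0\<close> is so strong that \<open>d0\<close> is constant.\<close>
lemma (in pell_pair) descent:
  assumes gp: "a \<in> gauss_rat_polys" "c \<in> gauss_rat_polys" "s \<in> gauss_rat_polys"
    "z \<in> gauss_rat_polys" "x \<in> gauss_rat_polys" "d \<in> gauss_rat_polys"
   and zx: "z\<^sup>2 = c*d+1" "x\<^sup>2 = a*d+1"
  obtains M z0 x0 d0 where "z = orbit_z s c z0 x0 M" "z0\<^sup>2 = c*d0+1" "x0\<^sup>2 = a*d0+1"
    "z0 \<in> gauss_rat_polys" "x0 \<in> gauss_rat_polys" "d0 \<in> gauss_rat_polys" "degree d0 < degree c"
    "(even M \<and> degree z0 < degree c \<and> c dvd z - z0)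
     \<or> (odd M \<and> c dvd z - s * z0 \<and> degree d0 = 0 \<and> (degree a > 0 \<longrightarrow> d0 = 0))"
proof -
  obtain k where k: "(even k \<and> degree (orbit_z s c z x k) < degree c) \<or> (odd k \<and> 2 * degree (orbit_z s c z x k) + degree a \<le> degree c)"
    by (rule descent_aux) blast+
  let ?z = "orbit_z s c z x k" let ?x = "orbit_x s a z x k"
  obtain d' where d': "d' \<in> gauss_rat_polys" "?z \<in> gauss_rat_polys" "?x \<in> gauss_rat_polys" "?z\<^sup>2 = c*d'+1" "?x\<^sup>2 = a*d'+1"
    using orbit_gauss[OF gp zx] by blast
  have inv: "z = orbit_z s c ?z ?x (-k)" using orbit_inverse(1)[OF ss, of z x k] by simp
  have cong_ev: "c dvd z - ?z" if "even k"
  proof -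
    have "c\<^sup>2 dvd 2*z - (2*?z + c*(a*?z*(of_int (-k))\<^sup>2 + 2*of_int (-k)*s*?x))"
      using orbit_z_mod(1)[OF ss, of "-k" ?z ?x] inv that by simp
    hence "c dvd 2*z - (2*?z + c*(a*?z*(of_int (-k))\<^sup>2 + 2*of_int (-k)*s*?x))"
      by (metis dvd_mult_left power2_eq_square)
    hence "c dvd (2*z - (2*?z + c*(a*?z*(of_int (-k))\<^sup>2 + 2*of_int (-k)*s*?x))) + c*(a*?z*(of_int (-k))\<^sup>2 + 2*of_int (-k)*s*?x)"
      by (rule dvd_add) simp
    hence "c dvd 2 * (z - ?z)" by (simp add: algebra_simps)
    thus ?thesis by (rule dvd_twice)
  qed
  have cong_od: "c dvd z - s*?z" if "odd k"
  proof -
    let ?w = "a*s*?z*((of_int (-k))\<^sup>2-1) + 2*of_int (-k)*?x"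
    have "c\<^sup>2 dvd 2*z - (2*s*?z + c*?w)"
      using orbit_z_mod(2)[OF ss, of "-k" ?z ?x] inv that by simp
    hence "c dvd 2*z - (2*s*?z + c*?w)"
      by (metis dvd_mult_left power2_eq_square)
    hence "c dvd (2*z - (2*s*?z + c*?w)) + c*?w"
      by (rule dvd_add) simp
    hence "c dvd 2 * (z - s*?z)" by (simp add: algebra_simps)
    thus ?thesis by (rule dvd_twice)
  qed
  have degree_relations: "d' = 0 \<or> degree c + degree d' = 2 * degree ?z"
    using deg_root[OF d'(4)] nz deg by (cases "d' = 0") auto
  have "degree d' < degree c" "odd k \<Longrightarrow> degree d' = 0" "odd k \<Longrightarrow> degree a > 0 \<Longrightarrow> d' = 0"
    using degree_relations k deg by auto
  thus ?thesis using that[of ?z ?x "-k" d'] inv d' k cong_ev cong_od by auto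
qed

section \<open>Extensions of a Diophantine triple\<close>

definition D1_regular :: "complex poly \<Rightarrow> complex poly \<Rightarrow> complex poly \<Rightarrow> complex poly \<Rightarrow> bool" where
  "D1_regular a b c d \<longleftrightarrow> (a + b - c - d)\<^sup>2 = 4 * (a*b+1) * (c*d+1)"

text \<open>Regularity as a quadratic equation for \<open>d\<close>. For a triple with roots \<open>r, s, t\<close> the right-hand side is
  \<open>(2rst)\<^sup>2\<close>, which gives the two regular extensions.\<close>
lemma D1_regular_iff: "D1_regular a b c d \<longleftrightarrow> (d - (a+b+c+2*a*b*c))\<^sup>2 = 4*(a*b+1)*(a*c+1)*(b*c+1)"
proof -
  have "(a + b - c - d)\<^sup>2 - 4 * (a*b+1) * (c*d+1) = (d - (a+b+c+2*a*b*c))\<^sup>2 - 4*(a*b+1)*(a*c+1)*(b*c+1)"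
    by algebra
  thus ?thesis unfolding D1_regular_def by (metis eq_iff_diff_eq_0)
qed

text \<open>The product of the two regular extensions is a polynomial in \<open>a, b, c\<close> alone; its degree bounds the
  smaller extension once the degree of the larger one is known.\<close>
lemma extension_roots:
  fixes a b c :: "complex poly"
  assumes "r\<^sup>2 = a*b+1" "s\<^sup>2 = a*c+1" "t\<^sup>2 = b*c+1" and e: "e = a+b+c+2*a*b*c - 2*r*s*t"
  shows "(a*t - r*s)\<^sup>2 = a*e+1" "(b*s - r*t)\<^sup>2 = b*e+1" "(c*r - s*t)\<^sup>2 = c*e+1"
    "e * (a+b+c+2*a*b*c + 2*r*s*t) = a\<^sup>2+b\<^sup>2+c\<^sup>2-2*a*b-2*a*c-2*b*c-4"
  using assms(1-3) unfolding e by algebra+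

text \<open>Extending is reversible: \<open>c\<close> is the other regular extension of \<open>{a, b, e}\<close>, and the roots can be
  recovered from the roots belonging to \<open>e\<close>.\<close>
lemma extension_inverse:
  fixes a b c :: "complex poly"
  assumes "r\<^sup>2 = a*b+1" "s\<^sup>2 = a*c+1" "t\<^sup>2 = b*c+1" "e = a+b+c+2*a*b*c - 2*r*s*t"
     "s' = a*t - r*s" "t' = b*s - r*t"
  shows "c = a+b+e+2*a*b*e + 2*r*s'*t'" "s = -(a*t' + r*s')" "t = -(b*s' + r*t')"
  using assms(1-3) unfolding assms(4-6) by algebra+

text \<open>The sum of the two extensions is \<open>2(a+b+c+2abc)\<close>, so at least one of them has the degree of \<open>abc\<close>. The sign of
  \<open>r\<close> selects it.\<close>
lemma large_extension:
  fixes a b c :: "complex poly"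
  assumes sq: "r\<^sup>2 = a*b+1" "s\<^sup>2 = a*c+1" "t\<^sup>2 = b*c+1"
    and nz: "a \<noteq> 0" "b \<noteq> 0" "c \<noteq> 0"
    and small: "degree a < degree a + degree b + degree c" "degree b < degree a + degree b + degree c"
      "degree c < degree a + degree b + degree c"
  obtains \<rho> where "\<rho> = r \<or> \<rho> = -r" "degree (a+b+c+2*a*b*c + 2*\<rho>*s*t) = degree a + degree b + degree c"
proof -
  let ?n = "degree a + degree b + degree c" let ?D = "a+b+c+2*a*b*c"
  have d3: "degree (2*a*b*c) = ?n" using nz by (simp add: degree_mult_eq mult.assoc)
  have "degree (a+b+c) < ?n" using small by (intro degree_add_less)
  hence D: "degree ?D = ?n" using degree_add_eq_right[of "a+b+c" "2*a*b*c"] d3 by simp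
  have "degree (r*s*t) \<le> degree r + degree s + degree t"
    using degree_mult_le[of "r*s" t] degree_mult_le[of r s] by simp
  hence "degree (r*s*t) \<le> ?n"
    using deg_root_le[OF sq(1)] deg_root_le[OF sq(2)] deg_root_le[OF sq(3)] by simp
  hence rst: "degree (2*r*s*t) \<le> ?n" "degree (2*(-r)*s*t) \<le> ?n" by (simp_all add: mult.assoc)
  have sum: "(?D + 2*r*s*t) + (?D + 2*(-r)*s*t) = 2 * ?D" by algebra
  have le: "degree (?D + 2*r*s*t) \<le> ?n" "degree (?D + 2*(-r)*s*t) \<le> ?n"
    by (rule degree_add_le; use D rst in simp)+
  have "degree (?D + 2*r*s*t) = ?n \<or> degree (?D + 2*(-r)*s*t) = ?n"
  proof (rule ccontr)
    assume "\<not> ?thesis"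
    hence "degree (?D + 2*r*s*t) < ?n" "degree (?D + 2*(-r)*s*t) < ?n" using le by linarith+
    hence "degree ((?D + 2*r*s*t) + (?D + 2*(-r)*s*t)) < ?n" by (rule degree_add_less)
    moreover have "degree (2 * ?D) = ?n" by (simp only: D degree_numeral_mult)
    ultimately show False unfolding sum by linarith
  qed
  thus ?thesis using that by blast
qed

lemma deg_disc_le:
  fixes a b c :: "complex poly"
  assumes "degree a \<le> \<mu>" "degree b \<le> \<mu>" "degree c \<le> \<mu>"
  shows "degree (a\<^sup>2+b\<^sup>2+c\<^sup>2-2*a*b-2*a*c-2*b*c-4) \<le> 2 * \<mu>"
  using assms degree_mult_le[of a b] degree_mult_le[of a c] degree_mult_le[of b c]
  by (intro degree_add_le degree_diff_le) (auto simp: degree_square_complex mult.assoc)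

lemma deg_factor_le:
  fixes p q :: "complex poly"
  assumes "p * q = u" "degree u \<le> n" "q \<noteq> 0"
  shows "p = 0 \<or> degree p + degree q \<le> n"
  using assms by (cases "p = 0") (auto simp: degree_mult_eq)

text \<open>Serves to bound the smaller of the two regular extensions \<open>p\<close> and \<open>q\<close> of \<open>{a, b, c}\<close>.\<close>
lemma disc_factor:
  fixes a b c p q :: "complex poly"
  assumes "p * q = a\<^sup>2+b\<^sup>2+c\<^sup>2-2*a*b-2*a*c-2*b*c-4" "q \<noteq> 0"
     "degree a \<le> \<mu>" "degree b \<le> \<mu>" "degree c \<le> \<mu>"
  shows "p = 0 \<or> degree p + degree q \<le> 2*\<mu>"
  using deg_factor_le[OF assms(1) deg_disc_le[OF assms(3-5)] assms(2)] .

text \<open>The smaller extension would have negative degree, so it is 0, and the product formula for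
  the extensions becomes the claim.\<close>
lemma regular_triple:
  fixes a b c :: "complex poly"
  assumes sq: "r\<^sup>2 = a*b+1" "s\<^sup>2 = a*c+1" "t\<^sup>2 = b*c+1"
    and nz: "a \<noteq> 0" "b \<noteq> 0" "c \<noteq> 0"
    and dg: "degree a \<le> degree c" "degree b \<le> degree c" "degree c < degree a + degree b"
  shows "(a + b - c)\<^sup>2 = 4*(a*b+1)"
proof -
  obtain \<rho> where r: "\<rho> = r \<or> \<rho> = -r" and
     big: "degree (a+b+c+2*a*b*c + 2*\<rho>*s*t) = degree a + degree b + degree c"
    by (rule large_extension[OF sq nz]) (use dg in auto)
  define e where "e = a+b+c+2*a*b*c - 2*\<rho>*s*t"
  have "\<rho>\<^sup>2 = a*b+1" using r sq by auto
  from extension_roots(4)[OF this sq(2,3) e_def]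
  have P: "e * (a+b+c+2*a*b*c + 2*\<rho>*s*t) = a\<^sup>2+b\<^sup>2+c\<^sup>2-2*a*b-2*a*c-2*b*c-4" .
  have "e = 0"
  proof (rule ccontr)
    assume "e \<noteq> 0"
    moreover have "a+b+c+2*a*b*c + 2*\<rho>*s*t \<noteq> 0" using big dg by auto
    ultimately have "degree (e * (a+b+c+2*a*b*c + 2*\<rho>*s*t)) \<ge> degree a + degree b + degree c"
      using big by (simp add: degree_mult_eq)
    moreover have "degree (a\<^sup>2+b\<^sup>2+c\<^sup>2-2*a*b-2*a*c-2*b*c-4) \<le> 2 * degree c"
      using dg degree_mult_le[of a b] degree_mult_le[of a c] degree_mult_le[of b c]
      by (intro degree_add_le degree_diff_le) (auto simp: degree_square_complex mult.assoc)
    ultimately show False using P dg by simp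
  qed
  hence "a\<^sup>2+b\<^sup>2+c\<^sup>2-2*a*b-2*a*c-2*b*c-4 = 0" using P by simp
  thus ?thesis by algebra
qed

section \<open>Ordered quadruples and their starting points\<close>

text \<open>A quadruple with its roots, in which \<open>c\<close> has the largest degree among \<open>a, b, c\<close>, while \<open>d\<close> is arbitrary. The last
  assumption is what induction on the total degree provides. There \<open>d0 = a\<close> can occur only for constant
  \<open>a\<close>, because \<open>a\<^sup>2 + 1\<close> is then a square.\<close>
locale quad =
  fixes a b c d r s t x y z :: "complex poly"
  assumes nz: "a \<noteq> 0" "b \<noteq> 0" "c \<noteq> 0" "d \<noteq> 0" "a \<noteq> b" "a \<noteq> c" "b \<noteq> c" "d \<noteq> a" "d \<noteq> b" "d \<noteq> c"
   and rr: "r\<^sup>2 = a*b+1" and ss: "s\<^sup>2 = a*c+1" and tt: "t\<^sup>2 = b*c+1"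
   and xx: "x\<^sup>2 = a*d+1" and yy: "y\<^sup>2 = b*d+1" and zz: "z\<^sup>2 = c*d+1"
   and deg: "degree a \<le> degree b" "degree b \<le> degree c" "0 < degree b"
   and gp: "a \<in> gauss_rat_polys" "b \<in> gauss_rat_polys" "c \<in> gauss_rat_polys" "d \<in> gauss_rat_polys"
     "r \<in> gauss_rat_polys" "s \<in> gauss_rat_polys" "t \<in> gauss_rat_polys"
     "x \<in> gauss_rat_polys" "y \<in> gauss_rat_polys" "z \<in> gauss_rat_polys"
   and IH: "\<And>d0 x0 y0 z0. d0 \<in> gauss_rat_polys \<Longrightarrow> x0 \<in> gauss_rat_polys \<Longrightarrow> y0 \<in> gauss_rat_polys \<Longrightarrow> z0 \<in> gauss_rat_polys
      \<Longrightarrow> x0\<^sup>2 = a*d0+1 \<Longrightarrow> y0\<^sup>2 = b*d0+1 \<Longrightarrow> z0\<^sup>2 = c*d0+1 \<Longrightarrow> degree d0 < degree c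
      \<Longrightarrow> d0 = 0 \<or> d0 = a \<or> D1_regular a b c d0"
begin

lemma root_degrees: "2 * degree r = degree a + degree b" "2 * degree s = degree a + degree c" "2 * degree t = degree b + degree c"
  using deg_root[OF rr] deg_root[OF ss] deg_root[OF tt] nz deg by auto

sublocale ac: pell_pair a c s z x
proof
  show "a * z\<^sup>2 - c * x\<^sup>2 = a - c" unfolding xx zz by algebra
qed (use nz ss deg in auto)

sublocale bc: pell_pair b c t z y
proof
  show "b * z\<^sup>2 - c * y\<^sup>2 = b - c" unfolding yy zz by algebra
qed (use nz tt deg in auto)

text \<open>Both Pell equations have the solution \<open>z\<close>. If it lies at even positions, the two starting values
  are congruent to \<open>z\<close> modulo \<open>c\<close> and smaller than \<open>c\<close>, so they coincide and belong to an extension \<open>d0\<close> of the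
  whole triple, to which the induction hypothesis applies. At odd positions \<open>d0\<close> is constant, hence 0 or \<open>a\<close> by
  \<open>const_partner_unique\<close>, and \<open>d1 = 0\<close> since \<open>b\<close> is not constant.\<close>
lemma descents:
  obtains M z0 x0 d0 N z1 y1 d1 where
    "z = orbit_z s c z0 x0 M" "z0\<^sup>2 = c*d0+1" "x0\<^sup>2 = a*d0+1"
    "(even M \<and> degree z0 < degree c \<and> c dvd z - z0)
     \<or> (odd M \<and> c dvd z - s * z0 \<and> degree d0 = 0 \<and> (d0 = 0 \<or> d0 = a \<and> degree a = 0))"
    "z = orbit_z t c z1 y1 N" "z1\<^sup>2 = c*d1+1" "y1\<^sup>2 = b*d1+1"
    "(even N \<and> degree z1 < degree c \<and> c dvd z - z1)
     \<or> (odd N \<and> c dvd z - t * z1 \<and> d1 = 0)"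
    "even M \<Longrightarrow> even N \<Longrightarrow> z0 = z1 \<and> d0 = d1 \<and> (d0 = 0 \<or> d0 = a \<and> degree a = 0 \<or> D1_regular a b c d0)"
    "degree d0 < degree c" "degree d1 < degree c"
proof -
  obtain M z0 x0 d0 where A: "z = orbit_z s c z0 x0 M" "z0\<^sup>2 = c*d0+1" "x0\<^sup>2 = a*d0+1"
    "z0 \<in> gauss_rat_polys" "x0 \<in> gauss_rat_polys" "d0 \<in> gauss_rat_polys" "degree d0 < degree c"
    "(even M \<and> degree z0 < degree c \<and> c dvd z - z0)
     \<or> (odd M \<and> c dvd z - s * z0 \<and> degree d0 = 0 \<and> (degree a > 0 \<longrightarrow> d0 = 0))"
    by (rule ac.descent[OF gp(1,3,6,10,8,4) zz xx]) (rule that, assumption+)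
  obtain N z1 y1 d1 where B: "z = orbit_z t c z1 y1 N" "z1\<^sup>2 = c*d1+1" "y1\<^sup>2 = b*d1+1"
    "z1 \<in> gauss_rat_polys" "y1 \<in> gauss_rat_polys" "d1 \<in> gauss_rat_polys" "degree d1 < degree c"
    "(even N \<and> degree z1 < degree c \<and> c dvd z - z1)
     \<or> (odd N \<and> c dvd z - t * z1 \<and> degree d1 = 0 \<and> (degree b > 0 \<longrightarrow> d1 = 0))"
    by (rule bc.descent[OF gp(2,3,7,10,9,4) zz yy]) (rule that, assumption+)
  have odd: "d0 = 0 \<or> d0 = a \<and> degree a = 0" if "odd M"
  proof (cases "d0 = 0")
    case False
    hence 0: "degree a = 0" "degree d0 = 0" using A(8) that by auto
    have "degree c > 0" using deg by simp
    from const_partner_unique[OF 0(2,1) False nz(1) this, of z0 s] A(2) ss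
    show ?thesis using 0 by (simp add: mult.commute)
  qed simp
  have even: "z0 = z1 \<and> d0 = d1 \<and> (d0 = 0 \<or> d0 = a \<and> degree a = 0 \<or> D1_regular a b c d0)" if "even M" "even N"
  proof -
    have "c dvd (z - z1) - (z - z0)" using A(8) B(8) that dvd_diff[of c "z - z1" "z - z0"] by blast
    hence "c dvd z0 - z1" by simp
    moreover have "degree (z0 - z1) < degree c" using A(8) B(8) that by (intro degree_diff_less) auto
    ultimately have z: "z0 = z1" using small_multiple_zero by fastforce
    have "c * d0 + 1 = c * d1 + 1" unfolding A(2)[symmetric] B(2)[symmetric] z ..
    hence d: "d0 = d1" using nz(3) by simp
    have "d0 = a \<Longrightarrow> degree a = 0" using A(3) self_partner_const by blast
    thus ?thesis using IH[of d0 x0 y1 z0] A(2-7) B(3,5) z d by blast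
  qed
  have n: "odd N \<Longrightarrow> d1 = 0" using B(8) deg by blast
  show ?thesis
    by (rule that[OF A(1,2,3) _ B(1,2,3) _ even A(7) B(7)]) (use A(8) B(8) odd n in blast)+
qed

end

text \<open>The polynomials \<open>cr \<plusminus> st\<close> are the roots that belong to the two regular extensions.\<close>
lemma (in quad) regular_from_root:
  assumes "c*d+1 = (c*r + s*t)\<^sup>2 \<or> c*d+1 = (c*r - s*t)\<^sup>2"
  shows "D1_regular a b c d"
proof -
  have "c * (d - (a+b+c+2*a*b*c)) = c*(2*r*s*t) \<or> c * (d - (a+b+c+2*a*b*c)) = c*(-(2*r*s*t))"
    using assms
  proof
    assume "c*d+1 = (c*r + s*t)\<^sup>2"
    hence "c * (d - (a+b+c+2*a*b*c)) = c*(2*r*s*t)" using rr ss tt by algebra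
    thus ?thesis ..
  next
    assume "c*d+1 = (c*r - s*t)\<^sup>2"
    hence "c * (d - (a+b+c+2*a*b*c)) = c*(-(2*r*s*t))" using rr ss tt by algebra
    thus ?thesis ..
  qed
  hence "d - (a+b+c+2*a*b*c) = 2*r*s*t \<or> d - (a+b+c+2*a*b*c) = -(2*r*s*t)"
    using nz(3) by (metis mult_left_cancel)
  hence "(d - (a+b+c+2*a*b*c))\<^sup>2 = (2*r*s*t)\<^sup>2" by auto
  thus ?thesis unfolding D1_regular_iff rr[symmetric] ss[symmetric] tt[symmetric] by algebra
qed

section \<open>Triples with a strictly dominant element: classes and congruences\<close>

text \<open>By \<open>large_extension\<close> the sign of \<open>r\<close> may be chosen such that \<open>2rst\<close> does not cancel the leading
  term of \<open>2abc\<close> in the sum; then \<open>e\<close> below is the smaller regular extension, and \<open>w0\<close> the root that belongs to it.\<close>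
locale quad_lt = quad +
  assumes lt: "degree b < degree c"
    and big: "degree (a+b+c+2*a*b*c + 2*r*s*t) = degree a + degree b + degree c"
begin

definition e where "e = a+b+c+2*a*b*c - 2*r*s*t"

definition w0 where "w0 = c*r - s*t"

lemma e_roots: "(a*t - r*s)\<^sup>2 = a*e+1" "(b*s - r*t)\<^sup>2 = b*e+1" "w0\<^sup>2 = c*e+1"
  using extension_roots[OF rr ss tt e_def] unfolding w0_def by auto

text \<open>Here \<open>c\<^sup>2\<close> dominates the product of the two extensions.\<close>
lemma deg_e: "degree e + degree a + degree b = degree c" "e \<noteq> 0"
proof -
  let ?P = "a\<^sup>2+b\<^sup>2+c\<^sup>2-2*a*b-2*a*c-2*b*c-4"
  have P: "e * (a+b+c+2*a*b*c + 2*r*s*t) = ?P" using extension_roots(4)[OF rr ss tt e_def] .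
  have "degree (a\<^sup>2+b\<^sup>2-2*a*b-2*a*c-2*b*c-4) < 2 * degree c"
  proof -
    have "degree (a\<^sup>2) < 2 * degree c" "degree (b\<^sup>2) < 2 * degree c"
      using lt deg by (auto simp: degree_square_complex)
    moreover have "degree (2*a*b) < 2*degree c" "degree (2*a*c) < 2*degree c" "degree (2*b*c) < 2*degree c"
      using degree_mult_le[of a b] degree_mult_le[of a c] degree_mult_le[of b c] lt deg by (auto simp: mult.assoc)
    moreover have "degree (4::complex poly) < 2 * degree c" using lt by simp
    ultimately show ?thesis by (intro degree_add_less degree_diff_less)
  qed
  hence "degree (c\<^sup>2 + (a\<^sup>2+b\<^sup>2-2*a*b-2*a*c-2*b*c-4)) = 2 * degree c"
    by (subst degree_add_eq_left) (auto simp: degree_square_complex)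
  moreover have "c\<^sup>2 + (a\<^sup>2+b\<^sup>2-2*a*b-2*a*c-2*b*c-4) = ?P" by simp
  ultimately have dP: "degree ?P = 2 * degree c" by simp
  show "e \<noteq> 0" using P dP lt by auto
  moreover have "a+b+c+2*a*b*c + 2*r*s*t \<noteq> 0" using big lt by auto
  ultimately have "degree ?P = degree e + (degree a + degree b + degree c)"
    using big by (simp add: degree_mult_eq flip: P)
  thus "degree e + degree a + degree b = degree c" using dP by simp
qed

lemma deg_w0: "2 * degree w0 = degree c + degree e" "degree w0 < degree c" "w0 \<noteq> 0"
proof -
  show *: "2 * degree w0 = degree c + degree e" using deg_root[OF e_roots(3)] nz deg_e deg by simp
  thus "degree w0 < degree c" using deg_e deg by simp
  show "w0 \<noteq> 0" using * deg by auto
qed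

lemma deg_lt: "degree s < degree c" "degree t < degree c" "degree s > degree a" "degree t > degree b" "s \<noteq> 0" "t \<noteq> 0"
proof -
  show "degree s < degree c" "degree t < degree c" "degree s > degree a" "degree t > degree b" using root_degrees deg lt by auto
  thus "s \<noteq> 0" "t \<noteq> 0" by auto
qed

lemma small_extension_unique: assumes "D1_regular a b c d0" "degree d0 < degree c" shows "d0 = e"
proof -
  have "(d0 - (a+b+c+2*a*b*c))\<^sup>2 = (2*r*s*t)\<^sup>2"
    using assms(1) unfolding D1_regular_iff rr[symmetric] ss[symmetric] tt[symmetric] by algebra
  from square_eq_cases[OF this] show ?thesis
  proof
    assume "d0 - (a+b+c+2*a*b*c) = 2*r*s*t"
    hence "d0 = a+b+c+2*a*b*c + 2*r*s*t" by algebra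
    thus ?thesis using big assms(2) by simp
  next
    assume "d0 - (a+b+c+2*a*b*c) = -(2*r*s*t)"
    thus ?thesis unfolding e_def by algebra
  qed
qed

text \<open>The six possible pairs of extensions at the two starting points: \<open>(0,0)\<close>, \<open>(b,0)\<close>, \<open>(0,a)\<close>, \<open>(e,e)\<close>, and for
  constant \<open>a\<close> also \<open>(a,0)\<close> and \<open>(a,a)\<close>. The polynomial \<open>w\<close> is \<open>z\<close> up to sign. Two odd positions are
  incompatible modulo \<open>c\<close>.\<close>
lemma starting_points:
  obtains w M N where "w\<^sup>2 = c*d+1" "even M" "even N" "w = orbit_z s c 1 1 M" "w = orbit_z t c 1 1 N"
  | w M N where "w\<^sup>2 = c*d+1" "even M" "odd N" "w = orbit_z s c t r M" "w = orbit_z t c 1 1 N"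
  | w M N where "w\<^sup>2 = c*d+1" "odd M" "even N" "w = orbit_z s c 1 1 M" "w = orbit_z t c s r N"
  | w M N where "w\<^sup>2 = c*d+1" "even M" "even N" "w = orbit_z s c w0 (a*t-r*s) M" "w = orbit_z t c w0 (b*s-r*t) N"
  | w M N p where "w\<^sup>2 = c*d+1" "degree a = 0" "p\<^sup>2 = a\<^sup>2+1" "odd M" "even N" "w = orbit_z s c s p M" "w = orbit_z t c 1 1 N"
  | w M N p where "w\<^sup>2 = c*d+1" "degree a = 0" "p\<^sup>2 = a\<^sup>2+1" "even M" "even N" "w = orbit_z s c s p M" "w = orbit_z t c s r N"
proof -
  note W = that
  have finish: "\<exists>w M' N'. w\<^sup>2 = c*d+1 \<and> even M' = even M \<and> even N' = even N \<and> w = orbit_z s c u v M' \<and> w = orbit_z t c u' v' N'"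
    if T: "z = orbit_z s c z0 x0 M" "x0\<^sup>2 = v\<^sup>2" "z0 = \<sigma>*u" "z = orbit_z t c z1 y1 N" "y1\<^sup>2 = v'\<^sup>2" "z1 = \<sigma>*u'"
      "\<sigma> = 1 \<or> \<sigma> = -1" "u \<noteq> 0" "u' \<noteq> 0" for z0 x0 M N z1 y1 u v u' v' \<sigma>
  proof -
    obtain M' where 1: "even M' = even M" "\<sigma>*z = orbit_z s c u v M'"
      using orbit_start_fixed_sign[OF T(1,2,3,7,8)] by blast
    obtain N' where 2: "even N' = even N" "\<sigma>*z = orbit_z t c u' v' N'"
      using orbit_start_fixed_sign[OF T(4,5,6,7,9)] by blast
    have "(\<sigma>*z)\<^sup>2 = c*d+1" using sign_sq[OF T(7)] zz by simp
    thus ?thesis using 1 2 by blast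
  qed
  obtain M z0 x0 d0 N z1 y1 d1 where
    A: "z = orbit_z s c z0 x0 M" "z0\<^sup>2 = c*d0+1" "x0\<^sup>2 = a*d0+1"
    "(even M \<and> degree z0 < degree c \<and> c dvd z - z0)
     \<or> (odd M \<and> c dvd z - s * z0 \<and> degree d0 = 0 \<and> (d0 = 0 \<or> d0 = a \<and> degree a = 0))" and
    B: "z = orbit_z t c z1 y1 N" "z1\<^sup>2 = c*d1+1" "y1\<^sup>2 = b*d1+1"
    "(even N \<and> degree z1 < degree c \<and> c dvd z - z1)
     \<or> (odd N \<and> c dvd z - t * z1 \<and> d1 = 0)" and
    EE: "even M \<Longrightarrow> even N \<Longrightarrow> z0 = z1 \<and> d0 = d1 \<and> (d0 = 0 \<or> d0 = a \<and> degree a = 0 \<or> D1_regular a b c d0)" and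
    degree_relations: "degree d0 < degree c" "degree d1 < degree c"
    by (rule descents) (rule that, assumption+)
  consider (ee) "even M" "even N" | (eo) "even M" "odd N" | (oe) "odd M" "even N" | (oo) "odd M" "odd N" by blast
  thus thesis
  proof cases
    case ee
    hence z: "z0 = z1" "d0 = d1" and d0: "d0 = 0 \<or> d0 = a \<and> degree a = 0 \<or> d0 = e"
      using EE small_extension_unique degree_relations by auto
    from d0 consider "d0 = 0" | "d0 = a" "degree a = 0" | "d0 = e" by metis
    thus thesis
    proof cases
      case 1
      hence q: "z0\<^sup>2 = 1\<^sup>2" "x0\<^sup>2 = 1\<^sup>2" "y1\<^sup>2 = 1\<^sup>2" using A B z by auto
      obtain \<sigma> where sg: "\<sigma> = 1 \<or> \<sigma> = -1" "z0 = \<sigma>*1" using sign_cases[OF q(1)] by blast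
      obtain w M' N' where F: "w\<^sup>2 = c*d+1" "even M' = even M" "even N' = even N" "w = orbit_z s c 1 1 M'" "w = orbit_z t c 1 1 N'"
        using finish[OF A(1) q(2) sg(2) B(1) q(3) sg(2)[unfolded z(1)] sg(1) one_neq_zero one_neq_zero] by blast
      show thesis by (rule W(1)[OF F(1) _ _ F(4,5)]) (use F(2,3) ee in simp_all)
    next
      case 2
      hence q: "z0\<^sup>2 = s\<^sup>2" "y1\<^sup>2 = r\<^sup>2" "x0\<^sup>2 = a\<^sup>2+1"
        using A B z ss rr by (auto simp: mult.commute power2_eq_square)
      obtain \<sigma> where sg: "\<sigma> = 1 \<or> \<sigma> = -1" "z0 = \<sigma>*s" using sign_cases[OF q(1)] by blast
      obtain w M' N' where F: "w\<^sup>2 = c*d+1" "even M' = even M" "even N' = even N" "w = orbit_z s c s x0 M'" "w = orbit_z t c s r N'"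
        using finish[OF A(1) refl sg(2) B(1) q(2) sg(2)[unfolded z(1)] sg(1) deg_lt(5) deg_lt(5)] by blast
      show thesis by (rule W(6)[OF F(1) 2(2) q(3) _ _ F(4,5)]) (use F(2,3) ee in simp_all)
    next
      case 3
      hence q: "z0\<^sup>2 = w0\<^sup>2" "x0\<^sup>2 = (a*t-r*s)\<^sup>2" "y1\<^sup>2 = (b*s-r*t)\<^sup>2"
        using A B z e_roots by auto
      obtain \<sigma> where sg: "\<sigma> = 1 \<or> \<sigma> = -1" "z0 = \<sigma>*w0" using sign_cases[OF q(1)] by blast
      obtain w M' N' where F: "w\<^sup>2 = c*d+1" "even M' = even M" "even N' = even N" "w = orbit_z s c w0 (a*t-r*s) M'" "w = orbit_z t c w0 (b*s-r*t) N'"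
        using finish[OF A(1) q(2) sg(2) B(1) q(3) sg(2)[unfolded z(1)] sg(1) deg_w0(3) deg_w0(3)] by blast
      show thesis by (rule W(4)[OF F(1) _ _ F(4,5)]) (use F(2,3) ee in simp_all)
    qed
  next
    case eo
    hence d1: "d1 = 0" "c dvd z - t*z1" and zz0: "c dvd z - z0" "degree z0 < degree c" using A B by auto
    have q1: "z1\<^sup>2 = 1\<^sup>2" "y1\<^sup>2 = 1\<^sup>2" using B d1 by auto
    obtain \<sigma> where \<sigma>: "\<sigma> = 1 \<or> \<sigma> = -1" "z1 = \<sigma>*1" using sign_cases[OF q1(1)] by blast
    have z0: "z0 = \<sigma>*t" using d1 zz0 \<sigma> deg_lt by (intro cong_eq[of c z]) (auto simp: mult.commute)
    hence "z0\<^sup>2 = t\<^sup>2" using sign_sq \<sigma> by simp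
    hence "c * (d0 - b) = 0" using A tt by (simp add: algebra_simps)
    hence "d0 = b" using nz by simp
    hence x0: "x0\<^sup>2 = r\<^sup>2" using A rr by simp
    obtain w M' N' where F: "w\<^sup>2 = c*d+1" "even M' = even M" "even N' = even N" "w = orbit_z s c t r M'" "w = orbit_z t c 1 1 N'"
        using finish[OF A(1) x0 z0 B(1) q1(2) \<sigma>(2,1) deg_lt(6) one_neq_zero] by blast
      show thesis by (rule W(2)[OF F(1) _ _ F(4,5)]) (use F(2,3) eo in simp_all)
  next
    case oe
    hence d0: "d0 = 0 \<or> d0 = a \<and> degree a = 0" "c dvd z - s*z0" and zz1: "c dvd z - z1" "degree z1 < degree c" using A B by auto
    from d0(1) consider "d0 = 0" | "d0 = a" "degree a = 0" by metis
    thus thesis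
    proof cases
      case 1
      hence q1: "z0\<^sup>2 = 1\<^sup>2" "x0\<^sup>2 = 1\<^sup>2" using A by auto
      obtain \<sigma> where \<sigma>: "\<sigma> = 1 \<or> \<sigma> = -1" "z0 = \<sigma>*1" using sign_cases[OF q1(1)] by blast
      have z1: "z1 = \<sigma>*s" using d0 zz1 \<sigma> deg_lt by (intro cong_eq[of c z]) (auto simp: mult.commute)
      hence "z1\<^sup>2 = s\<^sup>2" using sign_sq \<sigma> by simp
      hence "c * (d1 - a) = 0" using B ss by (simp add: algebra_simps)
      hence "d1 = a" using nz by simp
      hence y1: "y1\<^sup>2 = r\<^sup>2" using B rr by (simp add: mult.commute)
      obtain w M' N' where F: "w\<^sup>2 = c*d+1" "even M' = even M" "even N' = even N" "w = orbit_z s c 1 1 M'" "w = orbit_z t c s r N'"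
        using finish[OF A(1) q1(2) \<sigma>(2) B(1) y1 z1 \<sigma>(1) one_neq_zero deg_lt(5)] by blast
      show thesis by (rule W(3)[OF F(1) _ _ F(4,5)]) (use F(2,3) oe in simp_all)
    next
      case 2
      hence q1: "z0\<^sup>2 = s\<^sup>2" "x0\<^sup>2 = a\<^sup>2+1" using A ss by (auto simp: mult.commute power2_eq_square)
      obtain \<sigma> where \<sigma>: "\<sigma> = 1 \<or> \<sigma> = -1" "z0 = \<sigma>*s" using sign_cases[OF q1(1)] by blast
      \<comment> \<open>As \<open>s\<^sup>2\<close> is 1 modulo \<open>c\<close>, an odd position over the start \<open>s\<close> looks like the start 1.\<close>
      have eq: "(z - s*z0) + c*(a*\<sigma>) = z - \<sigma>*1" using \<sigma> ss by algebra
      have "c dvd (z - s*z0) + c*(a*\<sigma>)" using d0 by (intro dvd_add) auto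
      hence "c dvd z - \<sigma>*1" unfolding eq .
      hence z1: "z1 = \<sigma>*1" using zz1 \<sigma> lt by (intro cong_eq[of c z]) auto
      hence "z1\<^sup>2 = 1" using \<sigma> by auto
      hence "d1 = 0" using B nz by simp
      hence y1: "y1\<^sup>2 = 1\<^sup>2" using B by simp
      obtain w M' N' where F: "w\<^sup>2 = c*d+1" "even M' = even M" "even N' = even N" "w = orbit_z s c s x0 M'" "w = orbit_z t c 1 1 N'"
        using finish[OF A(1) refl \<sigma>(2) B(1) y1 z1 \<sigma>(1) deg_lt(5) one_neq_zero] by blast
      show thesis by (rule W(5)[OF F(1) 2(2) q1(2) _ _ F(4,5)]) (use F(2,3) oe in simp_all)
    qed
  next
    case oo
    hence d0: "d0 = 0 \<or> d0 = a \<and> degree a = 0" "c dvd z - s*z0" and d1: "d1 = 0" "c dvd z - t*z1" using A B by auto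
    have q1: "z1\<^sup>2 = 1\<^sup>2" using B d1 by auto
    obtain \<sigma> where \<sigma>: "\<sigma> = 1 \<or> \<sigma> = -1" "z1 = \<sigma>*1" using sign_cases[OF q1(1)] by blast
    from d0(1) consider "d0 = 0" | "d0 = a" by blast
    hence False
    proof cases
      case 1
      hence q0: "z0\<^sup>2 = 1\<^sup>2" using A by auto
      obtain \<tau> where \<tau>: "\<tau> = 1 \<or> \<tau> = -1" "z0 = \<tau>*1" using sign_cases[OF q0] by blast
      have "s*z0 = t*z1" using d0 d1 \<sigma> \<tau> deg_lt by (intro cong_eq[of c z]) (auto simp: mult.commute)
      hence "s\<^sup>2 = t\<^sup>2" using \<sigma> \<tau> by auto
      hence "c * (a - b) = 0" using ss tt by (simp add: algebra_simps)
      thus False using nz by simp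
    next
      case 2
      hence q0: "z0\<^sup>2 = s\<^sup>2" using A ss by (auto simp: mult.commute)
      obtain \<tau> where \<tau>: "\<tau> = 1 \<or> \<tau> = -1" "z0 = \<tau>*s" using sign_cases[OF q0] by blast
      have eq: "(z - s*z0) + c*(a*\<tau>) = z - \<tau>" using \<tau> ss by algebra
      have "c dvd (z - s*z0) + c*(a*\<tau>)" using d0 by (intro dvd_add) auto
      hence "c dvd z - \<tau>" unfolding eq .
      hence "\<tau> = t*z1" using d1 \<sigma> \<tau> deg_lt lt by (intro cong_eq[of c z]) auto
      hence "\<tau>\<^sup>2 = t\<^sup>2 * z1\<^sup>2" by (simp add: power_mult_distrib)
      hence "t\<^sup>2 = 1" using q1 \<tau> by auto
      thus False using tt nz by simp
    qed
    thus thesis ..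
  qed
qed

text \<open>Modulo \<open>c\<close> the product \<open>2rst\<close> is \<open>a + b - e\<close>, which is how \<open>e\<close> enters the identities below.\<close>
lemma rst_e: "2*r*s*t = a + b - e + c*(1+2*a*b)"
  unfolding e_def by algebra

text \<open>In this lemma and the next five the suffixes of the name are the extensions at the two starting points. The linear
  terms of the expansions modulo \<open>c\<^sup>2\<close> agree modulo \<open>c\<close>. Where products of roots occur, they are multiplied by the common
  starting value, whose square is 1 modulo \<open>c\<close>; this brings \<open>rst\<close> into play, which \<open>rst_e\<close> reduces.
  What is left has smaller degree than \<open>c\<close>, so the congruence is an equality.\<close>
lemma ident_0_0:
  assumes "even M" "even N" "w = orbit_z s c 1 1 M" "w = orbit_z t c 1 1 N"
  shows "a*(of_int M)\<^sup>2 + 2*of_int M*s = b*(of_int N)\<^sup>2 + 2*of_int N*t"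
proof -
  define m n :: "complex poly" where mn: "m = of_int M" "n = of_int N"
  have "c\<^sup>2 dvd 2*w - (2 + c*(a*m\<^sup>2+2*m*s))" "c\<^sup>2 dvd 2*w - (2 + c*(b*n\<^sup>2+2*n*t))"
    using orbit_z_mod(1)[OF ss assms(1), of 1 1] orbit_z_mod(1)[OF tt assms(2), of 1 1] assms mn by auto
  from cong_quotient[OF this nz(3)] have "c dvd (a*m\<^sup>2+2*m*s) - (b*n\<^sup>2+2*n*t)" .
  moreover have "degree ((a*m\<^sup>2+2*m*s) - (b*n\<^sup>2+2*n*t)) < degree c"
    unfolding mn using deg_lt lt deg
    by (intro degree_add_less degree_diff_less deg0_scale_less deg0_simps) auto
  ultimately show ?thesis using small_multiple_zero mn by fastforce
qed

lemma ident_b_0: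
  assumes "even M" "odd N" "w = orbit_z s c t r M" "w = orbit_z t c 1 1 N"
  shows "a*(of_int M)\<^sup>2 + of_int M*(a+b-e) = b*((of_int N)\<^sup>2-1) + 2*of_int N*t"
proof -
  define m n :: "complex poly" where mn: "m = of_int M" "n = of_int N"
  have "c\<^sup>2 dvd 2*w - (2*t + c*(a*t*m\<^sup>2+2*m*s*r))" "c\<^sup>2 dvd 2*w - (2*t + c*(b*t*(n\<^sup>2-1)+2*n))"
    using orbit_z_mod(1)[OF ss assms(1), of t r] orbit_z_mod(2)[OF tt assms(2), of 1 1] assms mn by auto
  from cong_quotient[OF this nz(3)] have "c dvd (a*t*m\<^sup>2+2*m*s*r) - (b*t*(n\<^sup>2-1)+2*n)" .
  hence "c dvd t*((a*t*m\<^sup>2+2*m*s*r) - (b*t*(n\<^sup>2-1)+2*n))" by simp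
  moreover have "t*((a*t*m\<^sup>2+2*m*s*r) - (b*t*(n\<^sup>2-1)+2*n))
     = (a*m\<^sup>2 + m*(a+b-e) - (b*(n\<^sup>2-1) + 2*n*t)) + c*(b*(a*m\<^sup>2 - b*(n\<^sup>2-1)) + m*(1+2*a*b))"
    using tt rst_e by algebra
  ultimately have "c dvd a*m\<^sup>2 + m*(a+b-e) - (b*(n\<^sup>2-1) + 2*n*t)"
    by (metis dvd_add_left_iff dvd_triv_left)
  moreover have "degree (a*m\<^sup>2 + m*(a+b-e) - (b*(n\<^sup>2-1) + 2*n*t)) < degree c"
    unfolding mn using deg_lt lt deg deg_e
    by (intro degree_add_less degree_diff_less deg0_scale_less deg0_simps) auto
  ultimately show ?thesis using small_multiple_zero mn by fastforce
qed

lemma ident_0_a: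
  assumes "odd M" "even N" "w = orbit_z s c 1 1 M" "w = orbit_z t c s r N"
  shows "a*((of_int M)\<^sup>2-1) + 2*of_int M*s = b*(of_int N)\<^sup>2 + of_int N*(a+b-e)"
proof -
  define m n :: "complex poly" where mn: "m = of_int M" "n = of_int N"
  have "c\<^sup>2 dvd 2*w - (2*s + c*(a*s*(m\<^sup>2-1)+2*m))" "c\<^sup>2 dvd 2*w - (2*s + c*(b*s*n\<^sup>2+2*n*t*r))"
    using orbit_z_mod(2)[OF ss assms(1), of 1 1] orbit_z_mod(1)[OF tt assms(2), of s r] assms mn by auto
  from cong_quotient[OF this nz(3)] have "c dvd (a*s*(m\<^sup>2-1)+2*m) - (b*s*n\<^sup>2+2*n*t*r)" .
  hence "c dvd s*((a*s*(m\<^sup>2-1)+2*m) - (b*s*n\<^sup>2+2*n*t*r))" by simp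
  moreover have "s*((a*s*(m\<^sup>2-1)+2*m) - (b*s*n\<^sup>2+2*n*t*r))
     = (a*(m\<^sup>2-1) + 2*m*s - (b*n\<^sup>2 + n*(a+b-e))) + c*(a*(a*(m\<^sup>2-1) - b*n\<^sup>2) - n*(1+2*a*b))"
    using ss rst_e by algebra
  ultimately have "c dvd a*(m\<^sup>2-1) + 2*m*s - (b*n\<^sup>2 + n*(a+b-e))"
    by (metis dvd_add_left_iff dvd_triv_left)
  moreover have "degree (a*(m\<^sup>2-1) + 2*m*s - (b*n\<^sup>2 + n*(a+b-e))) < degree c"
    unfolding mn using deg_lt lt deg deg_e
    by (intro degree_add_less degree_diff_less deg0_scale_less deg0_simps) auto
  ultimately show ?thesis using small_multiple_zero mn by fastforce
qed

lemma ident_e_e: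
  assumes "even M" "even N" "w = orbit_z s c w0 (a*t-r*s) M" "w = orbit_z t c w0 (b*s-r*t) N"
  shows "a*(of_int M)\<^sup>2 + of_int M*(b-a-e) = b*(of_int N)\<^sup>2 + of_int N*(a-b-e)"
proof -
  define m n :: "complex poly" where mn: "m = of_int M" "n = of_int N"
  let ?u = "a*w0*m\<^sup>2+2*m*s*(a*t-r*s)" let ?v = "b*w0*n\<^sup>2+2*n*t*(b*s-r*t)"
  have "c\<^sup>2 dvd 2*w - (2*w0 + c*?u)" "c\<^sup>2 dvd 2*w - (2*w0 + c*?v)"
    using orbit_z_mod(1)[OF ss assms(1), of w0 "a*t-r*s"] orbit_z_mod(1)[OF tt assms(2), of w0 "b*s-r*t"] assms mn by auto
  from cong_quotient[OF this nz(3)] have "c dvd ?u - ?v" .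
  hence "c dvd w0*(?u - ?v)" by simp
  moreover have "w0 * (?u - ?v) = (a*m\<^sup>2 + m*(b-a-e) - (b*n\<^sup>2 + n*(a-b-e)))
     + c*(e*(a*m\<^sup>2 - b*n\<^sup>2) + 2*m*(r*(a*t*s - r - r*a*c) + a*r*s*t - a*(a+b+a*b*c)) + m*(1+2*a*b)
         - 2*n*(r*(b*t*s - r - r*b*c) + b*r*s*t - b*(a+b+a*b*c)) - n*(1+2*a*b))"
  proof -
    have 1: "w0 * (s*(a*t-r*s)) = (r*s*t - a) + c*(r*(a*t*s - r - r*a*c) + a*r*s*t - a*(a+b+a*b*c))"
      unfolding w0_def using ss tt by algebra
    have 2: "w0 * (t*(b*s-r*t)) = (r*s*t - b) + c*(r*(b*t*s - r - r*b*c) + b*r*s*t - b*(a+b+a*b*c))"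
      unfolding w0_def using ss tt by algebra
    have "w0 * (?u - ?v) = w0\<^sup>2*(a*m\<^sup>2 - b*n\<^sup>2) + 2*m*(w0 * (s*(a*t-r*s))) - 2*n*(w0 * (t*(b*s-r*t)))"
      by algebra
    also have "\<dots> = (a*m\<^sup>2 + m*(b-a-e) - (b*n\<^sup>2 + n*(a-b-e)))
     + c*(e*(a*m\<^sup>2 - b*n\<^sup>2) + 2*m*(r*(a*t*s - r - r*a*c) + a*r*s*t - a*(a+b+a*b*c)) + m*(1+2*a*b)
         - 2*n*(r*(b*t*s - r - r*b*c) + b*r*s*t - b*(a+b+a*b*c)) - n*(1+2*a*b))"
      unfolding 1 2 e_roots(3) using rst_e by algebra
    finally show ?thesis .
  qed
  ultimately have "c dvd a*m\<^sup>2 + m*(b-a-e) - (b*n\<^sup>2 + n*(a-b-e))"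
    by (metis dvd_add_left_iff dvd_triv_left)
  moreover have "degree (a*m\<^sup>2 + m*(b-a-e) - (b*n\<^sup>2 + n*(a-b-e))) < degree c"
    unfolding mn using deg_lt lt deg deg_e
    by (intro degree_add_less degree_diff_less deg0_scale_less deg0_simps) auto
  ultimately show ?thesis using small_multiple_zero mn by fastforce
qed

lemma ident_a_0:
  assumes "odd M" "even N" "w = orbit_z s c s p M" "w = orbit_z t c 1 1 N" "degree p = 0"
  shows "a*((of_int M)\<^sup>2+1) + 2*of_int M*p = b*(of_int N)\<^sup>2 + 2*of_int N*t"
proof -
  define m n :: "complex poly" where mn: "m = of_int M" "n = of_int N"
  have "c\<^sup>2 dvd 2*w - (2*s*s + c*(a*s*s*(m\<^sup>2-1)+2*m*p))" "c\<^sup>2 dvd 2*w - (2 + c*(b*n\<^sup>2+2*n*t))"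
    using orbit_z_mod(2)[OF ss assms(1), of s p] orbit_z_mod(1)[OF tt assms(2), of 1 1] assms mn by auto
  moreover have "2*s*s + c*(a*s*s*(m\<^sup>2-1)+2*m*p) = 2 + c*(2*a + a*s*s*(m\<^sup>2-1)+2*m*p)"
    using ss by algebra
  ultimately have "c dvd (2*a + a*s*s*(m\<^sup>2-1)+2*m*p) - (b*n\<^sup>2+2*n*t)"
    using cong_quotient[OF _ _ nz(3)] by metis
  moreover have "(2*a + a*s*s*(m\<^sup>2-1)+2*m*p) - (b*n\<^sup>2+2*n*t)
     = (a*(m\<^sup>2+1) + 2*m*p - (b*n\<^sup>2+2*n*t)) + c*(a\<^sup>2*(m\<^sup>2-1))"
    using ss by algebra
  ultimately have "c dvd a*(m\<^sup>2+1) + 2*m*p - (b*n\<^sup>2+2*n*t)"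
    by (metis dvd_add_left_iff dvd_triv_left)
  moreover have "degree (a*(m\<^sup>2+1) + 2*m*p - (b*n\<^sup>2+2*n*t)) < degree c"
    unfolding mn using deg_lt lt deg assms(5)
    by (intro degree_add_less degree_diff_less deg0_scale_less deg0_simps) auto
  ultimately show ?thesis using small_multiple_zero mn by fastforce
qed

lemma ident_a_a:
  assumes "even M" "even N" "w = orbit_z s c s p M" "w = orbit_z t c s r N" "degree p = 0"
  shows "a*(of_int M)\<^sup>2 + 2*of_int M*p = b*(of_int N)\<^sup>2 + of_int N*(a+b-e)"
proof -
  define m n :: "complex poly" where mn: "m = of_int M" "n = of_int N"
  have "c\<^sup>2 dvd 2*w - (2*s + c*(a*s*m\<^sup>2+2*m*s*p))" "c\<^sup>2 dvd 2*w - (2*s + c*(b*s*n\<^sup>2+2*n*t*r))"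
    using orbit_z_mod(1)[OF ss assms(1), of s p] orbit_z_mod(1)[OF tt assms(2), of s r] assms mn by auto
  from cong_quotient[OF this nz(3)] have "c dvd (a*s*m\<^sup>2+2*m*s*p) - (b*s*n\<^sup>2+2*n*t*r)" .
  hence "c dvd s*((a*s*m\<^sup>2+2*m*s*p) - (b*s*n\<^sup>2+2*n*t*r))" by simp
  moreover have "s*((a*s*m\<^sup>2+2*m*s*p) - (b*s*n\<^sup>2+2*n*t*r))
     = (a*m\<^sup>2 + 2*m*p - (b*n\<^sup>2 + n*(a+b-e))) + c*(a*(a*m\<^sup>2+2*m*p - b*n\<^sup>2) - n*(1+2*a*b))"
    using ss rst_e by algebra
  ultimately have "c dvd a*m\<^sup>2 + 2*m*p - (b*n\<^sup>2 + n*(a+b-e))"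
    by (metis dvd_add_left_iff dvd_triv_left)
  moreover have "degree (a*m\<^sup>2 + 2*m*p - (b*n\<^sup>2 + n*(a+b-e))) < degree c"
    unfolding mn using deg_lt lt deg deg_e assms(5)
    by (intro degree_add_less degree_diff_less deg0_scale_less deg0_simps) auto
  ultimately show ?thesis using small_multiple_zero mn by fastforce
qed

lemma no_orbit_0_0:
  assumes "w\<^sup>2 = c*d+1" "even M" "even N" "w = orbit_z s c 1 1 M" "w = orbit_z t c 1 1 N"
  shows False
proof -
  define m n :: "complex poly" where mn: "m = of_int M" "n = of_int N"
  have id: "a*m\<^sup>2 + 2*m*s = b*n\<^sup>2 + 2*n*t" using ident_0_0[OF assms(2-)] mn by simp
  \<comment> \<open>The identity says \<open>q = 2(ms - nt)\<close>; the second factor below makes the product a constant.\<close>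
  define q where "q = b*n\<^sup>2 - a*m\<^sup>2"
  have Q: "q * ((m*s + n*t) + 2*c) = 2*(m\<^sup>2 - n\<^sup>2)"
  proof -
    have "q = 2*(m*s - n*t)" using id unfolding q_def by algebra
    hence "q * (m*s + n*t) = 2*(m\<^sup>2*s\<^sup>2 - n\<^sup>2*t\<^sup>2)" by algebra
    also have "\<dots> = 2*(m\<^sup>2-n\<^sup>2) - 2*c*q" unfolding ss tt q_def by algebra
    finally show ?thesis by algebra
  qed
  have "degree (m*s + n*t) < degree c" unfolding mn using deg_lt
    by (intro degree_add_less deg0_scale_less) auto
  hence dc: "degree ((m*s + n*t) + 2*c) = degree c" by (subst degree_add_eq_right) auto
  have "q = 0"
  proof (rule ccontr)
    assume "q \<noteq> 0"
    moreover have "(m*s + n*t) + 2*c \<noteq> 0" using dc lt by auto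
    ultimately have "degree (2*(m\<^sup>2 - n\<^sup>2)) \<ge> degree c" using dc unfolding Q[symmetric] by (simp add: degree_mult_eq)
    moreover have "degree (2*(m\<^sup>2 - n\<^sup>2)) = 0" unfolding mn by (simp add: deg0_simps)
    ultimately show False using lt by simp
  qed
  hence "m\<^sup>2 = n\<^sup>2" using Q by simp
  hence "m\<^sup>2 * (b - a) = 0" using \<open>q = 0\<close> unfolding q_def by algebra
  hence "m = 0" using nz by simp
  hence "M = 0" using mn by simp
  hence "w = 1" using assms(4) by (simp add: orbit_z_def)
  thus False using assms(1) nz by simp
qed

text \<open>In \<open>ident_a_0\<close> the root \<open>t\<close> has larger degree than every other term, so its coefficient \<open>2N\<close> vanishes.\<close>
lemma no_orbit_a_0:
  assumes "w\<^sup>2 = c*d+1" "degree a = 0" "p\<^sup>2 = a\<^sup>2+1" "odd M" "even N" "w = orbit_z s c s p M" "w = orbit_z t c 1 1 N"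
  shows False
proof -
  define m n :: "complex poly" where mn: "m = of_int M" "n = of_int N"
  have "degree (p\<^sup>2) = 0" unfolding assms(3) using assms(2) by (intro deg0_simps) auto
  hence dp: "degree p = 0" by (simp add: degree_square_complex)
  have id: "a*(m\<^sup>2+1) + 2*m*p = b*n\<^sup>2 + 2*n*t" using ident_a_0[OF assms(4-7) dp] mn by simp
  have "n = 0"
  proof (rule ccontr)
    assume n: "n \<noteq> 0"
    have dn: "degree n = 0" "degree (2*n) = 0" using mn by simp_all
    have "degree (b*n\<^sup>2) < degree (2*n*t)"
      using deg0_scale_eq[OF dn(2), of t] n deg_lt(4) deg0_scale[of "n\<^sup>2" b] dn by (auto simp: deg0_simps)
    hence "degree (b*n\<^sup>2 + 2*n*t) = degree t"
      using deg0_scale_eq[OF dn(2), of t] n by (subst degree_add_eq_right) auto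
    moreover have "degree (a*(m\<^sup>2+1) + 2*m*p) = 0" using assms(2) dp mn by (intro deg0_simps) auto
    ultimately show False using deg_lt(4) id by simp
  qed
  hence "w = 1" using assms(7) mn by (simp add: orbit_z_def)
  thus False using assms(1) nz by simp
qed

end

section \<open>Integer equations for the exponents\<close>

text \<open>A chain of divisibilities gives \<open>l = 2u\<close> and \<open>k = 2ui\<close>. The equation in \<open>u\<close> and \<open>i\<close> then has a dominant
  square and leaves only \<open>u, i = \<plusminus>1\<close>.\<close>
lemma int_no_solution_a_a:
  fixes k l :: int
  assumes "2*l*k\<^sup>2 + 2*(l+1)*k + 3*l\<^sup>2 + 2*l = 0" "l \<noteq> 0"
  shows False
proof -
  have "3*l\<^sup>2 = 2*(-(l*k\<^sup>2) - (l+1)*k - l)" using assms(1) by (simp add: algebra_simps)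
  hence "even (3*l\<^sup>2)" by simp
  hence "even l" by simp
  then obtain u where u: "l = 2*u" by blast
  have e1: "2*u*k\<^sup>2 + (2*u+1)*k + 6*u\<^sup>2+2*u = 0" using assms(1) unfolding u by (simp add: power2_eq_square algebra_simps)
  have "k = u * (- 2*k\<^sup>2 - 2*k - 6*u - 2)" using e1 by (simp add: power2_eq_square algebra_simps)
  then obtain j where j: "k = u*j" by blast
  have "u * (2*u\<^sup>2*j\<^sup>2 + (2*u+1)*j + 6*u+2) = 0" using e1 unfolding j by (simp add: power2_eq_square algebra_simps)
  hence e2: "2*u\<^sup>2*j\<^sup>2 + (2*u+1)*j + 6*u+2 = 0" using assms(2) u by simp
  have "j = 2 * (- u\<^sup>2*j\<^sup>2 - u*j - 3*u - 1)" using e2 by (simp add: algebra_simps)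
  then obtain i where i: "j = 2*i" by blast
  have e3: "4*(u*i)\<^sup>2 + 2*(u*i) + i + 3*u+1 = 0" using e2 unfolding i by (simp add: power2_eq_square algebra_simps)
  have "i \<noteq> 0"
  proof
    assume "i = 0"
    hence "3*u + 1 = 0" using e3 by simp
    thus False by presburger
  qed
  have "u \<noteq> 0" using assms u by simp
  have ab: "\<bar>u\<bar> * 1 \<le> \<bar>u\<bar>*\<bar>i\<bar>" "1*\<bar>i\<bar> \<le> \<bar>u\<bar>*\<bar>i\<bar>"
    by (rule mult_mono; use \<open>i \<noteq> 0\<close> \<open>u \<noteq> 0\<close> in linarith)+
  hence b: "\<bar>u\<bar> \<le> \<bar>u*i\<bar>" "\<bar>i\<bar> \<le> \<bar>u*i\<bar>" by (simp_all add: abs_mult)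
  have "4*(u*i)\<^sup>2 \<le> 6 * \<bar>u*i\<bar>" using e3 b by linarith
  moreover have "(u*i)\<^sup>2 = \<bar>u*i\<bar> * \<bar>u*i\<bar>" by (simp add: power2_eq_square abs_mult_self_eq)
  ultimately have "\<bar>u*i\<bar> * (4*\<bar>u*i\<bar> - 6) \<le> 0" by (simp add: algebra_simps)
  moreover have "\<bar>u*i\<bar> \<ge> 1" using \<open>i \<noteq> 0\<close> \<open>u \<noteq> 0\<close> by (simp add: int_one_le_iff_zero_less)
  ultimately have "4*\<bar>u*i\<bar> - 6 \<le> 0" using mult_le_0_iff[of "\<bar>u*i\<bar>" "4*\<bar>u*i\<bar> - 6"] by linarith
  hence "\<bar>u\<bar> \<le> 1" "\<bar>i\<bar> \<le> 1" using b by linarith+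
  hence "u = 1 \<or> u = -1" "i = 1 \<or> i = -1" using \<open>i \<noteq> 0\<close> \<open>u \<noteq> 0\<close> by linarith+
  thus False using e3 by auto
qed

text \<open>By symmetry let \<open>D = l - k > 0\<close>. The equation makes \<open>8 l (l-1)\<close> at most \<open>D\<^sup>2\<close>, which is
  too small for \<open>l = k + D\<close>.\<close>
lemma exponents_equal_const_e:
  fixes k l :: int
  assumes "(l-k)*((l-k) + l*(l-1) - k*(k-1)) = 2*((l-k) + 2*(l*(l-1)))*((l-k) - 2*(k*(k-1)))"
  shows "k = l"
proof (rule ccontr)
  have main: False if eq: "P*(3*D-8*Q) = D*(3*Q-D)" and D: "D > 0" and P: "P = (k+D)*(k+D-1)" and Q: "Q = k*(k-1)" for k D P Q :: int
  proof -
    have Q0: "Q \<ge> 0" unfolding Q by (cases "k \<ge> 1") (auto simp: mult_nonneg_nonneg mult_nonpos_nonpos)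
    have P0: "P \<ge> 0" unfolding P by (cases "k + D \<ge> 1") (auto simp: mult_nonneg_nonneg mult_nonpos_nonpos)
    have d1: "3*D > 8*Q"
    proof (rule ccontr)
      assume "\<not> ?thesis"
      hence "P*(3*D-8*Q) \<le> 0" using P0 by (simp add: mult_nonneg_nonpos)
      hence "3*Q - D \<le> 0" using eq D by (simp add: mult_le_0_iff)
      thus False using \<open>\<not> 3*D > 8*Q\<close> Q0 D by linarith
    qed
    have "P * 1 \<le> P*(3*D-8*Q)" using P0 d1 by (intro mult_left_mono) auto
    hence P1: "P \<le> D*(3*Q-D)" using eq by simp
    have "8*(D*(3*Q-D)) = D*(24*Q-8*D)" by (simp add: algebra_simps)
    also have "\<dots> \<le> D*D" using d1 D by (intro mult_left_mono) auto
    finally have P2: "8*P \<le> D*D" using P1 by linarith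
    have "3*Q - D \<ge> 0" using P1 P0 D by (smt (verit) zero_le_mult_iff)
    hence Qp: "Q > 0" using D by linarith
    hence k: "k \<ge> 2 \<or> k \<le> -1" unfolding Q by (smt (verit) mult_eq_0_iff)
    thus False
    proof
      assume "k \<ge> 2"
      hence "(k+D)*(k+D-1) \<ge> D*D" using D by (intro mult_mono) auto
      hence "8*(D*D) \<le> D*D" using P P2 by linarith
      thus False using mult_pos_pos[OF D D] by linarith
    next
      assume k: "k \<le> -1"
      have "2*(-k) \<le> (1-k)*(-k)" using k by (intro mult_right_mono) auto
      hence "Q \<ge> 2*(-k)" unfolding Q by (simp add: algebra_simps)
      hence "3*D > -16*k" using d1 by linarith
      have "2 - 2*k \<le> D" using \<open>3*D > -16*k\<close> k by linarith
      hence "D \<le> 2*(k+D-1)" "D \<le> 2*(k+D)" by (simp_all add: algebra_simps)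
      hence "(2*(k+D))*(2*(k+D-1)) \<ge> D*D" using D by (intro mult_mono) auto
      hence "4*P \<ge> D*D" unfolding P by (simp add: algebra_simps)
      thus False using P2 mult_pos_pos[OF D D] by linarith
    qed
  qed
  assume "k \<noteq> l"
  hence "k < l \<or> l < k" by auto
  thus False
  proof
    assume "k < l"
    from main[of "l*(l-1)" "l-k" "k*(k-1)" k] this assms show False by (simp add: algebra_simps power2_eq_square)
  next
    assume "l < k"
    from main[of "k*(k-1)" "k-l" "l*(l-1)" l] this assms show False by (simp add: algebra_simps power2_eq_square)
  qed
qed

text \<open>The disjunction comes from the degrees along the two orbits. Substituting any of the four linear
  relations into the equation leaves a polynomial in one variable that is visibly positive
  outside a few small values.\<close>
lemma exponents_equal_const_a:
  fixes k l :: int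
  assumes eq: "2*(l-k)\<^sup>2 + 3*(l-k)*(l*(l-1)) + 2*(k*(k-1))*(l*(l-1)) = 0"
    and c: "(l \<ge> 1 \<and> k \<ge> 1 \<and> 2*k = 3*l-1) \<or> (l \<ge> 1 \<and> k \<le> 0 \<and> -2*k = 3*l-2) \<or> (l \<le> 0 \<and> k \<ge> 1 \<and> 2*k = 1-3*l)
       \<or> (l \<le> 0 \<and> k \<le> 0 \<and> 2*k = 3*l)"
  shows "k = l"
proof -
  have eq2: "2*(2*l-2*k)\<^sup>2 + 6*(2*l-2*k)*(l*(l-1)) + 2*((2*k)*(2*k-2))*(l*(l-1)) = 0" (is "?f (2*k) = 0")
  proof -
    have "?f (2*k) = 4*(2*(l-k)\<^sup>2 + 3*(l-k)*(l*(l-1)) + 2*(k*(k-1))*(l*(l-1)))" by algebra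
    thus ?thesis using eq by simp
  qed
  from c consider (1) "l \<ge> 1" "2*k = 3*l-1" | (2) "l \<ge> 1" "2*k = 2-3*l" | (3) "l \<le> 0" "2*k = 1-3*l" | (4) "l \<le> 0" "2*k = 3*l"
    by linarith
  thus ?thesis
  proof cases
    case 1
    have "?f (3*l-1) = 2*((3*l-1)*(l-1))\<^sup>2" by algebra
    hence "(3*l-1)*(l-1) = 0" using eq2 1 by simp
    hence "3*l - 1 = 0 \<or> l = 1" by simp
    thus ?thesis using 1 by presburger
  next
    case 2
    have f: "?f (2-3*l) = 2*((5*l-2)\<^sup>2 + 3*(l*(l-1))*(3*l\<^sup>2+3*l-2))" by algebra
    have "3*(l*(l-1))*(3*l\<^sup>2+3*l-2) \<ge> 0" using 2 by (intro mult_nonneg_nonneg) (auto simp: power2_eq_square intro: order_trans[of _ "3*l"])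
    moreover have "(5*l-2)\<^sup>2 > 0" using 2 by simp
    ultimately have "(5*l-2)\<^sup>2 + 3*(l*(l-1))*(3*l\<^sup>2+3*l-2) > 0" by (rule add_pos_nonneg[rotated])
    thus ?thesis using eq2 unfolding 2(2) f by simp
  next
    case 3
    define j where "j = -l"
    have j: "j \<ge> 0" "l = -j" using 3 j_def by auto
    have "?f (1-3*l) = 2*((5*j+1)\<^sup>2 + (j*(j+1))*(9*j\<^sup>2-15*j-4))" unfolding j(2) by algebra
    hence z: "(5*j+1)\<^sup>2 + (j*(j+1))*(9*j\<^sup>2-15*j-4) = 0" using eq2 3 by simp
    have "j = 0 \<or> j = 1 \<or> j \<ge> 2" using j by linarith
    moreover have False if "j \<ge> 2"
    proof -
      have "9*j\<^sup>2-15*j-4 = 9*(j-2)\<^sup>2 + 21*(j-2) + 2" by algebra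
      moreover have "9*(j-2)\<^sup>2 \<ge> 0" "21*(j-2) \<ge> 0" using that by simp_all
      ultimately have "9*j\<^sup>2-15*j-4 \<ge> 0" by linarith
      hence "(j*(j+1))*(9*j\<^sup>2-15*j-4) \<ge> 0" using that by simp
      moreover have "(5*j+1)\<^sup>2 > 0" using that by simp
      ultimately show False using z by linarith
    qed
    ultimately show ?thesis using z by auto
  next
    case 4
    define j where "j = -l"
    have j: "j \<ge> 0" "l = -j" using 4 j_def by auto
    have "?f (3*l) = 2*j\<^sup>2*(1 + 3*(j+1) + 3*(3*j+2)*(j+1))" unfolding j(2) by algebra
    moreover have "1 + 3*(j+1) + 3*(3*j+2)*(j+1) > 0" using j by (simp add: add_pos_nonneg)
    ultimately have "j = 0" using eq2 4 by auto
    thus ?thesis using 4 j by simp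
  qed
qed

lemma int_no_root_cubic: "k*(k\<^sup>2+11) + 3 \<noteq> (0::int)"
proof
  assume "k*(k\<^sup>2+11) + 3 = 0"
  hence "3 = (k\<^sup>2+11) * (-k)" by (simp add: algebra_simps)
  hence "k\<^sup>2 + 11 dvd 3" by (rule dvdI)
  hence "k\<^sup>2 + 11 \<le> 3" by (rule zdvd_imp_le) simp
  thus False using zero_le_power2[of k] by linarith
qed

lemma int_no_root_quartic: "2*l^4 + l^3 + 10*l\<^sup>2 - l - 3 \<noteq> (0::int)"
proof
  assume "2*l^4 + l^3 + 10*l\<^sup>2 - l - 3 = 0"
  hence "l*(l\<^sup>2 - 1) = 3 - 2*l^4 - 10*l\<^sup>2" by (simp add: algebra_simps power2_eq_square power3_eq_cube)
  moreover have "even (l*(l\<^sup>2-1))" by simp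
  ultimately have "even (3 - 2*l^4 - 10*l\<^sup>2)" by simp
  thus False by simp
qed

text \<open>As in \<open>exponents_equal_const_a\<close>, the degrees supply a linear relation, and the equation becomes a positive
  polynomial in one variable apart from the exception.\<close>
lemma int_solution_0_a:
  fixes l M :: int
  assumes eq: "6*l^3 + 6*l\<^sup>2*M + 3*l\<^sup>2 + l\<^sup>2*M\<^sup>2 + 6*l*M + 2*M\<^sup>2 = 0"
    and c: "(l > 0 \<and> \<bar>M\<bar> = 3*l) \<or> (l < 0 \<and> \<bar>M\<bar> + 1 = -3*l)"
  shows "l = 1 \<and> M = -3"
  using c
proof (elim disjE conjE)
  assume l: "l > 0" "\<bar>M\<bar> = 3*l"
  hence "M = 3*l \<or> M = -3*l" by linarith
  thus ?thesis
  proof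
    assume M: "M = 3*l"
    have "6*l^3 + 6*l\<^sup>2*M + 3*l\<^sup>2 + l\<^sup>2*M\<^sup>2 + 6*l*M + 2*M\<^sup>2 > 0" unfolding M using l(1)
      by (intro add_pos_pos) simp_all
    thus ?thesis using eq by linarith
  next
    assume M: "M = -3*l"
    have "3*l\<^sup>2*((3*l-1)*(l-1)) = 0" using eq unfolding M by algebra
    hence "(3*l-1)*(l-1) = 0" using l by simp
    hence "3*l - 1 = 0 \<or> l = 1" by simp
    hence "l = 1" by presburger
    thus ?thesis using M by simp
  qed
next
  assume l: "l < 0" "\<bar>M\<bar> + 1 = -3*l"
  define j where "j = -l"
  have j: "j \<ge> 1" "l = -j" using l j_def by auto
  have "M = 3*j-1 \<or> M = 1-3*j" using l j by linarith
  thus ?thesis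
  proof
    assume M: "M = 3*j-1"
    have "6*l^3 + 6*l\<^sup>2*M + 3*l\<^sup>2 + l\<^sup>2*M\<^sup>2 + 6*l*M + 2*M\<^sup>2 = 9*(j\<^sup>2)\<^sup>2 + 6*j^3 - 2*j\<^sup>2 - 6*j + 2"
      unfolding M j(2) by algebra
    moreover have "9*(j\<^sup>2)\<^sup>2 + 6*j^3 - 2*j\<^sup>2 - 6*j + 2 = (3*j\<^sup>2-1)\<^sup>2 + 6*j*(j\<^sup>2-1) + 4*j\<^sup>2 + 1" by algebra
    moreover have "j\<^sup>2 \<ge> 1" using j by simp
    hence "6*j*(j\<^sup>2-1) \<ge> 0" using j by simp
    ultimately show ?thesis using eq zero_le_power2[of "3*j\<^sup>2-1"] zero_le_power2[of j] by linarith
  next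
    assume M: "M = 1-3*j"
    have "6*l^3 + 6*l\<^sup>2*M + 3*l\<^sup>2 + l\<^sup>2*M\<^sup>2 + 6*l*M + 2*M\<^sup>2 = (j*(3*j-5))\<^sup>2 + 12*j\<^sup>2 + 9*(j-1)\<^sup>2 - 7"
      unfolding M j(2) by algebra
    moreover have "j\<^sup>2 \<ge> 1" using j by simp
    ultimately show ?thesis using eq zero_le_power2[of "j*(3*j-5)"] zero_le_power2[of "j-1"] by linarith
  qed
qed

section \<open>Triples with a strictly dominant element: equal starting points\<close>

context quad_lt begin

text \<open>Over the constants, \<open>e\<close> depends linearly on \<open>b\<close>. So \<open>ae+1\<close> and \<open>be+1\<close> are quadratic expressions in \<open>r\<close> and in \<open>b\<close> that
  have to be squares, which gives \<open>a\<kappa> = n\<^sup>2\<close> and \<open>\<kappa>\<^sup>2 = 4n\<^sup>2(n+1)\<close>. Eliminating \<open>a\<close>, \<open>p\<close> and \<open>\<kappa>\<close> leaves an equation for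
  \<open>M\<close> and \<open>N\<close>.\<close>
lemma no_orbit_a_a:
  assumes "w\<^sup>2 = c*d+1" "degree a = 0" "p\<^sup>2 = a\<^sup>2+1" "even M" "even N" "w = orbit_z s c s p M" "w = orbit_z t c s r N"
  shows False
proof -
  define m n :: "complex poly" where mn: "m = of_int M" "n = of_int N"
  have dmn: "degree m = 0" "degree n = 0" using mn by auto
  have "degree (p\<^sup>2) = 0" unfolding assms(3) using assms(2) by (intro deg0_simps) auto
  hence dp: "degree p = 0" by (simp add: degree_square_complex)
  have id: "a*m\<^sup>2 + 2*m*p = b*n\<^sup>2 + n*(a+b-e)" using ident_a_a[OF assms(4-7) dp] mn by simp
  have n: "n \<noteq> 0"
  proof
    assume "n = 0"
    hence "w = s" using assms(7) mn by (simp add: orbit_z_def)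
    hence "c * d + 1 = a * c + 1" using assms(1) ss by metis
    hence "c * (d - a) = 0" by algebra
    thus False using nz by simp
  qed
  have n1: "n + 1 \<noteq> 0"
  proof
    assume "n + 1 = 0"
    hence "(of_int (N+1) :: complex poly) = 0" using mn by simp
    thus False using assms(5) by (simp only: of_int_eq_0_iff) presburger
  qed
  \<comment> \<open>The identity reads \<open>n e = (n\<^sup>2+n) b + \<kappa>\<close>, with a constant \<open>\<kappa>\<close> because \<open>a\<close> and \<open>p\<close> are constant.\<close>
  define \<kappa> where "\<kappa> = n*a - a*m\<^sup>2 - 2*m*p"
  have dk: "degree \<kappa> = 0" unfolding \<kappa>_def using dmn assms(2) dp by (intro deg0_simps) auto
  have ne: "n*e = (n\<^sup>2+n)*b + \<kappa>" using id unfolding \<kappa>_def by algebra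
  have "degree r > 0" using root_degrees deg by simp
  moreover have "(n\<^sup>2*(n+1)) * r\<^sup>2 + n*(a*\<kappa> - n\<^sup>2) = (n*(a*t-r*s))\<^sup>2"
    unfolding power_mult_distrib e_roots rr using ne by algebra
  ultimately have "n*(a*\<kappa> - n\<^sup>2) = 0" using n n1 dmn dk assms(2)
    by (intro no_square_shift[of "n\<^sup>2*(n+1)" _ r "n*(a*t-r*s)"]) (auto intro!: deg0_simps)
  hence ak: "a*\<kappa> = n\<^sup>2" using n by simp
  have "(n\<^sup>2*(n+1))*b\<^sup>2 + (n*\<kappa>)*b + n\<^sup>2 = (n*(b*s-r*t))\<^sup>2"
    unfolding power_mult_distrib e_roots using ne by algebra
  \<comment> \<open>The square \<open>(n(bs-rt))\<^sup>2\<close> is a quadratic in \<open>b\<close>, so its discriminant vanishes.\<close>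
  from quadratic_square[OF _ _ _ _ _ this] have "(n*\<kappa>)\<^sup>2 = 4*(n\<^sup>2*(n+1))*n\<^sup>2"
    using n n1 dmn dk deg by (auto simp: deg0_simps)
  hence "n\<^sup>2*(\<kappa>\<^sup>2 - 4*n\<^sup>2*(n+1)) = 0" by algebra
  hence k2: "\<kappa>\<^sup>2 = 4*n\<^sup>2*(n+1)" using n by simp
  have "n\<^sup>2*(n\<^sup>2 - 4*a\<^sup>2*(n+1)) = 0" using ak k2 by algebra
  hence a2: "n\<^sup>2 = 4*a\<^sup>2*(n+1)" using n by simp
  have "(4*(n+1)*(a*p))\<^sup>2 = (n*(n+2))\<^sup>2" using a2 assms(3) by algebra
  from square_eq_cases[OF this]
  have "4*(n+1)*(a*p) = of_int 1 * n*(n+2) \<or> 4*(n+1)*(a*p) = of_int (-1) * n*(n+2)" by simp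
  then obtain \<sigma> :: int where \<sigma>: "\<sigma> = 1 \<or> \<sigma> = -1" "4*(n+1)*(a*p) = of_int \<sigma> * n*(n+2)"
    by blast
  have "4*(n+1)*(a*\<kappa>) = n*(4*a\<^sup>2*(n+1)) - m\<^sup>2*(4*a\<^sup>2*(n+1)) - 2*m*(4*(n+1)*(a*p))"
    unfolding \<kappa>_def by algebra
  hence "n*(n*m\<^sup>2 + 2*(n+2)*(of_int \<sigma>*m) + 3*n\<^sup>2+4*n) = 0" unfolding ak \<sigma>(2) a2[symmetric] by algebra
  hence "n*m\<^sup>2 + 2*(n+2)*(of_int \<sigma>*m) + 3*n\<^sup>2+4*n = 0" using n by simp
  hence "(of_int (N*M\<^sup>2 + 2*(N+2)*(\<sigma>*M) + 3*N\<^sup>2+4*N) :: complex poly) = 0" unfolding mn by simp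
  hence z: "N*M\<^sup>2 + 2*(N+2)*(\<sigma>*M) + 3*N\<^sup>2+4*N = 0" by (simp only: of_int_eq_0_iff)
  obtain k l where kl: "\<sigma>*M = 2*k" "N = 2*l" using assms(4,5) by (auto elim!: evenE)
  have "M\<^sup>2 = (\<sigma>*M)\<^sup>2" using \<sigma>(1) by auto
  hence "M\<^sup>2 = (2*k)\<^sup>2" unfolding kl(1) .
  hence "2*l*k\<^sup>2 + 2*(l+1)*k + 3*l\<^sup>2 + 2*l = 0" using z unfolding kl by (simp add: power2_eq_square algebra_simps)
  moreover have "l \<noteq> 0" using n kl mn by auto
  ultimately show False by (rule int_no_solution_a_a)
qed

text \<open>The degree of \<open>w\<close> along either orbit, in units of half the degree of \<open>b\<close>.\<close>
lemma degrees_e_e: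
  assumes "degree a = 0" "degree e = degree b"
   and "w = orbit_z s c w0 (a*t-r*s) M" "w = orbit_z t c w0 (b*s-r*t) N" "even M" "even N"
  shows "(if M \<ge> 1 then 2*M+1 else 3-2*M) = (if N \<ge> 1 then 3*N-1 else 3-3*N)"
proof -
  define \<beta> where "\<beta> = degree b"
  have D: "degree c = 2*\<beta>" "degree s = \<beta>" "2*degree t = 3*\<beta>" "2*degree w0 = 3*\<beta>" "2*degree r = \<beta>" "\<beta> > 0"
    unfolding \<beta>_def using deg_e(1) assms(1,2) root_degrees deg_w0(1) deg(3) by simp_all
  have "r \<noteq> 0" using D by auto
  hence cr: "2*degree (c*r) = 5*\<beta>" "c*r \<noteq> 0" using D nz(3) by (auto simp: degree_mult_eq)
  have one: "s*w0 + c*(a*t-r*s) = -t" "t*w0 + c*(b*s-r*t) = -s"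
    unfolding w0_def using ss tt by algebra+
  have A: "2 * int (degree w) = \<beta> * (if M \<ge> 1 then 2*M+1 else 3-2*M)"
  proof -
    have sw: "2 * degree (2*s*w0) = 5*\<beta>" using D deg_w0 deg_lt by (simp add: degree_mult_eq)
    have m1: "s*w0 - c*(a*t-r*s) = 2*s*w0 + t" using one(1) by algebra
    have m2: "degree (2*s*w0 + t) = degree (2*s*w0)" using sw D by (intro degree_add_eq_left) linarith
    consider "M \<ge> 1" | "M = 0" | "M \<le> -1" by linarith
    thus ?thesis
    proof cases
      case 1
      have "degree w = degree t + nat (M-1) * degree s"
        using orbit_z_degree_pos[OF ss _ _ _ 1, of w0 "a*t-r*s"] D deg_lt assms(3) unfolding one by simp
      hence "2 * int (degree w) = 2 * int (degree t) + 2*(M-1) * \<beta>" using D 1 by simp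
      moreover have "2 * int (degree t) = 3*\<beta>" using D by simp
      ultimately show ?thesis using 1 by (simp add: algebra_simps)
    next
      case 2
      thus ?thesis using assms(3) D by (simp add: orbit_z_def)
    next
      case 3
      have "2*s*w0 + t \<noteq> 0" using m2 sw D by auto
      hence "degree w = degree (2*s*w0) + nat (-M-1) * degree s"
        using orbit_z_degree_neg[OF ss _ _ _ 3, of w0 "a*t-r*s"] D assms(3) m2 sw unfolding m1 by simp
      hence "2 * int (degree w) = 2 * int (degree (2*s*w0)) + 2*(-M-1) * \<beta>" using D 3 by simp
      moreover have "2 * int (degree (2*s*w0)) = 5*\<beta>" using sw by linarith
      ultimately show ?thesis using 3 by (simp add: algebra_simps)
    qed
  qed
  have B: "2 * int (degree w) = \<beta> * (if N \<ge> 1 then 3*N-1 else 3-3*N)"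
  proof -
    have tw: "2 * degree (2*t*w0) = 6*\<beta>" using D deg_w0 deg_lt by (simp add: degree_mult_eq)
    have m1: "t*w0 - c*(b*s-r*t) = 2*t*w0 + s" using one(2) by algebra
    have m2: "degree (2*t*w0 + s) = degree (2*t*w0)" using tw D by (intro degree_add_eq_left) linarith
    have "N \<noteq> 1" using assms(6) by auto
    then consider "N \<ge> 2" | "N = 0" | "N \<le> -1" by linarith
    thus ?thesis
    proof cases
      case 1
      have b1: "orbit_z t c w0 (b*s-r*t) 1 = -s" using one(2) by (simp add: orbit_z_def)
      have y1: "orbit_x t b w0 (b*s-r*t) 1 = -r" unfolding orbit_x_def w0_def cheb_one using tt by algebra
      have w: "w = orbit_z t c (-s) (-r) (N-1)" using orbit_z_shift[OF tt, of w0 "b*s-r*t" "N-1" 1] assms(4) b1 y1 by simp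
      have e: "t*(-s) + c*(-r) = w0 - 2*(c*r)" unfolding w0_def by algebra
      have de: "degree (w0 - 2*(c*r)) = degree (c*r)" using cr D degree_add_eq_right[of w0 "-2*(c*r)"] by simp
      hence "w0 - 2*(c*r) \<noteq> 0" using cr D by auto
      hence "degree w = degree (c*r) + nat (N-1-1) * degree t"
        using orbit_z_degree_pos[OF tt _ _ _, of "-s" "-r" "N-1"] D 1 w cr unfolding e de by simp
      hence "2 * int (degree w) = int (2 * degree (c*r)) + (N-2) * int (2 * degree t)" using 1 by (simp add: algebra_simps)
      thus ?thesis using 1 unfolding cr D by (simp add: algebra_simps)
    next
      case 2
      thus ?thesis using assms(4) D by (simp add: orbit_z_def)
    next
      case 3
      have "2*t*w0 + s \<noteq> 0" using m2 tw D by auto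
      hence "degree w = degree (2*t*w0) + nat (-N-1) * degree t"
        using orbit_z_degree_neg[OF tt _ _ _ 3, of w0 "b*s-r*t"] D assms(4) m2 tw unfolding m1 by simp
      hence "2 * int (degree w) = int (2 * degree (2*t*w0)) + (-N-1) * int (2*degree t)" using 3 by (simp add: algebra_simps)
      thus ?thesis using 3 unfolding tw D by (simp add: algebra_simps)
    qed
  qed
  show ?thesis using A B D by simp
qed

text \<open>For equal exponents \<open>ident_e_e\<close> leaves \<open>M = N = 0\<close> and \<open>M = N = 2\<close>, and these are the two regular
  extensions. For different exponents \<open>e\<close> is a rational linear combination of \<open>a\<close> and \<open>b\<close>. If \<open>a\<close> or \<open>e\<close> is
  constant, the conditions that \<open>ae+1\<close> and \<open>be+1\<close> be squares lead to equations for the exponents.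
  Otherwise \<open>{a, b, e}\<close> is a regular triple, so a root of \<open>ab+1\<close> is a combination of \<open>a\<close> and \<open>b\<close>, against
  \<open>dependence_const\<close>.\<close>
lemma regular_orbit_e_e:
  assumes "w\<^sup>2 = c*d+1" "even M" "even N" "w = orbit_z s c w0 (a*t-r*s) M" "w = orbit_z t c w0 (b*s-r*t) N"
  shows "D1_regular a b c d"
proof (cases "M = N")
  case True
  define m :: "complex poly" where m: "m = of_int M"
  have "a*m\<^sup>2 + m*(b-a-e) = b*m\<^sup>2 + m*(a-b-e)" using ident_e_e[OF assms(2-)] True m by simp
  hence "(b - a)*m*(m-2) = 0" by algebra
  hence "m = of_int 0 \<or> m = of_int 2" using nz by simp
  hence "M = 0 \<or> M = 2" unfolding m of_int_eq_iff .
  thus ?thesis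
  proof
    assume "M = 0"
    hence "w = c*r - s*t" using assms(4) by (simp add: orbit_z_def w0_def)
    thus ?thesis using assms(1) by (intro regular_from_root) auto
  next
    assume "M = 2"
    \<comment> \<open>Two steps from the root of \<open>c e + 1\<close> lies the root belonging to the large regular extension.\<close>
    have "cheb_T s 2 = 2*s\<^sup>2-1" "cheb_U s 2 = 2*s" using cheb_Suc[of s 1] by (simp_all add: power2_eq_square algebra_simps)
    hence "w = (2*s\<^sup>2-1)*(c*r-s*t) + c*(2*s)*(a*t-r*s)" using assms(4) \<open>M = 2\<close> by (simp add: orbit_z_def w0_def)
    hence "w = -(c*r+s*t)" using ss by algebra
    hence "w\<^sup>2 = (c*r+s*t)\<^sup>2" by (simp only: power2_minus)
    thus ?thesis using assms(1) by (intro regular_from_root) auto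
  qed
next
  case False
  define m n :: "complex poly" where mn: "m = of_int M" "n = of_int N"
  \<comment> \<open>The identity says that \<open>D e\<close> is a combination of \<open>a\<close> and \<open>b\<close> with coefficients \<open>A = D + L\<close>
    and \<open>B = D - K\<close> that are integers.\<close>
  define D K L where "D = n - m" and "K = m\<^sup>2 - 2*m" and "L = n\<^sup>2 - 2*n"
  have dDKL: "degree D = 0" "degree K = 0" "degree L = 0"
    unfolding D_def K_def L_def mn by (intro deg0_simps; simp add: deg0_simps)+
  obtain k l where kl: "M = 2*k" "N = 2*l" using assms(2,3) by (auto elim!: evenE)
  have ints: "D = of_int (2*(l-k))" "K = of_int (4*(k*(k-1)))" "L = of_int (4*(l*(l-1)))"
    unfolding D_def K_def L_def mn kl by (simp_all add: power2_eq_square algebra_simps)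
  have D0: "D \<noteq> 0" unfolding ints of_int_eq_0_iff using False kl by simp
  have De: "D*e = (D+L)*b + (D-K)*a"
    using ident_e_e[OF assms(2-)] unfolding D_def K_def L_def mn by algebra
  define A B where "A = D + L" and "B = D - K"
  have dAB: "degree A = 0" "degree B = 0" unfolding A_def B_def using dDKL by (auto intro: deg0_simps)
  have De: "D*e = A*b + B*a" using De A_def B_def by simp
  \<comment> \<open>Both right-hand sides are quadratic forms in \<open>a\<close> and \<open>b\<close> with constant coefficients, plus a
    constant, that have to be squares.\<close>
  have sqe: "D\<^sup>2*(a*t-r*s)\<^sup>2 = D*a*(A*b+B*a) + D\<^sup>2" "D\<^sup>2*(b*s-r*t)\<^sup>2 = D*b*(A*b+B*a) + D\<^sup>2"
    unfolding e_roots De[symmetric] by algebra+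
  show ?thesis
  proof (cases "degree a = 0")
    case a0: True
    have dr: "degree r > 0" using root_degrees deg a0 by simp
    show ?thesis
    proof (cases "A = 0")
      case True
      have "degree (D*e) = 0" unfolding De True using a0 dAB by (auto intro: deg0_simps)
      hence "degree e = 0" using deg0_scale_eq[OF dDKL(1) D0] by simp
      from const_partner_unique[OF this a0 deg_e(2) nz(1) deg(3), of "b*s-r*t" r]
      have "e = a" using e_roots(2) rr by (simp add: mult.commute)
      hence "D*a = B*a" using De unfolding True by simp
      hence "(D - B)*a = 0" by algebra
      hence "K = 0" using nz B_def by simp
      hence "k*(k-1) = 0" unfolding ints of_int_eq_0_iff by simp
      moreover have "of_int (2*(l-k) + 4*(l*(l-1))) = (0::complex poly)"
        using True unfolding A_def ints by simp
      hence "2*(l-k) + 4*(l*(l-1)) = 0" unfolding of_int_eq_0_iff .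
      ultimately have "k = 0 \<or> k = 1" "l - k + 2*(l*(l-1)) = 0" by auto
      hence "l*(2*l-1) = 0 \<or> (l-1)*(2*l+1) = 0" by (auto simp: algebra_simps)
      hence "(k = 0 \<and> l = 0) \<or> (k = 1 \<and> l = 1) \<or> (k = 1 \<and> l*(2*l-1) = 0) \<or> (k = 0 \<and> (l-1)*(2*l+1) = 0)"
        using \<open>k = 0 \<or> k = 1\<close> by (auto; presburger)
      thus ?thesis using \<open>l - k + 2*(l*(l-1)) = 0\<close> False kl by (auto; presburger)
    next
      case A0: False
      have "(D*A)*r\<^sup>2 + (D*B*a\<^sup>2 + D\<^sup>2 - D*A) = (D*(a*t-r*s))\<^sup>2"
        unfolding power_mult_distrib sqe rr by algebra
      from no_square_shift[OF _ _ _ dr this] have "D*B*a\<^sup>2 + D\<^sup>2 - D*A = 0"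
        using D0 A0 dDKL dAB a0 by (auto simp: deg0_simps)
      hence "D*(B*a\<^sup>2 + D - A) = 0" by algebra
      hence 1: "B*a\<^sup>2 = L" using D0 A_def by simp
      have "(D*A)*b\<^sup>2 + (D*B*a)*b + D\<^sup>2 = (D*(b*s-r*t))\<^sup>2"
        unfolding power_mult_distrib sqe by algebra
      from quadratic_square[OF _ _ _ _ deg(3) this] have "(D*B*a)\<^sup>2 = 4*(D*A)*D\<^sup>2"
        using D0 A0 dDKL dAB a0 by (auto simp: deg0_simps)
      hence "D\<^sup>2 * (B * (B*a\<^sup>2) - 4*D*A) = 0" by algebra
      hence "B * L - 4*D*A = 0" using D0 1 by simp
      hence "of_int (8*(2*(l-k)\<^sup>2 + 3*(l-k)*(l*(l-1)) + 2*(k*(k-1))*(l*(l-1)))) = (0::complex poly)"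
        unfolding A_def B_def ints by (simp add: power2_eq_square algebra_simps)
      hence eq: "2*(l-k)\<^sup>2 + 3*(l-k)*(l*(l-1)) + 2*(k*(k-1))*(l*(l-1)) = 0" unfolding of_int_eq_0_iff by simp
      have "degree (D*e) = degree b"
      proof -
        have "degree (A*b + B*a) = degree (A*b)"
          using deg deg0_scale_eq[OF dAB(1) A0, of b] a0 dAB by (intro degree_add_eq_left) (simp add: deg0_simps)
        thus ?thesis unfolding De using deg0_scale_eq[OF dAB(1) A0, of b] by simp
      qed
      hence "degree e = degree b" using deg0_scale_eq[OF dDKL(1) D0] by simp
      from degrees_e_e[OF a0 this assms(4,5,2,3)]
      have "k = l" unfolding kl by (intro exponents_equal_const_a[OF eq]) (auto split: if_splits; linarith)
      thus ?thesis using False kl by simp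
    qed
  next
    case a0: False
    have A0: "A \<noteq> 0"
    proof
      assume A: "A = 0"
      hence "(D*B)*a\<^sup>2 + D\<^sup>2 = (D*(a*t-r*s))\<^sup>2" unfolding power_mult_distrib sqe by algebra
      moreover have "B \<noteq> 0" using A De deg_e(2) D0 by auto
      ultimately have "D\<^sup>2 = 0" using no_square_shift[of "D*B" "D\<^sup>2" a] D0 dDKL dAB a0 by (auto simp: deg0_simps)
      thus False using D0 by simp
    qed
    show ?thesis
    proof (cases "degree e = 0")
      case e0: True
      have B0: "B \<noteq> 0"
      proof
        assume "B = 0"
        hence "degree (A*b) = 0" using De e0 dDKL by (metis add.right_neutral deg0_mult mult_zero_left)
        thus False using deg0_scale_eq[OF dAB(1) A0] deg by simp
      qed
      have se: "degree (a*t-r*s) > 0"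
      proof -
        have "2 * degree (a*t-r*s) = degree a + degree e" using a0 nz deg_e by (intro deg_root e_roots) auto
        thus ?thesis using a0 by simp
      qed
      have "(-(A*B))*(a*t-r*s)\<^sup>2 + A*(D*e\<^sup>2+A+B) = (A*(b*s-r*t))\<^sup>2"
        unfolding power_mult_distrib e_roots using De by algebra
      from no_square_shift[OF _ _ _ se this] have "A*(D*e\<^sup>2+A+B) = 0"
        using A0 B0 dAB dDKL e0 by (auto simp: deg0_simps)
      hence 1: "D*e\<^sup>2+A+B = 0" using A0 by simp
      have "(-(A*B))*a\<^sup>2 + (A*D*e)*a + A\<^sup>2 = (A*r)\<^sup>2" unfolding power_mult_distrib rr using De by algebra
      from quadratic_square[OF _ _ _ _ _ this] have "(A*D*e)\<^sup>2 = 4*(-(A*B))*A\<^sup>2"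
        using A0 B0 dAB dDKL e0 a0 by (auto simp: deg0_simps)
      hence "A\<^sup>2*(D*(D*e\<^sup>2) + 4*A*B) = 0" by algebra
      hence "D*(D*e\<^sup>2) + 4*A*B = 0" using A0 by simp
      hence "D*(A+B) = 4*A*B" using 1 by algebra
      hence "of_int (8*((l-k)*((l-k) + l*(l-1) - k*(k-1)) - 2*((l-k) + 2*(l*(l-1)))*((l-k) - 2*(k*(k-1))))) = (0::complex poly)"
        unfolding A_def B_def ints by (simp add: power2_eq_square algebra_simps)
      hence "(l-k)*((l-k) + l*(l-1) - k*(k-1)) = 2*((l-k) + 2*(l*(l-1)))*((l-k) - 2*(k*(k-1)))"
        unfolding of_int_eq_0_iff by simp
      hence "k = l" by (rule exponents_equal_const_e)
      thus ?thesis using False kl by simp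
    next
      case e0: False
      have le: "degree e \<le> degree b"
      proof -
        have "degree (D*e) \<le> degree b" unfolding De using deg dAB
          by (intro degree_add_le deg0_scale_le) auto
        thus ?thesis using deg0_scale_eq[OF dDKL(1) D0] by simp
      qed
      have "degree b < degree a + degree e"
      proof (cases "degree a < degree b")
        case True
        have "degree (A*b + B*a) = degree (A*b)"
          using True deg0_scale_eq[OF dAB(1) A0, of b] deg0_scale[OF dAB(2), of a] by (intro degree_add_eq_left) simp
        hence "degree (D*e) = degree b" unfolding De using deg0_scale_eq[OF dAB(1) A0, of b] by simp
        hence "degree e = degree b" using deg0_scale_eq[OF dDKL(1) D0] by simp
        thus ?thesis using a0 by simp
      next
        case False
        thus ?thesis using e0 deg by simp
      qed
      from regular_triple[OF e_roots(1) rr _ nz(1) deg_e(2) nz(2) deg(1) le this, of "b*s-r*t"]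
      have "(a+e-b)\<^sup>2 = 4*(a*e+1)" using e_roots(2) by (simp add: mult.commute)
      hence "(a+b-e)\<^sup>2 = 4*(a*b+1)" by algebra
      hence "4*D\<^sup>2*(a*b+1) = (D*(a+b)-D*e)\<^sup>2" by algebra
      also have "\<dots> = ((-L)*b+K*a)\<^sup>2" unfolding De A_def B_def by algebra
      finally have dep: "4*D\<^sup>2*(a*b+1) = ((-L)*b+K*a)\<^sup>2" .
      have "D\<^sup>2 \<noteq> (-L)*K"
      proof
        assume "D\<^sup>2 = (-L)*K"
        hence "of_int (4*((l-k)\<^sup>2 + 4*(l*(l-1))*(k*(k-1)))) = (0::complex poly)"
          unfolding ints by (simp add: power2_eq_square algebra_simps)
        hence "(l-k)\<^sup>2 + 4*(l*(l-1))*(k*(k-1)) = 0" unfolding of_int_eq_0_iff by simp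
        moreover have "j*(j-1) \<ge> 0" for j :: int
          by (cases "j \<ge> 1") (auto simp: mult_nonneg_nonneg mult_nonpos_nonpos)
        hence "4*(l*(l-1))*(k*(k-1)) \<ge> 0" by simp
        moreover have "(l-k)\<^sup>2 > 0" using False kl \<open>M \<noteq> N\<close> by simp
        ultimately show False by linarith
      qed
      from dependence_const[OF dep dDKL(1) _ dDKL(2) D0 this] a0 dDKL show ?thesis by simp
    qed
  qed
qed

end

section \<open>Triples with a strictly dominant element: different starting points\<close>

text \<open>The regular extension of \<open>{a, b, a}\<close> for a root \<open>s\<close> of \<open>a\<^sup>2+1\<close>, expressed by
  the solution \<open>\<theta>\<close> of \<open>\<theta>\<^sup>2 = 1 + 2a\<theta>\<close>.\<close>
lemma root_with_const_ext:
  fixes a b r s t :: "complex poly"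
  assumes "r\<^sup>2 = a*b+1" "s\<^sup>2 = a*a+1" "\<tau> = 1 \<or> \<tau> = -1" "t = \<tau>*r" "\<theta> = a + \<tau>*s"
    "c = a+b+a+2*a*b*a + 2*r*s*t"
  shows "\<theta>\<^sup>2 = 1 + 2*a*\<theta>" "c = \<theta>\<^sup>2*b+2*\<theta>"
     "-(b*s + r*t) = -\<tau>*(\<theta>*b+1)" "-(a*t + r*s) = -\<tau>*(\<theta>*r)"
proof -
  have tt: "\<tau>\<^sup>2 = 1" using assms(3) by auto
  show th: "\<theta>\<^sup>2 = 1 + 2*a*\<theta>" unfolding assms(5) using assms(2) tt by algebra
  show "c = \<theta>\<^sup>2*b+2*\<theta>" unfolding assms(6,4,5) using assms(1,2) tt by algebra
  show "-(b*s + r*t) = -\<tau>*(\<theta>*b+1)" unfolding assms(4,5) using assms(1) tt by algebra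
  show "-(a*t + r*s) = -\<tau>*(\<theta>*r)" unfolding assms(4,5) using tt by algebra
qed

context quad_lt begin

text \<open>Repeated passage to the other regular extension: \<open>c, e, e2, e3\<close> all extend \<open>{a, b}\<close>, any three
  consecutive ones being linked by a recurrence, and \<open>s1, t1\<close> and so on are the roots that belong to \<open>e, e2, e3\<close>.\<close>
definition s1 where "s1 = a*t - r*s"

definition t1 where "t1 = b*s - r*t"

definition e2 where "e2 = a+b+e+2*a*b*e - 2*r*s1*t1"

definition s2 where "s2 = a*t1 - r*s1"

definition t2 where "t2 = b*s1 - r*t1"

definition e3 where "e3 = a+b+e2+2*a*b*e2 - 2*r*s2*t2"

definition s3 where "s3 = a*t2 - r*s2"

definition t3 where "t3 = b*s2 - r*t2"

lemma chain1: "s1\<^sup>2 = a*e+1" "t1\<^sup>2 = b*e+1"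
  "c = a+b+e+2*a*b*e + 2*r*s1*t1" "s = -(a*t1 + r*s1)" "t = -(b*s1 + r*t1)"
  by (fact e_roots(1)[folded s1_def] e_roots(2)[folded t1_def] extension_inverse[OF rr ss tt e_def s1_def t1_def])+

lemma chain2: "s2\<^sup>2 = a*e2+1" "t2\<^sup>2 = b*e2+1"
  "e = a+b+e2+2*a*b*e2 + 2*r*s2*t2" "s1 = -(a*t2 + r*s2)" "t1 = -(b*s2 + r*t2)"
  "e2 * c = a\<^sup>2+b\<^sup>2+e\<^sup>2-2*a*b-2*a*e-2*b*e-4"
  by (fact extension_roots(1,2)[OF rr chain1(1,2) e2_def, folded s2_def t2_def]
      extension_inverse[OF rr chain1(1,2) e2_def s2_def t2_def]
      extension_roots(4)[OF rr chain1(1,2) e2_def, folded chain1(3)])+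

lemma chain3: "s3\<^sup>2 = a*e3+1" "t3\<^sup>2 = b*e3+1"
  "e2 = a+b+e3+2*a*b*e3 + 2*r*s3*t3" "s2 = -(a*t3 + r*s3)" "t2 = -(b*s3 + r*t3)"
  "e3 * e = a\<^sup>2+b\<^sup>2+e2\<^sup>2-2*a*b-2*a*e2-2*b*e2-4"
  by (fact extension_roots(1,2)[OF rr chain2(1,2) e3_def, folded s3_def t3_def]
      extension_inverse[OF rr chain2(1,2) e3_def s3_def t3_def]
      extension_roots(4)[OF rr chain2(1,2) e3_def, folded chain2(3)])+

lemma chain_rec: "s = -(2*r*s1 + s2)" "t = -(2*r*t1 + t2)" "s1 = -(2*r*s2 + s3)" "t1 = -(2*r*t2 + t3)"
  "e + e3 = 2*(a+b+e2+2*a*b*e2)"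
proof -
  show "s = -(2*r*s1 + s2)" unfolding s2_def by (subst chain1(4)) (simp add: algebra_simps)
  show "t = -(2*r*t1 + t2)" unfolding t2_def by (subst chain1(5)) (simp add: algebra_simps)
  show "s1 = -(2*r*s2 + s3)" unfolding s3_def by (subst chain2(4)) (simp add: algebra_simps)
  show "t1 = -(2*r*t2 + t3)" unfolding t3_def by (subst chain2(5)) (simp add: algebra_simps)
  show "e + e3 = 2*(a+b+e2+2*a*b*e2)" unfolding e3_def by (subst chain2(3)) (simp add: algebra_simps)
qed

text \<open>The relations along the chain with its members as variables. The constants \<open>e2\<close>, \<open>s2\<close> and so on are
  terms in \<open>r, s, t\<close>, so an equation for \<open>r\<close> would otherwise rewrite inside them.\<close>
lemma chain:
  obtains e' e2' e3' s1' t1' s2' t2' s3' t3' where "e' = e"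
    "s1'\<^sup>2 = a*e'+1" "t1'\<^sup>2 = b*e'+1" "s2'\<^sup>2 = a*e2'+1" "t2'\<^sup>2 = b*e2'+1" "s3'\<^sup>2 = a*e3'+1" "t3'\<^sup>2 = b*e3'+1"
    "e2' * c = a\<^sup>2+b\<^sup>2+e'\<^sup>2-2*a*b-2*a*e'-2*b*e'-4" "e3' * e' = a\<^sup>2+b\<^sup>2+e2'\<^sup>2-2*a*b-2*a*e2'-2*b*e2'-4"
    "e2' = a+b+e3'+2*a*b*e3' + 2*r*s3'*t3'" "s2' = -(a*t3' + r*s3')" "t2' = -(b*s3' + r*t3')"
    "s = -(2*r*s1' + s2')" "t = -(2*r*t1' + t2')" "s1' = -(2*r*s2' + s3')" "t1' = -(2*r*t2' + t3')"
    "e' + e3' = 2*(a+b+e2'+2*a*b*e2')"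
    "s2' = a*t1' - r*s1'" "e2' = a+b+e'+2*a*b*e' - 2*r*s1'*t1'" "e' = a+b+e2'+2*a*b*e2' + 2*r*s2'*t2'" "s1' = -(a*t2' + r*s2')"
  by (rule that[OF refl chain1(1,2) chain2(1,2) chain3(1,2) chain2(6) chain3(6) chain3(3-5) chain_rec(1-5) s2_def e2_def chain2(3,4)])

text \<open>In \<open>ident_b_0\<close> the polynomials \<open>e\<close> and \<open>t\<close> must have the same degree. This fixes the degree of \<open>c\<close>, and
  going down the chain of extensions ends at \<open>e3 = 0\<close> or at a constant \<open>e3 = a\<close>. Going up again makes the
  identity a relation between \<open>a\<close>, \<open>b\<close> and a root of \<open>ab+1\<close>. In the first case the relation is impossible by
  \<open>dependence_const\<close> or \<open>quadratic_zero\<close>; in the second, \<open>M = 2k\<close> with \<open>k(k\<^sup>2+11) + 3 = 0\<close>.\<close>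
lemma no_orbit_b_0:
  assumes "w\<^sup>2 = c*d+1" "even M" "odd N" "w = orbit_z s c t r M" "w = orbit_z t c 1 1 N"
  shows False
proof -
  obtain e1 e2 e3 s1 t1 s2 t2 s3 t3 where E1: "e1 = e" and
    sq: "s1\<^sup>2 = a*e1+1" "t1\<^sup>2 = b*e1+1" "s2\<^sup>2 = a*e2+1" "t2\<^sup>2 = b*e2+1" "s3\<^sup>2 = a*e3+1" "t3\<^sup>2 = b*e3+1" and
    pr: "e2 * c = a\<^sup>2+b\<^sup>2+e1\<^sup>2-2*a*b-2*a*e1-2*b*e1-4" "e3 * e1 = a\<^sup>2+b\<^sup>2+e2\<^sup>2-2*a*b-2*a*e2-2*b*e2-4" and
    ch: "e2 = a+b+e3+2*a*b*e3 + 2*r*s3*t3" "s2 = -(a*t3 + r*s3)" "t2 = -(b*s3 + r*t3)" and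
    rec: "s = -(2*r*s1 + s2)" "t = -(2*r*t1 + t2)" "s1 = -(2*r*s2 + s3)" "t1 = -(2*r*t2 + t3)" and
    rec_e: "e1 + e3 = 2*(a+b+e2+2*a*b*e2)"
    by (rule chain) (rule that, assumption+)
  note deg_e1 = deg_e[folded E1]
  define m n :: "complex poly" where mn: "m = of_int M" "n = of_int N"
  have dmn: "degree m = 0" "degree n = 0" using mn by auto
  have n0: "n \<noteq> 0" using mn assms(3) by auto
  have id: "a*m\<^sup>2 + m*(a+b-e1) = b*(n\<^sup>2-1) + 2*n*t" using ident_b_0[OF assms(2-)] unfolding mn E1 .
  define R where "R = a*m\<^sup>2 + m*(a+b) - b*(n\<^sup>2-1)"
  have R: "m*e1 + 2*n*t = R" using id unfolding R_def by algebra
  have dR: "degree R \<le> degree b" unfolding R_def using deg dmn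
    by (intro degree_add_le degree_diff_le deg0_scale_le deg0_simps) auto
  have dnt: "degree (2*n*t) = degree t" using deg0_scale_eq[of "2*n" t] dmn n0 by (simp add: deg0_simps)
  have dme: "degree (m*e1) = degree t"
  proof (rule ccontr)
    assume "degree (m*e1) \<noteq> degree t"
    hence "degree R \<ge> degree t" using degree_sum_ne[of "m*e1" "2*n*t"] dnt R by simp
    thus False using dR deg_lt(4) by simp
  qed
  have m0: "m \<noteq> 0" using dme deg_lt(4) by auto
  have de: "degree e1 = degree t" using dme deg0_scale_eq[OF dmn(1) m0, of e1] by simp
  have dc: "degree c = 2*degree a + 3*degree b" "degree e1 = degree a + 2*degree b" using de deg_e1(1) root_degrees(3) by linarith+
  have "e2 = 0 \<or> degree e2 + degree c \<le> 2*degree e1"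
    by (rule disc_factor[OF pr(1) nz(3)]) (use deg dc in auto)
  hence de2: "degree e2 \<le> degree b" using dc by auto
  have "e3 = 0 \<or> degree e3 + degree e1 \<le> 2*degree b"
    by (rule disc_factor[OF pr(2) deg_e1(2)]) (use deg de2 in auto)
  hence de3: "e3 = 0 \<or> degree e3 = 0 \<and> degree a = 0" using dc by auto
  have "e3 = 0 \<or> e3 = a \<and> degree a = 0"
    using de3 const_partner_unique[of e3 a b t3 r] nz deg sq(6) rr by (auto simp: mult.commute)
  thus False
  proof
    assume e3: "e3 = 0"
    have st: "s3\<^sup>2 = 1" "t3\<^sup>2 = 1" using sq(5,6) unfolding e3 by simp_all
    \<comment> \<open>Now \<open>s3\<close> and \<open>t3\<close> are signs, and \<open>\<rho>\<close> is the root of \<open>ab+1\<close> for which \<open>e2 = a+b+2\<rho>\<close>.\<close>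
    define \<rho> where "\<rho> = r*s3*t3"
    have r: "r = \<rho>*s3*t3" unfolding \<rho>_def using st by algebra
    have rho: "\<rho>\<^sup>2 = a*b+1" unfolding \<rho>_def using st rr by algebra
    have drho: "2 * degree \<rho> = degree a + degree b" using deg_root[OF rho] nz deg by simp
    have E2: "e2 = a+b+2*\<rho>" using ch(1) by (simp add: e3 \<rho>_def)
    have T2: "t2 = -(s3*(b+\<rho>))" unfolding ch(3) r using st by algebra
    have T1: "t1 = t3*(2*\<rho>*(b+\<rho>) - 1)" unfolding rec(4) T2 r using st by algebra
    have T: "t = -s3*(4*\<rho>\<^sup>2*(b+\<rho>) - 3*\<rho> - b)" unfolding rec(2) T1 T2 r using st by algebra
    have "e1 = 2*(a+b+e2+2*a*b*e2)" using rec_e e3 by simp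
    hence E: "e1 = 4*\<rho>\<^sup>2*(a+b+2*\<rho>) - 4*\<rho>" unfolding E2 using rho by algebra
    obtain N' :: int where N': "odd N'" "of_int N' = -s3*n" "(of_int N')\<^sup>2 = n\<^sup>2"
    proof -
      from square_eq_cases[of s3 1] st have "s3 = 1 \<or> s3 = -1" by simp
      thus thesis using that[of N] that[of "-N"] assms(3) mn by auto
    qed
    define n' :: "complex poly" where n': "n' = of_int N'"
    have nn: "n' = -s3*n" using N' n' by simp
    have dn': "degree n' = 0" using n' by simp
    \<comment> \<open>\<open>4 \<rho>\<^sup>2 G\<close> collects the terms of \<open>m e + 2 n t\<close> of large degree; what remains has at most the
      degree of \<open>b\<close>.\<close>
    define G where "G = (m+2*n')*b + m*a + 2*(m+n')*\<rho>"
    have G: "4*\<rho>\<^sup>2*G = R + (4*m+6*n')*\<rho> + 2*n'*b"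
      unfolding R[symmetric] T E G_def nn by algebra
    have "degree (R + (4*m+6*n')*\<rho> + 2*n'*b) \<le> degree b"
      using dR dmn dn' drho deg by (intro degree_add_le deg0_scale_le deg0_simps) auto
    hence dG: "G = 0 \<or> degree a + degree b + degree G \<le> degree b"
      unfolding G[symmetric] using drho deg by (cases "G = 0"; cases "\<rho> = 0") (auto simp: degree_mult_eq degree_square_complex)
    have "m + n' = of_int (M + N')" using mn n' by simp
    hence mn0: "m + n' \<noteq> 0" using assms(2) N'(1) by (simp only: of_int_eq_0_iff) presburger
    show False
    proof (cases "degree a = 0")
      case False
      hence "G = 0" using dG by auto
      hence "4*(m+n')\<^sup>2*(a*b+1) = ((m+2*n')*b+m*a)\<^sup>2" unfolding rho[symmetric] G_def by algebra
      moreover have "(m+n')\<^sup>2 - (m+2*n')*m = n\<^sup>2" using N'(3) unfolding n'[symmetric] by algebra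
      hence "(m+n')\<^sup>2 \<noteq> (m+2*n')*m" using n0 by auto
      ultimately have "degree a = 0" using dmn dn' mn0
        by (intro dependence_const[of "m+n'" a b "m+2*n'" m]) (auto intro!: deg0_simps)
      thus False using False by simp
    next
      case True
      hence "degree G = 0" using dG by auto
      moreover have Z: "(m+2*n')*\<rho>\<^sup>2 + (2*a*(m+n'))*\<rho> + (m*a\<^sup>2 - (m+2*n') - a*G) = 0"
        unfolding G_def rho by algebra
      have "degree \<rho> > 0" using drho deg by simp
      ultimately have "2*a*(m+n') = 0" using True dmn dn'
        by (intro quadratic_zero(2)[OF _ _ _ _ Z] deg0_simps) simp_all
      thus False using mn0 nz by simp
    qed
  next
    assume e3: "e3 = a \<and> degree a = 0"
    hence e3a: "e3 = a" ..
    have st: "s3\<^sup>2 = a*a+1" "t3\<^sup>2 = r\<^sup>2"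
      using sq(5,6) unfolding e3a rr by (simp_all add: mult.commute)
    have "t3 = 1*r \<or> t3 = (-1)*r" using square_eq_cases[OF st(2)] by simp
    then obtain \<tau> where \<tau>: "\<tau> = 1 \<or> \<tau> = -1" "t3 = \<tau>*r" by blast
    define \<theta> where "\<theta> = a + \<tau>*s3"
    have "degree (s3\<^sup>2) = 0" unfolding st using e3 by (auto intro!: deg0_simps)
    hence "degree s3 = 0" by (simp add: degree_square_complex)
    hence dth: "degree \<theta> = 0" unfolding \<theta>_def using e3 \<tau> by (intro deg0_simps) auto
    have E2': "e2 = a+b+a+2*a*b*a + 2*r*s3*t3" using ch(1) e3 by simp
    note F = root_with_const_ext[OF rr st(1) \<tau> \<theta>_def E2']
    have th0: "\<theta> \<noteq> 0" using F(1) by auto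
    have T2: "t2 = -\<tau>*(\<theta>*b+1)" unfolding ch(3) F(3) ..
    have tau: "\<tau>\<^sup>2 = 1" using \<tau> by auto
    have T1: "t1 = \<tau>*r*(2*\<theta>*b+1)" unfolding rec(4) T2 \<tau>(2) by algebra
    have T: "t = -\<tau>*(4*a*\<theta>*b\<^sup>2 + (2*a+3*\<theta>)*b + 1)" unfolding rec(2) T1 T2 using rr tau by algebra
    have "e1 + a = 2*(a+b+(\<theta>\<^sup>2*b+2*\<theta>)+2*a*b*(\<theta>\<^sup>2*b+2*\<theta>))" using rec_e e3 F(2) by simp
    hence "e1 = 2*(a+b+(\<theta>\<^sup>2*b+2*\<theta>)+2*a*b*(\<theta>\<^sup>2*b+2*\<theta>)) - a" by (simp add: eq_diff_eq)
    hence E: "e1 = 4*a*\<theta>\<^sup>2*b\<^sup>2 + (2+2*\<theta>\<^sup>2+8*a*\<theta>)*b + a + 4*\<theta>" by (simp add: algebra_simps power2_eq_square)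
    define n' :: "complex poly" where n': "n' = -\<tau>*n"
    have dn': "degree n' = 0" unfolding n' using \<tau> dmn by auto
    have nn: "n'\<^sup>2 = n\<^sup>2" unfolding n' using tau by algebra
    \<comment> \<open>Everything has become a quadratic in \<open>b\<close> with constant coefficients.\<close>
    have quad: "(4*a*\<theta>\<^sup>2*m + 8*n'*a*\<theta>)*b\<^sup>2 + (m*(2+2*\<theta>\<^sup>2+8*a*\<theta>) + 2*n'*(2*a+3*\<theta>) - m + (n\<^sup>2-1))*b
       + (m*(a+4*\<theta>) + 2*n' - a*m\<^sup>2 - m*a) = 0"
      using R[unfolded T E R_def] unfolding n' by algebra
    have q0: "4*a*\<theta>\<^sup>2*m + 8*n'*a*\<theta> = 0" "m*(2+2*\<theta>\<^sup>2+8*a*\<theta>) + 2*n'*(2*a+3*\<theta>) - m + (n\<^sup>2-1) = 0"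
        "m*(a+4*\<theta>) + 2*n' - a*m\<^sup>2 - m*a = 0"
      using quadratic_zero[OF _ _ _ deg(3) quad] dmn dn' dth e3 by (auto simp: deg0_simps)
    have "(4*a*\<theta>)*(\<theta>*m+2*n') = 0" using q0(1) by algebra
    hence tm: "\<theta>*m = -(2*n')" using nz th0 by (simp add: eq_neg_iff_add_eq_0)
    have am: "a*m\<^sup>2 = -(6*n')" using q0(3) tm by algebra
    have "4*n\<^sup>2*m = m^3 + 24*n\<^sup>2" using F(1) tm am unfolding nn[symmetric] by algebra
    hence "(of_int (4*N\<^sup>2*M) :: complex poly) = of_int (M^3 + 24*N\<^sup>2)" unfolding mn by simp
    hence z1: "4*N\<^sup>2*M = M^3 + 24*N\<^sup>2" unfolding of_int_eq_iff .
    have "12*m*n\<^sup>2 - 24*n\<^sup>2 - 3*m^3 + m\<^sup>2*n\<^sup>2 - m\<^sup>2 = 0"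
    proof -
      have "6*m*\<theta>\<^sup>2 - 3*m + 4*a*n' + 6*n'*\<theta> + n\<^sup>2 - 1 = 0" using q0(2) F(1) by algebra
      hence "6*m*(\<theta>*m)\<^sup>2 - 3*m^3 + 4*(a*m\<^sup>2)*n' + 6*n'*m*(\<theta>*m) + m\<^sup>2*n\<^sup>2 - m\<^sup>2 = 0" by algebra
      thus ?thesis unfolding tm am using nn by algebra
    qed
    hence "(of_int (12*M*N\<^sup>2 - 24*N\<^sup>2 - 3*M^3 + M\<^sup>2*N\<^sup>2 - M\<^sup>2) :: complex poly) = 0" unfolding mn by simp
    hence z2: "12*M*N\<^sup>2 - 24*N\<^sup>2 - 3*M^3 + M\<^sup>2*N\<^sup>2 - M\<^sup>2 = 0" unfolding of_int_eq_0_iff .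
    obtain k where k: "M = 2*k" using assms(2) by (auto elim!: evenE)
    have "k \<noteq> 0" using m0 mn k by auto
    have y1: "N\<^sup>2*(k-3) = k^3" using z1 unfolding k by (simp add: power_mult_distrib algebra_simps)
    have y2: "N\<^sup>2*(k\<^sup>2+6*k-6) = 6*k^3+k\<^sup>2" using z2 unfolding k by (simp add: power_mult_distrib algebra_simps)
    have "k\<^sup>2*(k*(k\<^sup>2+11)+3) = 0" using y1 y2 by algebra
    thus False using \<open>k \<noteq> 0\<close> int_no_root_cubic by simp
  qed
qed

end

text \<open>The part of \<open>no_orbit_0_a\<close> in which \<open>s\<close> has the degree of \<open>b\<close> and \<open>a\<close> is not constant; the premise \<open>R\<close> is the identity
  \<open>ident_0_a\<close>. Here \<open>b\<close> is the large extension of \<open>{a, e, e2}\<close>, and with the other extension \<open>b'\<close> everything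
  can be expressed by polynomials of smaller degree. Comparing degrees shows that \<open>e\<close> is constant and
  \<open>e2 = H\<^sup>2 a + 2H\<close> for a constant \<open>H\<close>. Then \<open>b\<close> and \<open>s\<close> are quadratic in \<open>a\<close>, and comparing
  coefficients gives two equations for \<open>M\<close> and \<open>N\<close> without a common solution.\<close>
lemma no_orbit_0_a_intermediate:
  fixes a b e e2 r s s1 t1 s2 m n :: "complex poly"
  assumes rr: "r\<^sup>2 = a*b+1" and sq: "s1\<^sup>2 = a*e+1" "t1\<^sup>2 = b*e+1" "s2\<^sup>2 = a*e2+1"
    and s2: "s2 = a*t1 - r*s1" and e2: "e2 = a+b+e+2*a*b*e - 2*r*s1*t1" and s: "s = s2 - 2*a*t1"
    and R: "n*e + 2*m*s = (n\<^sup>2+n)*b + (n-m\<^sup>2+1)*a"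
    and mn: "m = of_int M" "n = of_int N" and N: "even N" and m0: "m \<noteq> 0" and n0: "n \<noteq> 0" "n\<^sup>2+n \<noteq> 0"
    and nz: "a \<noteq> 0" "b \<noteq> 0" "e \<noteq> 0" "e2 \<noteq> 0" and de2: "degree e2 \<le> degree a"
    and a0: "degree a > 0" and de: "degree e + 2*degree a = degree b"
  shows False
proof -
  have dmn: "degree m = 0" "degree n = 0" using mn by auto
  define q where "q = n\<^sup>2+n"
  have q: "degree q = 0" "q \<noteq> 0" using n0 dmn unfolding q_def by (auto simp: deg0_simps)
  define u where "u = e*r - s1*t1"
  have e2': "e2 = a+e+b+2*a*e*b - 2*s1*r*t1" unfolding e2 by algebra
  have be: "t1\<^sup>2 = e*b+1" using sq(2) by (simp add: mult.commute)
  have s2': "s2 = a*t1 - s1*r" unfolding s2 by algebra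
  have uu: "u\<^sup>2 = e*e2+1" unfolding u_def using extension_roots(2)[OF sq(1) rr be e2'] .
  note inv = extension_inverse[OF sq(1) rr be e2' s2' u_def]
  define b' where "b' = a+e+e2+2*a*e*e2 - 2*s1*s2*u"
  define v where "v = e*s2 - s1*u"
  have vv: "v\<^sup>2 = e*b'+1" unfolding v_def using extension_roots(2)[OF sq(1,3) uu b'_def] .
  have "b' * (a+e+e2+2*a*e*e2 + 2*s1*s2*u) = a\<^sup>2+e\<^sup>2+e2\<^sup>2-2*a*e-2*a*e2-2*e*e2-4"
    using extension_roots(4)[OF sq(1,3) uu b'_def] .
  hence pr: "b' * b = a\<^sup>2+e\<^sup>2+e2\<^sup>2-2*a*e-2*a*e2-2*e*e2-4" unfolding inv(1)[symmetric] .
  have t1: "t1 = v - 2*e*s2" unfolding v_def by (subst inv(3)) (simp add: algebra_simps)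
  have bb: "b = 2*(a+e+e2)+4*a*e*e2 - b'" unfolding b'_def by (subst inv(1)) (simp add: algebra_simps)
  define \<mu> where "\<mu> = max (degree a) (degree e)"
  have mu: "degree a \<le> \<mu>" "degree e \<le> \<mu>" "degree e2 \<le> \<mu>" "\<mu> \<le> degree b" using de2 de a0 unfolding \<mu>_def by auto
  have b'0: "b' = 0 \<or> degree b' + degree b \<le> 2*\<mu>" by (rule disc_factor[OF pr nz(2) mu(1-3)])
  hence db': "degree b' \<le> \<mu>" using mu by auto
  have dv: "degree a + degree v \<le> \<mu>"
  proof (cases "b' = 0")
    case True
    hence "degree (v\<^sup>2) = 0" unfolding vv by simp
    thus ?thesis using mu by (simp add: degree_square_complex)
  next
    case False
    thus ?thesis using b'0 deg_root_le[OF vv] de by linarith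
  qed
  have ds2: "degree s2 \<le> degree a" using deg_root_le[OF sq(3)] de2 by simp
  \<comment> \<open>\<open>4aeX\<close> collects the terms of \<open>n e + 2 m s - q b\<close> of large degree.\<close>
  define X where "X = 2*m*s2 - q*e2"
  have "n*e + 2*m*(s2 - 2*a*(v - 2*e*s2)) = q*(2*(a+e+e2)+4*a*e*e2 - b') + (n-m\<^sup>2+1)*a"
    unfolding bb[symmetric] t1[symmetric] s[symmetric] q_def using R .
  hence X: "4*(a*e*X) = 4*(m*(a*v)) - n*e - 2*m*s2 + q*(2*(a+e+e2)-b') + (n-m\<^sup>2+1)*a"
    unfolding X_def by algebra
  have "degree (4*(m*(a*v)) - n*e - 2*m*s2 + q*(2*(a+e+e2)-b') + (n-m\<^sup>2+1)*a) \<le> \<mu>"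
  proof -
    define p where "p = a*v"
    have "degree p \<le> \<mu>" using degree_mult_le[of a v] dv unfolding p_def by simp
    moreover have "degree s2 \<le> \<mu>" using ds2 mu by simp
    ultimately show ?thesis unfolding p_def[symmetric] using mu db' dmn q
      by (intro degree_add_le degree_diff_le deg0_scale_le deg0_simps) auto
  qed
  hence "degree (a*e*X) \<le> \<mu>" unfolding X[symmetric] by simp
  hence dX: "X = 0 \<or> degree a + degree e + degree X \<le> \<mu>" using nz by (cases "X = 0") (auto simp: degree_mult_eq)
  have X2: "e2 * (4*m\<^sup>2*a - q\<^sup>2*e2 - 2*q*X) = X\<^sup>2 - 4*m\<^sup>2"
  proof -
    have "(2*m*s2)\<^sup>2 = 4*m\<^sup>2*(a*e2+1)" unfolding power_mult_distrib sq(3) by simp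
    moreover have "2*m*s2 = q*e2 + X" unfolding X_def by simp
    ultimately have "(q*e2+X)\<^sup>2 = 4*m\<^sup>2*(a*e2+1)" by simp
    thus ?thesis by algebra
  qed
  have dX0: "degree X = 0"
    using dX unfolding \<mu>_def by (cases "X = 0") auto
  have X4: "X\<^sup>2 = 4*m\<^sup>2"
  proof (rule ccontr)
    assume "X\<^sup>2 \<noteq> 4*m\<^sup>2"
    hence c: "X\<^sup>2 - 4*m\<^sup>2 \<noteq> 0" "degree (X\<^sup>2 - 4*m\<^sup>2) = 0" using dX0 dmn by (auto simp: deg0_simps)
    define p where "p = 4*m\<^sup>2*a - q\<^sup>2*e2 - 2*q*X"
    from unit_factors_deg0[OF X2 c(2,1)]
    have "degree (p + q\<^sup>2*e2 + 2*q*X) = 0" unfolding p_def[symmetric] using q dX0 by (intro deg0_simps) auto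
    moreover have "p + q\<^sup>2*e2 + 2*q*X = (4*m\<^sup>2)*a" unfolding p_def by simp
    moreover have "degree ((4*m\<^sup>2)*a) = degree a" using dmn m0 by (intro deg0_scale_eq deg0_simps) auto
    ultimately show False using a0 by simp
  qed
  have X0: "X \<noteq> 0" using X4 m0 by auto
  have e0: "degree e = 0" using dX X0 a0 unfolding \<mu>_def by auto
  have ba: "degree b = 2*degree a" using de e0 by simp
  have "X = 1*(2*m) \<or> X = (-1)*(2*m)" using square_eq_cases[of X "2*m"] X4 by (simp add: power_mult_distrib)
  then obtain \<eta> where \<eta>: "\<eta> = 1 \<or> \<eta> = -1" "X = \<eta>*(2*m)" by blast
  have eta: "\<eta>\<^sup>2 = 1" "degree \<eta> = 0" using \<eta>(1) by auto
  obtain q' where q': "degree q' = 0" "q*q' = 1" using deg0_inverse[OF q] .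
  \<comment> \<open>In terms of this constant \<open>e2\<close> and \<open>s2\<close> become polynomials in \<open>a\<close>.\<close>
  define H where "H = -(2*m*\<eta>*q')"
  have dH: "degree H = 0" unfolding H_def using dmn eta q' by (auto simp: deg0_simps)
  have qH: "q*H = -(2*m*\<eta>)" unfolding H_def using q'(2) by algebra
  have H0: "H \<noteq> 0" using qH m0 \<eta>(1) by auto
  have "e2 * (4*m\<^sup>2*a - q\<^sup>2*e2 - 2*q*X) = 0" using X2 X4 by simp
  hence "4*m\<^sup>2*a - q\<^sup>2*e2 - 2*q*X = 0" using nz by simp
  hence "q\<^sup>2*e2 = q\<^sup>2*(H\<^sup>2*a + 2*H)" unfolding \<eta>(2) using qH eta(1) by algebra
  hence E2: "e2 = H\<^sup>2*a + 2*H" using q by simp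
  have "2*m*s2 = q*e2 + X" unfolding X_def by simp
  hence "2*m*s2 = 2*m*(-\<eta>*(H*a+1))" unfolding E2 \<eta>(2) using qH by algebra
  moreover have "2*m \<noteq> 0" using m0 by simp
  ultimately have S2: "s2 = -\<eta>*(H*a+1)" using mult_left_cancel by blast
  have ds1: "degree s1 > 0"
  proof -
    have "2 * degree s1 = degree a + degree e" using a0 nz by (intro deg_root sq) auto
    thus ?thesis using a0 by simp
  qed
  have U: "H\<^sup>2 * s1\<^sup>2 + (2*H*e + 1 - H\<^sup>2) = u\<^sup>2" unfolding uu E2 sq(1) by algebra
  have "2*H*e + 1 - H\<^sup>2 = 0"
    using no_square_shift[OF _ _ _ ds1 U] dH H0 e0 by (auto simp: deg0_simps)
  hence He: "H\<^sup>2 = 1 + 2*H*e" by algebra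
  have "u\<^sup>2 = (H*s1)\<^sup>2" using U He by algebra
  from square_eq_cases[OF this] have "u = 1*(H*s1) \<or> u = (-1)*(H*s1)" by simp
  then obtain \<zeta> where \<zeta>: "\<zeta> = 1 \<or> \<zeta> = -1" "u = \<zeta>*(H*s1)" by blast
  have B: "b = a+e+H\<^sup>2*a+2*H+2*a*e*(H\<^sup>2*a+2*H) - 2*(\<zeta>*\<eta>)*H*(H*a+1)*(a*e+1)"
  proof -
    have "b = a+e+e2+2*a*e*e2 + 2*s1*s2*u" by (rule inv(1))
    also have "\<dots> = a+e+(H\<^sup>2*a+2*H)+2*a*e*(H\<^sup>2*a+2*H) + 2*(-\<eta>*(H*a+1))*\<zeta>*H*(s1\<^sup>2)"
      unfolding S2 E2 \<zeta>(2) by (simp add: algebra_simps power2_eq_square)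
    also have "\<dots> = a+e+H\<^sup>2*a+2*H+2*a*e*(H\<^sup>2*a+2*H) - 2*(\<zeta>*\<eta>)*H*(H*a+1)*(a*e+1)"
      unfolding sq(1) by (simp add: algebra_simps)
    finally show ?thesis .
  qed
  \<comment> \<open>With the other sign the leading terms of \<open>b\<close> cancel, and \<open>b\<close> is too small.\<close>
  have \<zeta>': "\<zeta> = -\<eta>"
  proof (rule ccontr)
    assume "\<zeta> \<noteq> -\<eta>"
    hence ze: "\<zeta>*\<eta> = 1" using \<zeta>(1) \<eta>(1) by auto
    have "b = (1 + H\<^sup>2 + 2*H*e - 2*H\<^sup>2)*a + e" unfolding B ze by algebra
    also have "degree \<dots> \<le> degree a" using dH e0 by (intro degree_add_le deg0_scale_le deg0_simps) auto
    finally show False using ba a0 by simp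
  qed
  have ze: "\<zeta>*\<eta> = -1" unfolding \<zeta>' using eta(1) by algebra
  have B: "b = 4*e*H\<^sup>2*a\<^sup>2 + (6*H\<^sup>2 - 2)*a + e + 4*H"
    unfolding B ze using He by algebra
  have T1: "t1 = \<eta>*(2*e*H*a + e + H)"
  proof -
    have "t1 = -(e*s2 + s1*u)" by (rule inv(3))
    also have "\<dots> = \<eta>*e*(H*a+1) - \<zeta>*H*s1\<^sup>2" unfolding S2 \<zeta>(2) by algebra
    also have "\<dots> = \<eta>*(2*e*H*a + e + H)" unfolding sq(1) \<zeta>' by algebra
    finally show ?thesis .
  qed
  have S: "s = -\<eta>*(4*e*H*a\<^sup>2 + (2*e+3*H)*a + 1)" unfolding s S2 T1 by algebra
  obtain M' :: int where M': "of_int M' = -\<eta>*m" using \<eta>(1) mn by (auto intro: that[of "-M"] that[of M])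
  define m' :: "complex poly" where m': "m' = of_int M'"
  have m'm: "m' = -\<eta>*m" using M' m' by simp
  have mm: "m'\<^sup>2 = m\<^sup>2" unfolding m'm using eta(1) by algebra
  have qH': "q*H = 2*m'" unfolding qH m'm by simp
  have dm': "degree m' = 0" unfolding m' by simp
  have Z: "(8*m'*e*H - 4*q*e*H\<^sup>2)*a\<^sup>2 + (2*m'*(2*e+3*H) - q*(6*H\<^sup>2-2) - (n-m\<^sup>2+1))*a + (n*e + 2*m' - q*e - 4*q*H) = 0"
    using R[folded q_def, unfolded S B] unfolding m'm by algebra
  have z: "2*m'*(2*e+3*H) - q*(6*H\<^sup>2-2) - (n-m\<^sup>2+1) = 0" "n*e + 2*m' - q*e - 4*q*H = 0"
    using quadratic_zero(2,3)[OF _ _ _ a0 Z] dm' dmn dH e0 q by (auto simp: deg0_simps)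
  have ne: "n\<^sup>2*e = -(6*m')" using z(2) qH' unfolding q_def by algebra
  have nH: "n*(n+1)*H = 2*m'" using qH' unfolding q_def by algebra
  have "n*(m\<^sup>2*(28*n+24)) = n*(n^3*(n+1)\<^sup>2)" using He ne nH unfolding mm[symmetric] by algebra
  hence F1: "m\<^sup>2*(28*n+24) = n^3*(n+1)\<^sup>2" using n0 by simp
  have F2: "m\<^sup>2*(n\<^sup>2*(n+1) - 36*n - 24) = n\<^sup>2*(n+1)\<^sup>2*(1-2*n)"
    using z(1) ne nH mm unfolding q_def by algebra
  obtain l where l: "N = 2*l" using N by (auto elim!: evenE)
  have l0: "l \<noteq> 0" using n0 mn l by auto
  have "(of_int (M\<^sup>2*(28*N+24)) :: complex poly) = of_int (N^3*(N+1)\<^sup>2)"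
    "(of_int (M\<^sup>2*(N\<^sup>2*(N+1) - 36*N - 24)) :: complex poly) = of_int (N\<^sup>2*(N+1)\<^sup>2*(1-2*N))"
    using F1 F2 unfolding mn by simp_all
  hence G: "M\<^sup>2*(28*N+24) = N^3*(N+1)\<^sup>2" "M\<^sup>2*(N\<^sup>2*(N+1) - 36*N - 24) = N\<^sup>2*(N+1)\<^sup>2*(1-2*N)"
    unfolding of_int_eq_iff by simp_all
  have "N\<^sup>2*(N+1)\<^sup>2 * (N*(N\<^sup>2*(N+1) - 36*N - 24)) = N\<^sup>2*(N+1)\<^sup>2 * ((28*N+24)*(1-2*N))"
    using G by algebra
  moreover have "N + 1 \<noteq> 0" using N by presburger
  hence "N\<^sup>2*(N+1)\<^sup>2 \<noteq> 0" using l0 l by simp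
  ultimately have "N*(N\<^sup>2*(N+1) - 36*N - 24) = (28*N+24)*(1-2*N)" using mult_left_cancel by blast
  hence "8*(2*l^4 + l^3 + 10*l\<^sup>2 - l - 3) = 0" unfolding l by algebra
  thus False using int_no_root_quartic[of l] by simp
qed

context quad_lt begin

text \<open>Again the degree of \<open>w\<close> along either orbit, in units of half the degree of \<open>b\<close>.\<close>
lemma degrees_0_a:
  assumes "degree a = 0" "degree c = 2*degree b" "w = orbit_z s c 1 1 M" "w = orbit_z t c s r N" "odd M" "even N" "N \<noteq> 0"
  shows "2*\<bar>M\<bar> + 2 = (if N > 0 then 3*N+2 else -3*N)"
proof -
  define \<beta> where "\<beta> = degree b"
  have D: "degree c = 2*\<beta>" "degree s = \<beta>" "2*degree t = 3*\<beta>" "2*degree w0 = 3*\<beta>" "2*degree r = \<beta>" "\<beta> > 0"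
    unfolding \<beta>_def using deg_e(1) assms(1,2) root_degrees deg_w0(1) deg(3) by linarith+
  have M0: "M \<noteq> 0" using assms(5) by auto
  have A: "2 * int (degree w) = \<beta> * (2*\<bar>M\<bar> + 2)"
  proof -
    have sc: "degree (s*1 + c*1) = 2*\<beta>" "degree (s*1 - c*1) = 2*\<beta>"
      using D degree_add_eq_right[of s c] degree_add_eq_right[of s "-c"] by auto
    have nz': "s*1 + c*1 \<noteq> 0" "s*1 - c*1 \<noteq> 0" using sc D by (metis degree_0 mult_is_0 neq0_conv zero_neq_numeral)+
    from M0 have "M \<ge> 1 \<or> M \<le> -1" by linarith
    thus ?thesis
    proof
      assume M: "M \<ge> 1"
      have "degree w = 2*\<beta> + nat (M-1) * degree s"
        using orbit_z_degree_pos[OF ss _ _ _ M, of 1 1] D nz' assms(3) sc by simp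
      hence "2 * int (degree w) = 2 * int (2*\<beta>) + 2*(M-1) * \<beta>" using D M by simp
      thus ?thesis using M by (simp add: algebra_simps)
    next
      assume M: "M \<le> -1"
      have "degree w = 2*\<beta> + nat (-M-1) * degree s"
        using orbit_z_degree_neg[OF ss _ _ _ M, of 1 1] D nz' assms(3) sc by simp
      hence "2 * int (degree w) = 2 * int (2*\<beta>) + 2*(-M-1) * \<beta>" using D M by simp
      thus ?thesis using M by (simp add: algebra_simps)
    qed
  qed
  have B: "2 * int (degree w) = \<beta> * (if N > 0 then 3*N+2 else -3*N)"
  proof -
    have "r \<noteq> 0" using D by auto
    hence cr: "2*degree (c*r) = 5*\<beta>" "c*r \<noteq> 0" using D nz(3) by (auto simp: degree_mult_eq)
    from assms(7) have "N \<ge> 1 \<or> N \<le> -1" by linarith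
    thus ?thesis
    proof
      assume N: "N \<ge> 1"
      have e: "t*s + c*r = 2*(c*r) - w0" unfolding w0_def by algebra
      have de: "degree (t*s + c*r) = degree (c*r)" unfolding e using cr D degree_add_eq_left[of "-w0" "2*(c*r)"] by simp
      hence "t*s + c*r \<noteq> 0" using cr D by auto
      hence "degree w = degree (c*r) + nat (N-1) * degree t"
        using orbit_z_degree_pos[OF tt _ _ _ N, of s r] D assms(4) cr de by simp
      hence "2 * int (degree w) = int (2 * degree (c*r)) + (N-1) * int (2 * degree t)" using N by (simp add: algebra_simps)
      thus ?thesis using N unfolding cr D by (simp add: algebra_simps)
    next
      assume N: "N \<le> -1"
      have e: "t*s - c*r = -w0" unfolding w0_def by algebra
      hence "degree w = degree w0 + nat (-N-1) * degree t"
        using orbit_z_degree_neg[OF tt _ _ _ N, of s r] D assms(4) deg_w0(3) by simp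
      hence "2 * int (degree w) = int (2 * degree w0) + (-N-1) * int (2 * degree t)" using N by (simp add: algebra_simps)
      thus ?thesis using N unfolding D by (simp add: algebra_simps)
    qed
  qed
  show ?thesis using A B D by simp
qed

text \<open>If \<open>s\<close> has larger degree than \<open>b\<close>, it must be cancelled by \<open>e\<close> in \<open>ident_0_a\<close>; the degrees are then
  fixed and the chain of extensions leads to a contradiction between the leading terms. Otherwise the
  coefficient of \<open>b\<close> does not vanish, so \<open>s\<close> has the degree of \<open>b\<close>. For nonconstant \<open>a\<close> this is the
  preceding lemma. For constant \<open>a\<close> the chain already ends at \<open>e2 = 0\<close> or \<open>e2 = a\<close>, and comparing
  coefficients gives integer equations.\<close>
lemma no_orbit_0_a:
  assumes "w\<^sup>2 = c*d+1" "odd M" "even N" "w = orbit_z s c 1 1 M" "w = orbit_z t c s r N"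
  shows False
proof -
  obtain e1 e2 e3 s1 t1 s2 t2 s3 t3 where E1: "e1 = e" and
    sq: "s1\<^sup>2 = a*e1+1" "t1\<^sup>2 = b*e1+1" "s2\<^sup>2 = a*e2+1" "t2\<^sup>2 = b*e2+1" "s3\<^sup>2 = a*e3+1" "t3\<^sup>2 = b*e3+1" and
    pr: "e2 * c = a\<^sup>2+b\<^sup>2+e1\<^sup>2-2*a*b-2*a*e1-2*b*e1-4" "e3 * e1 = a\<^sup>2+b\<^sup>2+e2\<^sup>2-2*a*b-2*a*e2-2*b*e2-4" and
    ch: "e2 = a+b+e3+2*a*b*e3 + 2*r*s3*t3" "s2 = -(a*t3 + r*s3)" "t2 = -(b*s3 + r*t3)" and
    rec: "s = -(2*r*s1 + s2)" "t = -(2*r*t1 + t2)" "s1 = -(2*r*s2 + s3)" "t1 = -(2*r*t2 + t3)" and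
    rec_e: "e1 + e3 = 2*(a+b+e2+2*a*b*e2)" and
    ch2: "s2 = a*t1 - r*s1" "e2 = a+b+e1+2*a*b*e1 - 2*r*s1*t1" "e1 = a+b+e2+2*a*b*e2 + 2*r*s2*t2" "s1 = -(a*t2 + r*s2)"
    by (rule chain) (rule that, assumption+)
  note deg_e1 = deg_e[folded E1]
  define m n :: "complex poly" where mn: "m = of_int M" "n = of_int N"
  have dmn: "degree m = 0" "degree n = 0" using mn by auto
  have m0: "m \<noteq> 0" using mn assms(2) by auto
  have id: "a*(m\<^sup>2-1) + 2*m*s = b*n\<^sup>2 + n*(a+b-e1)" using ident_0_a[OF assms(2-)] unfolding mn E1 .
  have d2m: "degree (2*m) = 0" "2*m \<noteq> 0" using dmn m0 by (auto simp: deg0_simps)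
  have n0: "n \<noteq> 0"
  proof
    assume "n = 0"
    hence "2*m*s = a*(1-m\<^sup>2)" using id by algebra
    moreover have "degree (a*(1-m\<^sup>2)) \<le> degree a" using dmn by (intro deg0_scale) (auto intro!: deg0_simps)
    ultimately show False using deg0_scale_eq[OF d2m, of s] deg_lt(3) by simp
  qed
  have n10: "n + 1 \<noteq> 0"
  proof
    assume "n + 1 = 0"
    hence "(of_int (N+1) :: complex poly) = 0" using mn by simp
    thus False using assms(3) by (simp only: of_int_eq_0_iff) presburger
  qed
  define q where "q = n\<^sup>2 + n"
  have q: "degree q = 0" "q \<noteq> 0"
  proof -
    show "degree q = 0" unfolding q_def using dmn by (intro deg0_simps) auto
    have "q = n*(n+1)" unfolding q_def by algebra
    thus "q \<noteq> 0" using n0 n10 by simp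
  qed
  define R where "R = q*b + (n-m\<^sup>2+1)*a"
  have R: "n*e1 + 2*m*s = R" using id unfolding R_def q_def by algebra
  have dR: "degree R \<le> degree b" unfolding R_def using deg dmn q
    by (intro degree_add_le deg0_scale_le deg0_simps) auto
  have dms: "degree (2*m*s) = degree s" by (rule deg0_scale_eq(1)[OF d2m])
  have dne: "degree (n*e1) = degree e1" by (rule deg0_scale_eq(1)[OF dmn(2) n0])
  show False
  proof (cases "degree s > degree b")
    case True
    have "degree (n*e1) = degree s"
    proof (rule ccontr)
      assume "degree (n*e1) \<noteq> degree s"
      hence "degree R \<ge> degree s" using degree_sum_ne[of "n*e1" "2*m*s"] dms R by simp
      thus False using dR True by simp
    qed
    hence dc: "degree c = 3*degree a + 2*degree b" "degree e1 = 2*degree a + degree b"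
      using dne deg_e1(1) root_degrees(2) by linarith+
    have a0: "degree a > 0" using True dc(1) root_degrees(2) by simp
    have "e2 = 0 \<or> degree e2 + degree c \<le> 2*degree e1"
      by (rule disc_factor[OF pr(1) nz(3)]) (use deg dc in auto)
    hence de2: "degree e2 \<le> degree a" using dc by auto
    have "e3 = 0 \<or> degree e3 + degree e1 \<le> 2*degree b"
      by (rule disc_factor[OF pr(2) deg_e1(2)]) (use deg de2 in auto)
    hence ds3: "2*degree s3 + degree a \<le> degree b"
    proof
      assume "e3 = 0"
      hence "degree (s3\<^sup>2) = 0" using sq(5) by simp
      hence "degree s3 = 0" by (simp add: degree_square_complex)
      thus ?thesis using deg by simp
    next
      assume "degree e3 + degree e1 \<le> 2*degree b"
      thus ?thesis using deg_root_le[OF sq(5)] dc by simp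
    qed
    have ds2: "degree s2 \<le> degree a" using deg_root_le[OF sq(3)] de2 by simp
    \<comment> \<open>\<open>4r\<^sup>2 s2 H\<close> collects the terms of \<open>n s1\<^sup>2 + 2mas\<close> of large degree.\<close>
    define H where "H = n*s2 + 2*m*a"
    have H: "4*r\<^sup>2*(s2*H) = a*R + n - n*(4*(r*s2*s3) + s3\<^sup>2) - 2*m*(2*(a*r*s3) - a*s2)"
    proof -
      have "n*s1\<^sup>2 + 2*m*a*s = a*R + n" unfolding R[symmetric] sq(1) by algebra
      moreover have S: "s = 4*r\<^sup>2*s2 + 2*r*s3 - s2" unfolding rec(1,3) by algebra
      have "n*s1\<^sup>2 + 2*m*a*s = n*(4*r\<^sup>2*s2\<^sup>2 + 4*r*s2*s3 + s3\<^sup>2) + 2*m*a*(4*r\<^sup>2*s2 + 2*r*s3 - s2)"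
        unfolding S unfolding rec(3) by algebra
      ultimately show ?thesis unfolding H_def by algebra
    qed
    have "degree (a*R + n - n*(4*(r*s2*s3) + s3\<^sup>2) - 2*m*(2*(a*r*s3) - a*s2)) \<le> degree a + degree b"
    proof -
      have "degree (a*R) \<le> degree a + degree b" using degree_mult_le[of a R] dR by simp
      moreover have "degree (r*s2*s3) \<le> degree a + degree b"
        using degree_mult_le[of "r*s2" s3] degree_mult_le[of r s2] ds2 ds3 root_degrees(1) by linarith
      moreover have "degree (a*r*s3) \<le> degree a + degree b"
        using degree_mult_le[of "a*r" s3] degree_mult_le[of a r] ds3 root_degrees(1) by linarith
      moreover have "degree (a*s2) \<le> degree a + degree b" using degree_mult_le[of a s2] ds2 deg by simp
      moreover have "degree (s3\<^sup>2) \<le> degree a + degree b" using ds3 by (simp add: degree_square_complex)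
      moreover define p1 p2 p3 p4 p5 where pdef: "p1 = a*R" "p2 = r*s2*s3" "p3 = a*r*s3" "p4 = a*s2" "p5 = s3\<^sup>2"
      ultimately show ?thesis unfolding pdef[symmetric] using dmn d2m
        by (intro degree_add_le degree_diff_le deg0_scale_le) auto
    qed
    hence dH: "degree (4*r\<^sup>2*(s2*H)) \<le> degree a + degree b" unfolding H .
    have rn: "r \<noteq> 0" using root_degrees(1) deg by auto
    have s2n: "s2 \<noteq> 0"
    proof
      assume "s2 = 0"
      hence "a*e2 + 1 = 0" using sq(3) by simp
      hence "a * (-e2) = 1" by algebra
      from unit_factors_deg0(1)[OF this] a0 show False by simp
    qed
    show False
    proof (cases "H = 0")
      case True
      hence "n\<^sup>2*s2\<^sup>2 = 4*m\<^sup>2*a\<^sup>2" unfolding H_def by algebra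
      hence "a * (4*m\<^sup>2*a - n\<^sup>2*e2) = n\<^sup>2" unfolding sq(3) by algebra
      from unit_factors_deg0(1)[OF this] a0 n0 dmn show False by (simp add: deg0_simps)
    next
      case False
      have "degree (4*r\<^sup>2*(s2*H)) = degree a + degree b + degree s2 + degree H"
        using rn s2n False root_degrees(1) by (simp add: degree_mult_eq degree_square_complex mult.assoc)
      hence "degree s2 = 0" "degree H = 0" using dH by auto
      hence "degree (H - n*s2) = 0" using dmn by (intro deg0_simps) auto
      moreover have "H - n*s2 = 2*m*a" unfolding H_def by simp
      ultimately show False using deg0_scale_eq[OF d2m, of a] a0 by simp
    qed
  next
    case False
    have ab: "degree a < degree b" using False root_degrees(2) lt by linarith
    have "degree ((n-m\<^sup>2+1)*a) \<le> degree a" using dmn by (intro deg0_scale deg0_simps) auto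
    hence dR': "degree R = degree b"
      unfolding R_def using deg0_scale_eq[OF q, of b] ab by (subst degree_add_eq_left) auto
    have ds: "degree s = degree b"
    proof (rule ccontr)
      assume "degree s \<noteq> degree b"
      hence "degree s < degree b" using False by simp
      hence "degree e1 \<ge> degree b" using R dR' degree_add_less[of "n*e1" "degree b" "2*m*s"] dms dne by fastforce
      thus False using deg_e1(1) root_degrees(2) \<open>degree s < degree b\<close> by linarith
    qed
    hence dc: "degree c + degree a = 2*degree b" "degree e1 + 2*degree a = degree b"
      using root_degrees(2) deg_e1(1) by linarith+
    show False
    proof (cases "degree a = 0")
      case a0: False
      have s: "s = s2 - 2*a*t1" unfolding rec(1) ch2(1) by algebra
      have "e2 = 0 \<or> degree e2 + degree c \<le> 2*degree b"
        by (rule disc_factor[OF pr(1) nz(3)]) (use deg dc in auto)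
      hence de2: "degree e2 \<le> degree a" using dc a0 by auto
      have e20: "e2 \<noteq> 0"
      proof
        assume "e2 = 0"
        hence sq4: "(a+e1-b)\<^sup>2 = 4*(a*e1+1)" using pr(1) by algebra
        have "degree (a*e1+1) \<le> degree b"
          using degree_mult_le[of a e1] dc by (intro degree_add_le) auto
        hence "degree ((a+e1-b)\<^sup>2) \<le> degree b" unfolding sq4 by (simp only: degree_numeral_mult)
        moreover have "degree (a+e1-b) = degree b"
        proof -
          have "degree (a+e1) < degree b" using ab dc a0 by (intro degree_add_less) auto
          thus ?thesis using degree_add_eq_right[of "a+e1" "-b"] by simp
        qed
        hence "degree ((a+e1-b)\<^sup>2) = 2*degree b" by (simp only: degree_square_complex)
        ultimately show False using deg(3) by linarith
      qed
      show False
        by (rule no_orbit_0_a_intermediate[OF rr sq(1,2,3) ch2(1) _ s R[unfolded R_def q_def] mn assms(3) _ _ _ nz(1,2) deg_e1(2) e20 de2])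
           (use a0 dc n0 m0 q ch2(2) q_def in auto)
    next
      case a0: True
      have dc': "degree c = 2*degree b" "degree e1 = degree b" using dc a0 by auto
      have "e2 = 0 \<or> degree e2 + degree c \<le> 2*degree b"
        by (rule disc_factor[OF pr(1) nz(3)]) (use deg dc' in auto)
      hence de2: "degree e2 = 0" using dc' by auto
      show False
      proof (cases "e2 = 0")
        case e2: True
        have st: "s2\<^sup>2 = 1" "t2\<^sup>2 = 1" using sq(3,4) unfolding e2 by simp_all
        define \<rho> where "\<rho> = r*s2*t2"
        have r: "r = \<rho>*s2*t2" unfolding \<rho>_def using st by algebra
        have rho: "\<rho>\<^sup>2 = a*b+1" unfolding \<rho>_def using st rr by algebra
        have drho: "degree \<rho> > 0" using deg_root[OF rho] nz deg by simp
        have E: "e1 = a+b+2*\<rho>" using ch2(3) by (simp add: e2 \<rho>_def)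
        have S1: "s1 = -(t2*(a+\<rho>))" unfolding ch2(4) r using st by algebra
        have S: "s = s2*(2*\<rho>*(a+\<rho>) - 1)" unfolding rec(1) S1 r using st by algebra
        define m' where "m' = s2*m"
        have mm: "m'\<^sup>2 = m\<^sup>2" unfolding m'_def using st by algebra
        have "s2 = 1 \<or> s2 = -1" using square_eq_cases[of s2 1] st by simp
        hence dm': "degree m' = 0" unfolding m'_def using dmn by auto
        have Z: "(n + 4*m'*a - q)*\<rho>\<^sup>2 + (2*n*a + 4*m'*a\<^sup>2)*\<rho> + (n*(a\<^sup>2-1) - 2*m'*a + q - (n-m\<^sup>2+1)*a\<^sup>2) = 0"
        proof -
          have "a*(n*(a+b+2*\<rho>) + 2*m*(s2*(2*\<rho>*(a+\<rho>) - 1))) = a*(q*b + (n-m\<^sup>2+1)*a)"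
            using R unfolding S E R_def by simp
          thus ?thesis using rho unfolding m'_def by algebra
        qed
        have z: "n + 4*m'*a - q = 0" "2*n*a + 4*m'*a\<^sup>2 = 0" "n*(a\<^sup>2-1) - 2*m'*a + q - (n-m\<^sup>2+1)*a\<^sup>2 = 0"
          using quadratic_zero[OF _ _ _ drho Z] a0 dmn dm' q by (auto simp: deg0_simps)
        have 1: "4*m'*a = n\<^sup>2" using z(1) unfolding q_def by algebra
        have "a*n*(n+2) = 0" using z(2) 1 by algebra
        hence "n + 2 = 0" using nz n0 by simp
        hence n2: "n = -2" by (simp add: eq_neg_iff_add_eq_0)
        have "4*(m'*a) = 4" using 1 unfolding n2 by simp
        hence ma: "m'*a = 1" by simp
        have "a\<^sup>2*(m\<^sup>2-1) + 2 = 0" using z(3) ma unfolding q_def n2 by algebra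
        hence "3*m\<^sup>2 = 1" using ma mm by algebra
        hence "(of_int (3*M\<^sup>2) :: complex poly) = of_int 1" unfolding mn by simp
        hence "3*M\<^sup>2 = 1" unfolding of_int_eq_iff .
        thus False by presburger
      next
        case e2: False
        have "e2 = a" using const_partner_unique[OF de2 a0 e2 nz(1) deg(3), of t2 r] sq(4) rr by (simp add: mult.commute)
        note e2a = this
        have st: "s2\<^sup>2 = a*a+1" "t2\<^sup>2 = r\<^sup>2"
          using sq(3,4) unfolding e2a rr by (simp_all add: mult.commute)
        have "t2 = 1*r \<or> t2 = (-1)*r" using square_eq_cases[OF st(2)] by simp
        then obtain \<tau> where \<tau>: "\<tau> = 1 \<or> \<tau> = -1" "t2 = \<tau>*r" by blast
        define \<theta> where "\<theta> = a + \<tau>*s2"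
        have "degree (s2\<^sup>2) = 0" unfolding st using a0 by (auto intro!: deg0_simps)
        hence "degree s2 = 0" by (simp add: degree_square_complex)
        hence dth: "degree \<theta> = 0" unfolding \<theta>_def using a0 \<tau> by (intro deg0_simps) auto
        have E': "e1 = a+b+a+2*a*b*a + 2*r*s2*t2" using ch2(3) e2a by simp
        note F = root_with_const_ext[OF rr st(1) \<tau> \<theta>_def E']
        have th0: "\<theta> \<noteq> 0" using F(1) by auto
        have tau: "\<tau>\<^sup>2 = 1" using \<tau> by auto
        have S1: "s1 = -\<tau>*(\<theta>*r)" unfolding ch2(4) F(4) ..
        have s2: "s2 = \<tau>*(\<theta> - a)" unfolding \<theta>_def using tau by algebra
        have S: "s = \<tau>*(2*\<theta>*r\<^sup>2 - \<theta> + a)" unfolding rec(1) S1 using s2 by algebra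
        define m' where "m' = of_int (if \<tau> = 1 then M else -M) * (1::complex poly)"
        have m': "m' = \<tau>*m" unfolding m'_def mn using \<tau> by auto
        have mm: "m'\<^sup>2 = m\<^sup>2" unfolding m' using tau by algebra
        have dm': "degree m' = 0" unfolding m' using \<tau> dmn by auto
        have Z: "0*b\<^sup>2 + (n*\<theta>\<^sup>2 + 4*m'*\<theta>*a - q)*b + (2*n*\<theta> + 2*m'*(\<theta>+a) - (n-m\<^sup>2+1)*a) = 0"
          using R[unfolded F(2) S R_def rr] unfolding m' by algebra
        have z: "n*\<theta>\<^sup>2 + 4*m'*\<theta>*a - q = 0" "2*n*\<theta> + 2*m'*(\<theta>+a) - (n-m\<^sup>2+1)*a = 0"
          using quadratic_zero(2,3)[OF _ _ _ deg(3) Z] a0 dmn dm' dth q by (auto simp: deg0_simps)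
        have T1: "\<theta>\<^sup>2*(n+2*m') = n\<^sup>2+n+2*m'" using z(1) F(1) unfolding q_def by algebra
        have T2: "\<theta>\<^sup>2*(3*n+6*m'-1+m'\<^sup>2) = 2*m'-n-1+m'\<^sup>2" using z(2) F(1) unfolding mm by algebra
        have P: "(n\<^sup>2+n+2*m')*(3*n+6*m'-1+m'\<^sup>2) = (n+2*m')*(2*m'-n-1+m'\<^sup>2)"
          unfolding T1[symmetric] T2[symmetric] by algebra
        obtain M' :: int where M': "m' = of_int M'" "\<bar>M'\<bar> = \<bar>M\<bar>" using m'_def by (auto split: if_splits)
        obtain l where l: "N = 2*l" using assms(3) by (auto elim!: evenE)
        have "(of_int ((N\<^sup>2+N+2*M')*(3*N+6*M'-1+M'\<^sup>2)) :: complex poly) = of_int ((N+2*M')*(2*M'-N-1+M'\<^sup>2))"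
          using P unfolding M'(1) mn by simp
        hence "(N\<^sup>2+N+2*M')*(3*N+6*M'-1+M'\<^sup>2) = (N+2*M')*(2*M'-N-1+M'\<^sup>2)" unfolding of_int_eq_iff .
        hence "4*(6*l^3 + 6*l\<^sup>2*M' + 3*l\<^sup>2 + l\<^sup>2*M'\<^sup>2 + 6*l*M' + 2*M'\<^sup>2) = 0" unfolding l by algebra
        hence eq: "6*l^3 + 6*l\<^sup>2*M' + 3*l\<^sup>2 + l\<^sup>2*M'\<^sup>2 + 6*l*M' + 2*M'\<^sup>2 = 0" by simp
        have N0: "N \<noteq> 0" using n0 mn by auto
        from degrees_0_a[OF a0 dc'(1) assms(4,5,2,3) N0]
        have "(l > 0 \<and> \<bar>M'\<bar> = 3*l) \<or> (l < 0 \<and> \<bar>M'\<bar> + 1 = -3*l)"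
          unfolding l M'(2) using N0 l by (auto split: if_splits)
        from int_solution_0_a[OF eq this] have "m' = -3" "n = 2" using M' mn l by auto
        hence "\<theta>\<^sup>2 * 4 = 0" using T1 by simp
        thus False using th0 by simp
      qed
    qed
  qed
qed

end

lemma (in quad_lt) regular: "D1_regular a b c d"
proof (cases rule: starting_points)
  case (1 w M N) thus ?thesis using no_orbit_0_0 by blast
next
  case (2 w M N) thus ?thesis using no_orbit_b_0 by blast
next
  case (3 w M N) thus ?thesis using no_orbit_0_a by blast
next
  case (4 w M N) thus ?thesis by (rule regular_orbit_e_e)
next
  case (5 w M N p) thus ?thesis using no_orbit_a_0 by blast
next
  case (6 w M N p) thus ?thesis using no_orbit_a_a by blast
qed

lemma (in quad) regular_if_lt:
  assumes "degree b < degree c" shows "D1_regular a b c d"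
proof -
  obtain \<rho> where \<rho>: "\<rho> = r \<or> \<rho> = -r" "degree (a+b+c+2*a*b*c + 2*\<rho>*s*t) = degree a + degree b + degree c"
    by (rule large_extension[OF rr ss tt nz(1-3)]) (use deg in auto)
  interpret Q: quad_lt a b c d \<rho> s t x y z
  proof
    show "\<rho>\<^sup>2 = a*b+1" using \<rho>(1) rr by auto
    show "\<rho> \<in> gauss_rat_polys" using \<rho>(1) gp gauss_polys_closed(4) by auto
  qed (fact nz ss tt xx yy zz deg gp IH assms \<rho>(2))+
  show ?thesis by (rule Q.regular)
qed

section \<open>Regular triples with two elements of top degree\<close>

text \<open>The case \<open>e = 0\<close>. Since \<open>t = c - s\<close>, both orbits can be compared in terms of \<open>a\<close>, \<open>c\<close> and \<open>s\<close>.\<close>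
locale quad_regular_triple = quad +
  assumes eqd: "degree b = degree c" and cdef: "c = a+b+2*r" and sdef: "s = a+r" and tdef: "t = b+r"
begin

lemma st_c: "t = c - s" "b = c + a - 2*s" "c*r - s*t = 1"
proof -
  show "t = c - s" unfolding cdef sdef tdef by algebra
  show "b = c + a - 2*s" unfolding cdef sdef by algebra
  show "c*r - s*t = 1" unfolding cdef sdef tdef using rr by algebra
qed

lemma small_extension_zero: assumes "D1_regular a b c d0" "degree d0 < degree c" shows "d0 = 0"
proof -
  let ?D = "a+b+c+2*a*b*c"
  have "(a+b-c)\<^sup>2 = (2*r)\<^sup>2" unfolding cdef by algebra
  hence "(0 - ?D)\<^sup>2 = 4*(a*b+1)*(a*c+1)*(b*c+1)" using rr by algebra
  hence "(d0 - ?D)\<^sup>2 = (0 - ?D)\<^sup>2" using assms(1) unfolding D1_regular_iff by simp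
  hence "d0 * (d0 - 2*?D) = 0" by algebra
  moreover have "d0 \<noteq> 2*?D"
  proof
    assume "d0 = 2*?D"
    hence "degree d0 = degree ?D" by (simp only: degree_numeral_mult)
    moreover have "degree ?D = degree (2*a*b*c)"
    proof (rule degree_add_eq_right)
      have "degree (2*a*b*c) = degree a + degree b + degree c" using nz by (simp add: degree_mult_eq mult.assoc)
      moreover have "degree (a+b+c) < degree a + degree b + degree c"
        using deg eqd by (intro degree_add_less) auto
      ultimately show "degree (a+b+c) < degree (2*a*b*c)" by simp
    qed
    moreover have "degree (2*a*b*c) = degree a + degree b + degree c" using nz by (simp add: degree_mult_eq mult.assoc)
    ultimately show False using assms(2) by simp
  qed
  ultimately show ?thesis by simp
qed

lemma s_deg: "degree s > 0" "s \<noteq> 0" "2*degree s = degree a + degree c"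
  using root_degrees(2) deg by auto

text \<open>The point \<open>(s, r)\<close> lies, up to sign, one step from \<open>(1, -1)\<close>, so the starts \<open>d1 = 0\<close> and \<open>d1 = a\<close> give the same orbit.\<close>
lemma shift_base: "orbit_z t c s r N = - orbit_z t c 1 1 (-N-1)"
proof -
  have "orbit_z t c 1 (-1) (N+1) = orbit_z t c (orbit_z t c 1 (-1) 1) (orbit_x t b 1 (-1) 1) N" by (rule orbit_z_shift[OF tt])
  moreover have "orbit_z t c 1 (-1) 1 = -s" unfolding orbit_z_def using st_c(1) by simp
  moreover have "orbit_x t b 1 (-1) 1 = -r" unfolding orbit_x_def tdef by simp
  ultimately have "orbit_z t c 1 (-1) (N+1) = orbit_z t c (-s) (-r) N" by simp
  moreover have "orbit_z t c 1 (-1) (N+1) = orbit_z t c 1 1 (-N-1)" using orbit_z_neg[of t c 1 1 "N+1"] by simp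
  moreover have "orbit_z t c (-s) (-r) N = - orbit_z t c s r N" by (simp add: orbit_z_def)
  ultimately show ?thesis by simp
qed

text \<open>For odd exponents \<open>t\<close> is congruent to \<open>-s\<close>; the sign in the third premise compensates for this, so that the constant terms of
  the two expansions agree.\<close>
lemma exponent_congruence:
  assumes "even M = even N" "w = orbit_z s c 1 1 M" "w = (if even N then orbit_z t c 1 1 N else - orbit_z t c 1 1 N)"
  defines "m \<equiv> of_int M :: complex poly" and "n \<equiv> of_int N"
  shows "c dvd a*(m\<^sup>2 - n\<^sup>2) + 2*s*(m+n+n\<^sup>2)"
proof (cases "even N")
  case True
  have "c\<^sup>2 dvd 2*w - (2 + c*(a*m\<^sup>2+2*m*s))" "c\<^sup>2 dvd 2*w - (2 + c*(b*n\<^sup>2+2*n*t))"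
    using orbit_z_mod(1)[OF ss, of M 1 1] orbit_z_mod(1)[OF tt, of N 1 1] assms(1-3) True unfolding m_def n_def by auto
  from cong_quotient[OF this nz(3)] have "c dvd (a*m\<^sup>2+2*m*s) - (b*n\<^sup>2+2*n*t)" .
  moreover have "(a*m\<^sup>2+2*m*s) - (b*n\<^sup>2+2*n*t) = (a*(m\<^sup>2 - n\<^sup>2) + 2*s*(m+n+n\<^sup>2)) + c*(-n\<^sup>2-2*n)"
    unfolding st_c(1,2) by algebra
  ultimately show ?thesis by (metis dvd_add_left_iff dvd_triv_left)
next
  case False
  have A: "c\<^sup>2 dvd 2*w - (2*s + c*(a*s*(m\<^sup>2-1)+2*m))"
    using orbit_z_mod(2)[OF ss, of M 1 1] assms(1,2) False unfolding m_def by simp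
  have wn: "-w = orbit_z t c 1 1 N" using assms(3) False by simp
  have "c\<^sup>2 dvd 2*(-w) - (2*t + c*(b*t*(n\<^sup>2-1)+2*n))"
    using orbit_z_mod(2)[OF tt, of N 1 1] False unfolding n_def wn by simp
  moreover have "- (2*(-w) - (2*t + c*(b*t*(n\<^sup>2-1)+2*n))) = 2*w - (2*s + c*(-2 - b*t*(n\<^sup>2-1)-2*n))"
    unfolding st_c(1) by algebra
  ultimately have "c\<^sup>2 dvd 2*w - (2*s + c*(-2 - b*t*(n\<^sup>2-1)-2*n))"
    by (metis dvd_minus_iff)
  from cong_quotient[OF A this nz(3)] have "c dvd (a*s*(m\<^sup>2-1)+2*m) - (-2 - b*t*(n\<^sup>2-1)-2*n)" .
  hence "c dvd s*((a*s*(m\<^sup>2-1)+2*m) - (-2 - b*t*(n\<^sup>2-1)-2*n))" by simp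
  moreover have "s*((a*s*(m\<^sup>2-1)+2*m) - (-2 - b*t*(n\<^sup>2-1)-2*n)) = (a*(m\<^sup>2 - n\<^sup>2) + 2*s*(m+n+n\<^sup>2))
     + c*(a\<^sup>2*(m\<^sup>2-1) + (n\<^sup>2-1)*(s*b - 1 - a*b))"
  proof -
    have "s*((a*s*(m\<^sup>2-1)+2*m) - (-2 - b*t*(n\<^sup>2-1)-2*n)) = a*s\<^sup>2*(m\<^sup>2-1) + 2*s*(m+n+1) + b*(s*c - s\<^sup>2)*(n\<^sup>2-1)"
      unfolding st_c(1) by algebra
    also have "\<dots> = a*(m\<^sup>2-1) + 2*s*(m+n+1) - b*(n\<^sup>2-1) + c*(a\<^sup>2*(m\<^sup>2-1) + (n\<^sup>2-1)*(s*b - a*b))"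
      unfolding ss by algebra
    also have "\<dots> = (a*(m\<^sup>2 - n\<^sup>2) + 2*s*(m+n+n\<^sup>2)) + c*(a\<^sup>2*(m\<^sup>2-1) + (n\<^sup>2-1)*(s*b - 1 - a*b))"
      using st_c(2) by algebra
    finally show ?thesis .
  qed
  ultimately show ?thesis by (metis dvd_add_left_iff dvd_triv_left)
qed

lemma trivial_orbit: assumes "w\<^sup>2 = c*d+1" "w = orbit_z s c 1 1 0" shows False
  using assms nz by (simp add: orbit_z_def)

lemma regular_orbit: assumes "w\<^sup>2 = c*d+1" "w = orbit_z s c 1 1 (-2)" shows "D1_regular a b c d"
proof -
  have "cheb_T s (-2) = 2*s\<^sup>2-1" "cheb_U s (-2) = -(2*s)" using cheb_Suc[of s 1] cheb_neg[of s 2] by (simp_all add: power2_eq_square algebra_simps)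
  hence "w = (2*s\<^sup>2-1) + c*(-(2*s))" using assms(2) by (simp add: orbit_z_def)
  moreover have "c*r + s*t = -((2*s\<^sup>2-1) + c*(-(2*s)))" using st_c(3) unfolding st_c(1) by algebra
  ultimately have "w\<^sup>2 = (c*r+s*t)\<^sup>2" by (simp only: power2_minus)
  thus ?thesis using assms(1) by (intro regular_from_root) auto
qed

text \<open>If \<open>a\<close> is smaller than \<open>c\<close>, the congruence is an equality and \<open>a\<close> and \<open>s\<close> have different
  degrees; if \<open>\<bar>M\<bar> = \<bar>N\<bar>\<close>, the term with \<open>a\<close> vanishes. Either way \<open>M\<^sup>2 = N\<^sup>2\<close> and \<open>M + N + N\<^sup>2 = 0\<close>, so \<open>M\<close> is 0, which
  belongs to \<open>d = 0\<close>, or \<open>-2\<close>, which belongs to the nonzero regular extension.\<close>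
lemma regular_if_unit_orbits:
  assumes w: "w\<^sup>2 = c*d+1" and "even M = even N" "w = orbit_z s c 1 1 M" "w = (if even N then orbit_z t c 1 1 N else - orbit_z t c 1 1 N)"
    and "degree a < degree c \<or> \<bar>M\<bar> = \<bar>N\<bar>"
  shows "D1_regular a b c d"
proof -
  define m n :: "complex poly" where mn: "m = of_int M" "n = of_int N"
  have I: "c dvd a*(m\<^sup>2 - n\<^sup>2) + 2*s*(m+n+n\<^sup>2)" using exponent_congruence[OF assms(2-4)] mn by simp
  have "M + N + N\<^sup>2 = 0 \<and> M\<^sup>2 = N\<^sup>2"
  proof (cases "\<bar>M\<bar> = \<bar>N\<bar>")
    case True
    hence "M\<^sup>2 = N\<^sup>2" by (simp only: power2_eq_iff abs_eq_iff)
    hence "m\<^sup>2 = n\<^sup>2" by (simp only: mn of_int_power[symmetric])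
    hence eq: "a*(m\<^sup>2 - n\<^sup>2) + 2*s*(m+n+n\<^sup>2) = 2*(s*(m+n+n\<^sup>2))" by (simp only: diff_self mult_zero_right add_0 mult.assoc)
    have "c dvd s*(m+n+n\<^sup>2)" using I unfolding eq by (rule dvd_twice)
    hence "c dvd s*(s*(m+n+n\<^sup>2))" by (rule dvd_mult)
    moreover have "s*(s*(m+n+n\<^sup>2)) = (m+n+n\<^sup>2) + c*(a*(m+n+n\<^sup>2))" using ss by algebra
    ultimately have "c dvd m+n+n\<^sup>2" by (metis dvd_add_left_iff dvd_triv_left)
    moreover have "degree (m+n+n\<^sup>2) < degree c" using deg unfolding mn by (simp add: deg0_simps)
    ultimately have "m+n+n\<^sup>2 = 0" by (rule small_multiple_zero)
    hence "(of_int (M+N+N\<^sup>2) :: complex poly) = 0" unfolding mn by simp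
    thus ?thesis using \<open>M\<^sup>2 = N\<^sup>2\<close> unfolding of_int_eq_0_iff by simp
  next
    case False
    hence lt: "degree a < degree c" using assms(5) by blast
    have d0: "degree (m\<^sup>2 - n\<^sup>2) = 0" "degree (2*(m+n+n\<^sup>2)) = 0" unfolding mn by (intro deg0_simps; simp)+
    have ds: "degree s < degree c" "degree a < degree s" using s_deg(3) lt by auto
    have e: "a*(m\<^sup>2 - n\<^sup>2) + 2*s*(m+n+n\<^sup>2) = (m\<^sup>2-n\<^sup>2)*a + (2*(m+n+n\<^sup>2))*s" by algebra
    have "degree ((m\<^sup>2-n\<^sup>2)*a + (2*(m+n+n\<^sup>2))*s) < degree c" using lt ds d0
      by (intro degree_add_less deg0_scale_less)
    with I have z: "(m\<^sup>2-n\<^sup>2)*a + (2*(m+n+n\<^sup>2))*s = 0" unfolding e by (rule small_multiple_zero)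
    have two: "2*(m+n+n\<^sup>2) = 0"
    proof (rule ccontr)
      assume nz0: "2*(m+n+n\<^sup>2) \<noteq> 0"
      have "degree ((m\<^sup>2-n\<^sup>2)*a) < degree ((2*(m+n+n\<^sup>2))*s)"
        unfolding deg0_scale_eq(1)[OF d0(2) nz0] using deg0_scale(1)[OF d0(1), of a] ds by linarith
      hence "degree ((m\<^sup>2-n\<^sup>2)*a + (2*(m+n+n\<^sup>2))*s) = degree s"
        using deg0_scale_eq(1)[OF d0(2) nz0, of s] by (simp add: degree_add_eq_right)
      thus False using z ds by simp
    qed
    have "(m\<^sup>2-n\<^sup>2)*a = 0" using z unfolding two by simp
    hence "m\<^sup>2 - n\<^sup>2 = 0" unfolding mult_eq_0_iff using nz by blast
    moreover have "m+n+n\<^sup>2 = 0" using two unfolding mult_eq_0_iff by simp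
    ultimately have "(of_int (M+N+N\<^sup>2) :: complex poly) = 0" "(of_int (M\<^sup>2 - N\<^sup>2) :: complex poly) = 0" unfolding mn by simp_all
    thus ?thesis unfolding of_int_eq_0_iff by simp
  qed
  hence MN: "M + N + N\<^sup>2 = 0" "M = N \<or> M = -N" by (auto simp: power2_eq_iff)
  have "M = 0 \<or> M = -2"
  proof -
    have "N*(N+2) = 0 \<or> N = 0" using MN by (auto simp: power2_eq_square algebra_simps)
    hence "N = 0 \<or> N = -2" by auto
    thus ?thesis using MN by auto
  qed
  thus ?thesis using trivial_orbit[OF w] regular_orbit[OF w] assms(3) by blast
qed

text \<open>For the orbit that starts at a constant \<open>a\<close> the congruence is an equality between a multiple of \<open>s\<close> and a
  constant, so \<open>N\<^sup>2 + N = 0\<close>.\<close>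
lemma a_orbit_trivial:
  assumes "even M \<noteq> even N" "w = orbit_z s c s p M" "w = (if even N then orbit_z t c 1 1 N else - orbit_z t c 1 1 N)"
    and lt: "degree a = 0" "degree p = 0"
  shows "w = 1 \<or> w = s"
proof -
  define m n :: "complex poly" where mn: "m = of_int M" "n = of_int N"
  have ds: "degree s < degree c" using s_deg(3) lt deg by simp
  show ?thesis
  proof (cases "even N")
    case True
    have A: "c\<^sup>2 dvd 2*w - (2*s*s + c*(a*s*s*(m\<^sup>2-1)+2*m*p))"
      using orbit_z_mod(2)[OF ss, of M s p] assms(1,2) True unfolding mn by (simp add: mult.assoc)
    have wn: "w = orbit_z t c 1 1 N" using assms(3) True by simp
    have B: "c\<^sup>2 dvd 2*w - (2 + c*(b*n\<^sup>2+2*n*t))"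
      using orbit_z_mod(1)[OF tt True, of 1 1] unfolding mn wn by simp
    have e: "2*s*s + c*(a*s*s*(m\<^sup>2-1)+2*m*p) = 2 + c*(2*a + a*s*s*(m\<^sup>2-1)+2*m*p)" using ss by algebra
    from cong_quotient[OF A[unfolded e] B nz(3)] have "c dvd (2*a + a*s*s*(m\<^sup>2-1)+2*m*p) - (b*n\<^sup>2+2*n*t)" .
    moreover have "(2*a + a*s*s*(m\<^sup>2-1)+2*m*p) - (b*n\<^sup>2+2*n*t)
       = ((2*(n\<^sup>2+n))*s + (a*(m\<^sup>2+1) + 2*m*p - a*n\<^sup>2)) + c*(a\<^sup>2*(m\<^sup>2-1) - n\<^sup>2 - 2*n)"
      unfolding st_c(1,2) using ss by algebra
    ultimately have dv: "c dvd (2*(n\<^sup>2+n))*s + (a*(m\<^sup>2+1) + 2*m*p - a*n\<^sup>2)"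
      by (metis dvd_add_left_iff dvd_triv_left)
    have d0: "degree (2*(n\<^sup>2+n)) = 0" "degree (a*(m\<^sup>2+1) + 2*m*p - a*n\<^sup>2) = 0"
      unfolding mn using lt by (intro deg0_simps; simp)+
    have "degree ((2*(n\<^sup>2+n))*s + (a*(m\<^sup>2+1) + 2*m*p - a*n\<^sup>2)) < degree c"
      using d0 ds by (intro degree_add_less deg0_scale_less) auto
    from small_multiple_zero[OF dv this] have z: "0*s\<^sup>2 + (2*(n\<^sup>2+n))*s + (a*(m\<^sup>2+1) + 2*m*p - a*n\<^sup>2) = 0" by simp
    from quadratic_zero(2)[OF _ d0 s_deg(1) z] have "2*(n\<^sup>2+n) = 0" by simp
    hence "n\<^sup>2 + n = 0" unfolding mult_eq_0_iff by simp
    hence "(of_int (N*(N+1)) :: complex poly) = 0" unfolding mn by (simp add: algebra_simps power2_eq_square)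
    hence "N*(N+1) = 0" unfolding of_int_eq_0_iff .
    moreover have "N + 1 \<noteq> 0" using True by presburger
    ultimately have "N = 0" by simp
    thus ?thesis using wn by (simp add: orbit_z_def)
  next
    case False
    have A: "c\<^sup>2 dvd 2*w - (2*s + c*(a*s*m\<^sup>2+2*m*s*p))"
      using orbit_z_mod(1)[OF ss, of M s p] assms(1,2) False unfolding mn by simp
    have wn: "-w = orbit_z t c 1 1 N" using assms(3) False by simp
    have "c\<^sup>2 dvd 2*(-w) - (2*t + c*(b*t*(n\<^sup>2-1)+2*n))"
      using orbit_z_mod(2)[OF tt, of N 1 1] False unfolding mn wn by simp
    moreover have "- (2*(-w) - (2*t + c*(b*t*(n\<^sup>2-1)+2*n))) = 2*w - (2*s + c*(-2 - b*t*(n\<^sup>2-1)-2*n))"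
      unfolding st_c(1) by algebra
    ultimately have "c\<^sup>2 dvd 2*w - (2*s + c*(-2 - b*t*(n\<^sup>2-1)-2*n))"
      by (metis dvd_minus_iff)
    from cong_quotient[OF A this nz(3)] have "c dvd (a*s*m\<^sup>2+2*m*s*p) - (-2 - b*t*(n\<^sup>2-1)-2*n)" .
    hence "c dvd s*((a*s*m\<^sup>2+2*m*s*p) - (-2 - b*t*(n\<^sup>2-1)-2*n))" by simp
    moreover have "s*((a*s*m\<^sup>2+2*m*s*p) - (-2 - b*t*(n\<^sup>2-1)-2*n))
       = ((2*(n\<^sup>2+n))*s + (a*m\<^sup>2 + 2*m*p - a*(n\<^sup>2-1))) + c*(a*(a*m\<^sup>2+2*m*p) + (n\<^sup>2-1)*(s*b - 1 - a*b))"
    proof -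
      have "s*((a*s*m\<^sup>2+2*m*s*p) - (-2 - b*t*(n\<^sup>2-1)-2*n)) = s\<^sup>2*(a*m\<^sup>2+2*m*p) + 2*s*(n+1) + b*(s*c - s\<^sup>2)*(n\<^sup>2-1)"
        unfolding st_c(1) by algebra
      also have "\<dots> = (a*m\<^sup>2+2*m*p) + 2*s*(n+1) - b*(n\<^sup>2-1) + c*(a*(a*m\<^sup>2+2*m*p) + (n\<^sup>2-1)*(s*b - a*b))"
        unfolding ss by algebra
      also have "\<dots> = ((2*(n\<^sup>2+n))*s + (a*m\<^sup>2 + 2*m*p - a*(n\<^sup>2-1))) + c*(a*(a*m\<^sup>2+2*m*p) + (n\<^sup>2-1)*(s*b - 1 - a*b))"
        using st_c(2) by algebra
      finally show ?thesis .
    qed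
    ultimately have dv: "c dvd (2*(n\<^sup>2+n))*s + (a*m\<^sup>2 + 2*m*p - a*(n\<^sup>2-1))"
      by (metis dvd_add_left_iff dvd_triv_left)
    have d0: "degree (2*(n\<^sup>2+n)) = 0" "degree (a*m\<^sup>2 + 2*m*p - a*(n\<^sup>2-1)) = 0"
      unfolding mn using lt by (intro deg0_simps; simp)+
    have "degree ((2*(n\<^sup>2+n))*s + (a*m\<^sup>2 + 2*m*p - a*(n\<^sup>2-1))) < degree c"
      using d0 ds by (intro degree_add_less deg0_scale_less) auto
    from small_multiple_zero[OF dv this] have z: "0*s\<^sup>2 + (2*(n\<^sup>2+n))*s + (a*m\<^sup>2 + 2*m*p - a*(n\<^sup>2-1)) = 0" by simp
    from quadratic_zero(2)[OF _ d0 s_deg(1) z] have "2*(n\<^sup>2+n) = 0" by simp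
    hence "n\<^sup>2 + n = 0" unfolding mult_eq_0_iff by simp
    hence "(of_int (N*(N+1)) :: complex poly) = 0" unfolding mn by (simp add: algebra_simps power2_eq_square)
    hence "N*(N+1) = 0" unfolding of_int_eq_0_iff .
    moreover have "N \<noteq> 0" using False by presburger
    ultimately have "N = -1" by simp
    hence "-w = t - c" using wn cheb_neg[of t 1] by (simp add: orbit_z_def)
    hence "w = s" unfolding st_c(1) by (simp add: eq_neg_iff_add_eq_0 minus_equation_iff)
    thus ?thesis ..
  qed
qed

lemma no_orbit_from_a:
  assumes w: "w\<^sup>2 = c*d+1" and "even M \<noteq> even N" "w = orbit_z s c s p M" "w = (if even N then orbit_z t c 1 1 N else - orbit_z t c 1 1 N)"
    and a0: "degree a = 0" and p: "p\<^sup>2 = a*a+1"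
  shows False
proof -
  have "degree (p\<^sup>2) = 0" unfolding p using a0 by (intro deg0_simps) auto
  hence "degree p = 0" by (simp add: degree_square_complex)
  from a_orbit_trivial[OF assms(2-4) a0 this] show False
  proof
    assume "w = 1" thus False using w nz by simp
  next
    assume "w = s"
    hence "c * d + 1 = a * c + 1" using w ss by metis
    hence "c * (d - a) = 0" by algebra
    thus False using nz by simp
  qed
qed

text \<open>Whatever the parities of the two positions, after a common change of sign the second orbit starts at
  \<open>(1, 1)\<close> and the first one at \<open>(1, 1)\<close> or, for constant \<open>a\<close>, at \<open>s\<close>; these are the situations of
  \<open>regular_if_unit_orbits\<close> and \<open>no_orbit_from_a\<close>.\<close>
lemma regular_if_small:
  assumes lt: "degree a < degree c"
  shows "D1_regular a b c d"
proof -
  have ds: "degree s < degree c" using s_deg(3) lt by simp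
  obtain M z0 x0 d0 N z1 y1 d1 where
    A: "z = orbit_z s c z0 x0 M" "z0\<^sup>2 = c*d0+1" "x0\<^sup>2 = a*d0+1"
    "(even M \<and> degree z0 < degree c \<and> c dvd z - z0)
     \<or> (odd M \<and> c dvd z - s * z0 \<and> degree d0 = 0 \<and> (d0 = 0 \<or> d0 = a \<and> degree a = 0))" and
    B: "z = orbit_z t c z1 y1 N" "z1\<^sup>2 = c*d1+1" "y1\<^sup>2 = b*d1+1"
    "(even N \<and> degree z1 < degree c \<and> c dvd z - z1)
     \<or> (odd N \<and> c dvd z - t * z1 \<and> d1 = 0)" and
    EE: "even M \<Longrightarrow> even N \<Longrightarrow> z0 = z1 \<and> d0 = d1 \<and> (d0 = 0 \<or> d0 = a \<and> degree a = 0 \<or> D1_regular a b c d0)" and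
    degree_relations: "degree d0 < degree c" "degree d1 < degree c"
    by (rule descents) (rule that, assumption+)
  have wz: "(\<sigma>*z)\<^sup>2 = c*d+1" if "\<sigma> = 1 \<or> \<sigma> = -1" for \<sigma> using sign_sq[OF that] zz by simp
  have t_s: "c dvd z + s*z1" if "c dvd z - t*z1"
  proof -
    have "c dvd (z - t*z1) + c*z1" using that by (intro dvd_add) auto
    moreover have "(z - t*z1) + c*z1 = z + s*z1" unfolding st_c(1) by algebra
    ultimately show ?thesis by simp
  qed
  have ss1: "c dvd z - \<sigma>" if "c dvd z - s*(\<sigma>*s)" for \<sigma>
  proof -
    have "c dvd (z - s*(\<sigma>*s)) + c*(a*\<sigma>)" using that by (intro dvd_add) auto
    moreover have "(z - s*(\<sigma>*s)) + c*(a*\<sigma>) = z - \<sigma>" using ss by algebra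
    ultimately show ?thesis by simp
  qed
  have root_s: "d' = a \<and> x'\<^sup>2 = f*a+1" if "z' = \<sigma>*s" "\<sigma> = 1 \<or> \<sigma> = -1" "z'\<^sup>2 = c*d'+1" "x'\<^sup>2 = f*d'+1" for z' \<sigma> d' x' f
  proof -
    have "c*d'+1 = a*c+1" using that(1-3) sign_sq ss by metis
    hence "c*(d'-a) = 0" by algebra
    thus ?thesis using nz that(4) by simp
  qed
  have d0z: "z0\<^sup>2 = 1\<^sup>2 \<and> x0\<^sup>2 = 1\<^sup>2" if "d0 = 0" using A(2,3) that by simp
  have d1z: "z1\<^sup>2 = 1\<^sup>2 \<and> y1\<^sup>2 = 1\<^sup>2" if "d1 = 0" using B(2,3) that by simp
  have d0a: "z0\<^sup>2 = s\<^sup>2 \<and> x0\<^sup>2 = a*a+1" if "d0 = a" using A(2,3) that ss by (simp add: mult.commute)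
  have sgn_ds: "degree (\<sigma>*s) < degree c" "degree (\<sigma>::complex poly) < degree c" if "\<sigma> = 1 \<or> \<sigma> = -1" for \<sigma>
    using that ds by auto
  show ?thesis
  proof (cases "even N")
    case odd: False
    hence d1: "d1 = 0" "c dvd z + s*z1" using B(4) t_s by auto
    obtain \<sigma> where sg: "\<sigma> = 1 \<or> \<sigma> = -1" "z1 = \<sigma>*1" using sign_cases d1z[OF d1(1)] by blast
    have ms: "-\<sigma> = 1 \<or> -\<sigma> = -1" using sg by auto
    obtain N' where N': "even N' = even N" "\<sigma>*z = orbit_z t c 1 1 N'"
      using orbit_start_fixed_sign[OF B(1) conjunct2[OF d1z[OF d1(1)]] sg(2,1) one_neq_zero] by blast
    hence wN: "(-\<sigma>)*z = (if even N' then orbit_z t c 1 1 N' else - orbit_z t c 1 1 N')" using odd by simp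
    have dv: "c dvd z - (-\<sigma>)*s" using d1(2) sg(2) by (simp add: mult.commute)
    show ?thesis
    proof (cases "even M")
      case True
      hence "z0 = (-\<sigma>)*s" using A(4) by (intro cong_eq[OF _ dv _ sgn_ds(1)[OF ms]]) auto
      from root_s[OF this ms A(2,3)] have "d0 = a" "x0\<^sup>2 = a*a+1" by auto
      hence "degree a = 0" using self_partner_const by blast
      obtain M' where M': "even M' = even M" "(-\<sigma>)*z = orbit_z s c s x0 M'"
        using orbit_start_fixed_sign[OF A(1) refl \<open>z0 = (-\<sigma>)*s\<close> ms s_deg(2)] by blast
      have "even M' \<noteq> even N'" using M' N' True odd by simp
      from no_orbit_from_a[OF wz[OF ms] this M'(2) wN \<open>degree a = 0\<close> \<open>x0\<^sup>2 = a*a+1\<close>] show ?thesis ..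
    next
      case False
      hence c0: "c dvd z - s*z0" "d0 = 0 \<or> d0 = a \<and> degree a = 0" using A(4) by auto
      from c0(2) show ?thesis
      proof
        assume "d0 = 0"
        obtain \<tau> where tau: "\<tau> = 1 \<or> \<tau> = -1" "z0 = \<tau>*1" using sign_cases d0z[OF \<open>d0=0\<close>] by blast
        have "\<tau>*s = (-\<sigma>)*s" using c0(1) tau(2) sgn_ds(1)[OF tau(1)]
          by (intro cong_eq[OF _ dv _ sgn_ds(1)[OF ms]]) (auto simp: mult.commute)
        hence "\<tau> = -\<sigma>" using sign_cancel[OF tau(1) ms] s_deg(2) by blast
        hence z0: "z0 = (-\<sigma>)*1" using tau by simp
        obtain M' where M': "even M' = even M" "(-\<sigma>)*z = orbit_z s c 1 1 M'"
          using orbit_start_fixed_sign[OF A(1) conjunct2[OF d0z[OF \<open>d0 = 0\<close>]] z0 ms one_neq_zero] by blast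
        have "even M' = even N'" using M' N' False odd by simp
        from regular_if_unit_orbits[OF wz[OF ms] this M'(2) wN] lt show ?thesis by blast
      next
        assume "d0 = a \<and> degree a = 0"
        obtain \<tau> where tau: "\<tau> = 1 \<or> \<tau> = -1" "z0 = \<tau>*s" using sign_cases d0a \<open>d0 = a \<and> degree a = 0\<close> by blast
        have "c dvd z - \<tau>" using c0(1) unfolding tau(2) by (rule ss1)
        hence "\<tau> = (-\<sigma>)*s" by (rule cong_eq[OF _ dv sgn_ds(2)[OF tau(1)] sgn_ds(1)[OF ms]])
        hence "degree \<tau> = degree s" using sign_deg[OF ms] by metis
        thus ?thesis using tau(1) s_deg(1) by auto
      qed
    qed
  next
    case even: True
    hence z1: "c dvd z - z1" "degree z1 < degree c" using B(4) by auto
    show ?thesis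
    proof (cases "even M")
      case True
      hence z: "z0 = z1" "d0 = d1" and d0: "d0 = 0 \<or> d0 = a \<and> degree a = 0 \<or> D1_regular a b c d0" using EE even by auto
      have "d0 = 0 \<or> d0 = a \<and> degree a = 0" using d0 small_extension_zero degree_relations by blast
      thus ?thesis
      proof
        assume "d0 = 0"
        obtain \<tau> where tau: "\<tau> = 1 \<or> \<tau> = -1" "z0 = \<tau>*1" using sign_cases d0z[OF \<open>d0=0\<close>] by blast
        have d1: "d1 = 0" "z1 = \<tau>*1" using z \<open>d0 = 0\<close> tau by auto
        obtain M' where M': "even M' = even M" "\<tau>*z = orbit_z s c 1 1 M'"
          using orbit_start_fixed_sign[OF A(1) conjunct2[OF d0z[OF \<open>d0 = 0\<close>]] tau(2,1) one_neq_zero] by blast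
        obtain N' where N': "even N' = even N" "\<tau>*z = orbit_z t c 1 1 N'"
          using orbit_start_fixed_sign[OF B(1) conjunct2[OF d1z[OF d1(1)]] d1(2) tau(1) one_neq_zero] by blast
        have "even M' = even N'" "\<tau>*z = (if even N' then orbit_z t c 1 1 N' else - orbit_z t c 1 1 N')" using M' N' True even by auto
        from regular_if_unit_orbits[OF wz[OF tau(1)] this(1) M'(2) this(2)] lt show ?thesis by blast
      next
        assume d0: "d0 = a \<and> degree a = 0"
        obtain \<tau> where tau: "\<tau> = 1 \<or> \<tau> = -1" "z0 = \<tau>*s" using sign_cases d0a d0 by blast
        have d1: "d1 = a" "z1 = \<tau>*s" using z d0 tau by auto
        have y1: "y1\<^sup>2 = r\<^sup>2" using B(3) d1 rr by (simp add: mult.commute)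
        obtain M' where M': "even M' = even M" "\<tau>*z = orbit_z s c s x0 M'"
          using orbit_start_fixed_sign[OF A(1) refl tau(2,1) s_deg(2)] by blast
        obtain N' where N': "even N' = even N" "\<tau>*z = orbit_z t c s r N'"
          using orbit_start_fixed_sign[OF B(1) y1 d1(2) tau(1) s_deg(2)] by blast
        have "even M' \<noteq> even (-N'-1)" "\<tau>*z = (if even (-N'-1) then orbit_z t c 1 1 (-N'-1) else - orbit_z t c 1 1 (-N'-1))"
          using M' N' True even unfolding shift_base by auto
        from no_orbit_from_a[OF wz[OF tau(1)] this(1) M'(2) this(2) conjunct2[OF d0] conjunct2[OF d0a[OF conjunct1[OF d0]]]] show ?thesis ..
      qed
    next
      case False
      hence c0: "c dvd z - s*z0" "d0 = 0 \<or> d0 = a \<and> degree a = 0" using A(4) by auto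
      from c0(2) show ?thesis
      proof
        assume "d0 = 0"
        obtain \<tau> where tau: "\<tau> = 1 \<or> \<tau> = -1" "z0 = \<tau>*1" using sign_cases d0z[OF \<open>d0=0\<close>] by blast
        have "c dvd z - \<tau>*s" using c0(1) tau(2) by (simp add: mult.commute)
        hence z1s: "z1 = \<tau>*s" by (rule cong_eq[OF z1(1) _ z1(2) sgn_ds(1)[OF tau(1)]])
        from root_s[OF this tau(1) B(2,3)] rr have y1: "y1\<^sup>2 = r\<^sup>2" by (simp add: mult.commute)
        obtain M' where M': "even M' = even M" "\<tau>*z = orbit_z s c 1 1 M'"
          using orbit_start_fixed_sign[OF A(1) conjunct2[OF d0z[OF \<open>d0 = 0\<close>]] tau(2,1) one_neq_zero] by blast
        obtain N' where N': "even N' = even N" "\<tau>*z = orbit_z t c s r N'"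
          using orbit_start_fixed_sign[OF B(1) y1 z1s tau(1) s_deg(2)] by blast
        have "even M' = even (-N'-1)" "\<tau>*z = (if even (-N'-1) then orbit_z t c 1 1 (-N'-1) else - orbit_z t c 1 1 (-N'-1))"
          using M' N' False even unfolding shift_base by auto
        from regular_if_unit_orbits[OF wz[OF tau(1)] this(1) M'(2) this(2)] lt show ?thesis by blast
      next
        assume d0: "d0 = a \<and> degree a = 0"
        obtain \<tau> where tau: "\<tau> = 1 \<or> \<tau> = -1" "z0 = \<tau>*s" using sign_cases d0a d0 by blast
        have "c dvd z - \<tau>" using c0(1) unfolding tau(2) by (rule ss1)
        hence z1t: "z1 = \<tau>*1" using cong_eq[OF z1(1) _ z1(2) sgn_ds(2)[OF tau(1)]] by simp
        hence "z1\<^sup>2 = 1" using tau(1) by auto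
        hence "d1 = 0" using B(2) nz by simp
        obtain M' where M': "even M' = even M" "\<tau>*z = orbit_z s c s x0 M'"
          using orbit_start_fixed_sign[OF A(1) refl tau(2,1) s_deg(2)] by blast
        obtain N' where N': "even N' = even N" "\<tau>*z = orbit_z t c 1 1 N'"
          using orbit_start_fixed_sign[OF B(1) conjunct2[OF d1z[OF \<open>d1 = 0\<close>]] z1t tau(1) one_neq_zero] by blast
        have "even M' \<noteq> even N'" "\<tau>*z = (if even N' then orbit_z t c 1 1 N' else - orbit_z t c 1 1 N')" using M' N' False even by auto
        from no_orbit_from_a[OF wz[OF tau(1)] this(1) M'(2) this(2) conjunct2[OF d0] conjunct2[OF d0a[OF conjunct1[OF d0]]]] show ?thesis ..
      qed
    qed
  qed
qed

end

context pell_pair begin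

text \<open>The product \<open>(s z0 + c x0)(s z0 - c x0) = c(a-c) + 1\<close> has the largest degree that its factors permit, so
  the leading terms cancel in neither direction.\<close>
lemma orbit_degree_unit:
  assumes eq: "degree a = degree c" "degree (a - c) = degree c" and "z0\<^sup>2 = 1" "x0\<^sup>2 = 1"
  shows "degree (orbit_z s c z0 x0 M) = nat \<bar>M\<bar> * degree c"
proof -
  have ds: "degree s = degree c" using deg_s eq by simp
  have sc: "degree (s*z0 + c*x0) = degree c" "degree (s*z0 - c*x0) = degree c"
  proof -
    have u: "z0 = 1 \<or> z0 = -1" "x0 = 1 \<or> x0 = -1" using assms(3,4) square_eq_cases[of _ 1] by auto
    hence le: "degree (s*z0 + c*x0) \<le> degree c" "degree (s*z0 - c*x0) \<le> degree c"
      using ds by (auto intro!: degree_add_le degree_diff_le)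
    have p: "(s*z0 + c*x0) * (s*z0 - c*x0) = c*(a - c) + 1"
    proof -
      have "(s*z0 + c*x0) * (s*z0 - c*x0) = s\<^sup>2*z0\<^sup>2 - c\<^sup>2*x0\<^sup>2" by algebra
      thus ?thesis unfolding ss assms(3,4) by algebra
    qed
    have "degree (c*(a-c) + 1) = 2*degree c"
    proof -
      have "degree (c*(a-c)) = 2*degree c" using eq nz by (simp add: degree_mult_eq)
      thus ?thesis using deg degree_add_eq_left[of 1 "c*(a-c)"] by simp
    qed
    hence "degree ((s*z0 + c*x0) * (s*z0 - c*x0)) = 2*degree c" unfolding p .
    moreover have "degree ((s*z0 + c*x0) * (s*z0 - c*x0)) \<le> degree (s*z0 + c*x0) + degree (s*z0 - c*x0)"
      by (rule degree_mult_le)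
    ultimately show "degree (s*z0 + c*x0) = degree c" "degree (s*z0 - c*x0) = degree c" using le by linarith+
  qed
  have nz': "s*z0 + c*x0 \<noteq> 0" "s*z0 - c*x0 \<noteq> 0"
    using sc deg by (metis degree_0 less_irrefl)+
  have z0: "degree z0 = 0" using assms(3) square_eq_cases[of z0 1] by auto
  consider "M = 0" | "M \<ge> 1" | "M \<le> -1" by linarith
  thus ?thesis
  proof cases
    case 1 thus ?thesis using z0 by (simp add: orbit_z_def)
  next
    case 2
    have "degree (orbit_z s c z0 x0 M) = degree c + nat (M-1) * degree c"
      using orbit_z_degree_pos[OF ss _ _ nz'(1) 2] sc ds deg z0 by simp
    moreover have "nat \<bar>M\<bar> = Suc (nat (M-1))" using 2 by simp
    ultimately show ?thesis by simp
  next
    case 3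
    have "degree (orbit_z s c z0 x0 M) = degree c + nat (-M-1) * degree c"
      using orbit_z_degree_neg[OF ss _ _ nz'(2) 3] sc ds deg z0 by simp
    moreover have "nat \<bar>M\<bar> = Suc (nat (-M-1))" using 3 by simp
    ultimately show ?thesis by simp
  qed
qed

text \<open>A start at a nonzero constant \<open>d0\<close> has half the degree of \<open>c\<close>, so along its orbit the degrees are half-odd
  multiples of that degree, and it is separated from the orbits of the preceding lemma.\<close>
lemma orbit_degree_const:
  assumes eq: "degree a = degree c" "degree (a - c) = degree c"
    and d0: "z0\<^sup>2 = c*d0+1" "x0\<^sup>2 = a*d0+1" "degree d0 = 0" "d0 \<noteq> 0"
  shows "\<exists>j. 2 * degree (orbit_z s c z0 x0 M) = (2*j+1) * degree c"
proof -
  have ds: "degree s = degree c" using deg_s eq by simp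
  have dz: "2*degree z0 = degree c" "2*degree x0 = degree c"
    using deg_root[OF d0(1)] deg_root[OF d0(2)] nz d0 deg eq by auto
  have n0: "z0 \<noteq> 0" "x0 \<noteq> 0" "s \<noteq> 0" using dz ds deg by auto
  let ?p = "s*z0 + c*x0" let ?m = "s*z0 - c*x0"
  have le: "2*degree ?p \<le> 3*degree c" "2*degree ?m \<le> 3*degree c"
  proof -
    have "2*degree (s*z0) = 3*degree c" "2*degree (c*x0) = 3*degree c"
      using dz ds n0 nz by (auto simp: degree_mult_eq)
    thus "2*degree ?p \<le> 3*degree c" "2*degree ?m \<le> 3*degree c"
      using degree_add_le_max[of "s*z0" "c*x0"] degree_diff_le_max[of "s*z0" "c*x0"] by linarith+
  qed
  have norm0: "a*z0\<^sup>2 - c*x0\<^sup>2 = a - c" unfolding d0 by algebra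
  have "?p * ?m = z0\<^sup>2 + c*(a-c)" using norm0 ss by algebra
  moreover have "degree (z0\<^sup>2 + c*(a-c)) = 2*degree c"
  proof -
    have "degree (c*(a-c)) = 2*degree c" using eq nz by (simp add: degree_mult_eq)
    moreover have "degree (z0\<^sup>2) = degree c" using dz by (simp add: degree_square_complex)
    ultimately show ?thesis using deg degree_add_eq_right[of "z0\<^sup>2" "c*(a-c)"] by simp
  qed
  ultimately have dp: "degree (?p * ?m) = 2*degree c" by simp
  hence n: "?p \<noteq> 0" "?m \<noteq> 0" using deg by auto
  hence sum: "degree ?p + degree ?m = 2*degree c" using dp by (simp add: degree_mult_eq)
  have dsum: "degree (?p + ?m) = degree s + degree z0"
  proof -
    have "?p + ?m = 2*(s*z0)" by algebra
    thus ?thesis using n0 by (simp only: degree_numeral_mult) (simp add: degree_mult_eq)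
  qed
  have "2 * degree (?p + ?m) = 3*degree c" using dsum dz ds by simp
  hence or: "2*degree ?p = 3*degree c \<or> 2*degree ?m = 3*degree c"
    using degree_add_le_max[of ?p ?m] le by linarith
  hence or: "(2*degree ?p = 3*degree c \<and> 2*degree ?m = degree c) \<or> (2*degree ?m = 3*degree c \<and> 2*degree ?p = degree c)"
    using sum by linarith
  have step: "\<exists>j. 2 * degree w = (2*j+1) * degree c" if "degree w = degree q + k * degree s" "2*degree q = 3*degree c \<or> 2*degree q = degree c" for w q :: "complex poly" and k
  proof -
    have "2*degree w = 2*degree q + 2*k*degree c" using that(1) ds by simp
    hence "2*degree w = (2*(k+1)+1)*degree c \<or> 2*degree w = (2*k+1)*degree c" using that(2) by auto
    thus ?thesis by blast
  qed
  consider "M = 0" | "M \<ge> 1" | "M \<le> -1" by linarith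
  thus ?thesis
  proof cases
    case 1
    have "2 * degree (orbit_z s c z0 x0 M) = (2*0+1) * degree c" using 1 dz by (simp add: orbit_z_def)
    thus ?thesis by blast
  next
    case 2
    have "degree (orbit_z s c z0 x0 M) = degree ?p + nat (M-1) * degree s"
      by (rule orbit_z_degree_pos[OF ss _ _ n(1) 2]) (use ds deg dz or in linarith)+
    from step[OF this] or show ?thesis by blast
  next
    case 3
    have "degree (orbit_z s c z0 x0 M) = degree ?m + nat (-M-1) * degree s"
      by (rule orbit_z_degree_neg[OF ss _ _ n(2) 3]) (use ds deg dz or in linarith)+
    from step[OF this] or show ?thesis by blast
  qed
qed

end

context quad_regular_triple begin

text \<open>Now \<open>s\<close> and \<open>t\<close> are not smaller than \<open>c\<close>, and the congruences alone do not determine the exponents. But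
  every starting extension is constant, a nonconstant one being excluded by \<open>regular_triple\<close>, and then the
  degree of \<open>z\<close> along the two orbits gives \<open>\<bar>M\<bar> = \<bar>N\<bar>\<close>.\<close>
lemma regular_if_equal:
  assumes eq: "degree a = degree c" and lc: "degree (a - c) = degree c" "degree (b - c) = degree c"
  shows "D1_regular a b c d"
proof -
  have pos: "degree a > 0" "degree c > 0" using eq deg eqd by auto
  obtain M z0 x0 d0 N z1 y1 d1 where
    A: "z = orbit_z s c z0 x0 M" "z0\<^sup>2 = c*d0+1" "x0\<^sup>2 = a*d0+1"
    "(even M \<and> degree z0 < degree c \<and> c dvd z - z0)
     \<or> (odd M \<and> c dvd z - s * z0 \<and> degree d0 = 0 \<and> (d0 = 0 \<or> d0 = a \<and> degree a = 0))" and
    B: "z = orbit_z t c z1 y1 N" "z1\<^sup>2 = c*d1+1" "y1\<^sup>2 = b*d1+1"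
    "(even N \<and> degree z1 < degree c \<and> c dvd z - z1)
     \<or> (odd N \<and> c dvd z - t * z1 \<and> d1 = 0)" and
    EE: "even M \<Longrightarrow> even N \<Longrightarrow> z0 = z1 \<and> d0 = d1 \<and> (d0 = 0 \<or> d0 = a \<and> degree a = 0 \<or> D1_regular a b c d0)" and
    degree_relations: "degree d0 < degree c" "degree d1 < degree c"
    by (rule descents) (rule that, assumption+)
  have const: "degree d' = 0"
    if sq: "z'\<^sup>2 = c*d'+1" "x'\<^sup>2 = f*d'+1" "u\<^sup>2 = f*c+1" and "degree d' < degree c" "degree f = degree c" "degree (f - c) = degree c" "f \<noteq> 0"
    for z' x' d' f u
  proof (rule ccontr)
    assume nc: "degree d' \<noteq> 0"
    have sq4: "(f + d' - c)\<^sup>2 = 4*(f*d'+1)"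
      by (rule regular_triple[of x' f d' u c z']) (use sq that nc nz in \<open>auto simp: mult.commute\<close>)
    have "degree (f + d' - c) = degree c"
    proof -
      have e: "f + d' - c = (f - c) + d'" by simp
      show ?thesis unfolding e using that by (subst degree_add_eq_left) auto
    qed
    hence "degree ((f + d' - c)\<^sup>2) = 2 * degree c" by (simp only: degree_square_complex)
    hence "degree (f*d'+1) = 2*degree c" unfolding sq4 by (simp only: degree_numeral_mult)
    moreover have "degree (f*d'+1) \<le> degree f + degree d'"
      using degree_mult_le[of f d'] by (intro degree_add_le) auto
    ultimately show False using that by linarith
  qed
  have d0c: "degree d0 = 0" by (rule const[OF A(2,3) ss degree_relations(1) eq lc(1) nz(1)])
  have d1c: "degree d1 = 0" by (rule const[OF B(2,3) tt degree_relations(2) eqd lc(2) nz(2)])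
  have dA: "d0 = 0 \<Longrightarrow> degree z = nat \<bar>M\<bar> * degree c" "d0 \<noteq> 0 \<Longrightarrow> \<exists>j. 2*degree z = (2*j+1)*degree c"
    unfolding A(1) using ac.orbit_degree_unit[OF eq lc(1), of z0 x0 M] ac.orbit_degree_const[OF eq lc(1) A(2,3) d0c, of M] A(2,3) by auto
  have dB: "d1 = 0 \<Longrightarrow> degree z = nat \<bar>N\<bar> * degree c" "d1 \<noteq> 0 \<Longrightarrow> \<exists>j. 2*degree z = (2*j+1)*degree c"
    unfolding B(1) using bc.orbit_degree_unit[OF eqd lc(2), of z1 y1 N] bc.orbit_degree_const[OF eqd lc(2) B(2,3) d1c, of N] B(2,3) by auto
  have par: False if "2*(k*degree c) = (2*j+1)*degree c" for k j :: nat
  proof -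
    have "(2*k) * degree c = (2*j+1) * degree c" using that by simp
    hence "2*k = 2*j+1" using pos(2) by (simp only: mult_cancel2) simp
    thus False by presburger
  qed
  have d01: "d0 = 0 \<and> d1 = 0"
  proof (rule ccontr)
    assume "\<not> (d0 = 0 \<and> d1 = 0)"
    hence ne: "d0 \<noteq> 0 \<and> d1 \<noteq> 0" using dA dB par by metis
    hence "even M" "even N" using A(4) B(4) pos by auto
    from EE[OF this] have "d0 = 0 \<or> D1_regular a b c d0" using pos by auto
    hence "d0 = 0" using small_extension_zero degree_relations by blast
    thus False using ne by simp
  qed
  note d = conjunct1[OF d01] conjunct2[OF d01]
  have "nat \<bar>M\<bar> * degree c = nat \<bar>N\<bar> * degree c" using trans[OF sym[OF dA(1)[OF d(1)]] dB(1)[OF d(2)]] .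
  hence MN: "\<bar>M\<bar> = \<bar>N\<bar>" using pos(2) by simp
  hence par: "even M = even N" by presburger
  have sqs: "z0\<^sup>2 = 1\<^sup>2" "x0\<^sup>2 = 1\<^sup>2" "z1\<^sup>2 = 1\<^sup>2" "y1\<^sup>2 = 1\<^sup>2" using A(2,3) B(2,3) d by auto
  obtain \<sigma> where sg: "\<sigma> = 1 \<or> \<sigma> = -1" "z0 = \<sigma>*1" using sign_cases[OF sqs(1)] by blast
  obtain \<tau> where tau: "\<tau> = 1 \<or> \<tau> = -1" "z1 = \<tau>*1" using sign_cases[OF sqs(3)] by blast
  \<comment> \<open>For even exponents \<open>z\<close> is congruent to both starting values modulo \<open>c\<close>, for odd ones to \<open>s \<sigma>\<close> and \<open>t \<tau>\<close>,
    where \<open>t\<close> is congruent to \<open>-s\<close>.\<close>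
  have st: "\<tau> = (if even N then \<sigma> else -\<sigma>)"
  proof (cases "even N")
    case True
    hence "even M" using par by simp
    from EE[OF this True] have "\<sigma> = \<tau>" using sg(2) tau(2) by simp
    thus ?thesis using True by simp
  next
    case False
    hence "c dvd z - s*z0" "c dvd z - t*z1" using A(4) B(4) par by auto
    hence "c dvd (z - t*z1) - (z - s*z0)" by (rule dvd_diff[rotated])
    hence "c dvd s*((z - t*z1) - (z - s*z0))" by (rule dvd_mult)
    moreover have "s*((z - t*z1) - (z - s*z0)) = (\<sigma>+\<tau>) + c*(a*(\<sigma>+\<tau>) - s*\<tau>)"
      unfolding sg(2) tau(2) st_c(1) using ss by algebra
    ultimately have "c dvd \<sigma>+\<tau>" by (metis dvd_add_left_iff dvd_triv_left)
    moreover have "degree (\<sigma>+\<tau>) < degree c" using sg(1) tau(1) pos by auto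
    ultimately have "\<sigma>+\<tau> = 0" by (rule small_multiple_zero)
    thus ?thesis using False by (simp add: eq_neg_iff_add_eq_0 add.commute)
  qed
  obtain M' where M': "M' = M \<or> M' = -M" "\<sigma>*z = orbit_z s c 1 1 M'"
  proof -
    have e: "\<sigma>*z = orbit_z s c 1 (\<sigma>*x0) M" unfolding A(1) sg(2) orbit_z_def using sg(1) by auto
    have "x0 = 1 \<or> x0 = -1" using square_eq_cases[OF sqs(2)] by simp
    hence "\<sigma>*x0 = 1 \<or> \<sigma>*x0 = -1" using sg(1) by auto
    thus thesis
    proof
      assume "\<sigma>*x0 = 1" thus thesis using that[of M] e by simp
    next
      assume "\<sigma>*x0 = -1" thus thesis using that[of "-M"] e orbit_z_neg[of s c 1 1 M] by simp
    qed
  qed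
  obtain N' where N': "N' = N \<or> N' = -N" "\<tau>*z = orbit_z t c 1 1 N'"
  proof -
    have e: "\<tau>*z = orbit_z t c 1 (\<tau>*y1) N" unfolding B(1) tau(2) orbit_z_def using tau(1) by auto
    have "y1 = 1 \<or> y1 = -1" using square_eq_cases[OF sqs(4)] by simp
    hence "\<tau>*y1 = 1 \<or> \<tau>*y1 = -1" using tau(1) by auto
    thus thesis
    proof
      assume "\<tau>*y1 = 1" thus thesis using that[of N] e by simp
    next
      assume "\<tau>*y1 = -1" thus thesis using that[of "-N"] e orbit_z_neg[of t c 1 1 N] by simp
    qed
  qed
  have 1: "even M' = even N'" "\<bar>M'\<bar> = \<bar>N'\<bar>" using M'(1) N'(1) par MN by auto
  have 2: "\<sigma>*z = (if even N' then orbit_z t c 1 1 N' else - orbit_z t c 1 1 N')"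
  proof (cases "even N")
    case True
    hence "even N'" using N'(1) by auto
    thus ?thesis using N'(2) st True by simp
  next
    case False
    hence "odd N'" using N'(1) by auto
    moreover have "- (\<sigma>*z) = orbit_z t c 1 1 N'" using N'(2) st False by simp
    hence "\<sigma>*z = - orbit_z t c 1 1 N'" by (metis minus_minus)
    ultimately show ?thesis by simp
  qed
  have "(\<sigma>*z)\<^sup>2 = c*d+1" using sign_sq[OF sg(1)] zz by simp
  from regular_if_unit_orbits[OF this 1(1) M'(2) 2] 1(2) show ?thesis by blast
qed

end

section \<open>Triples that extend by their own constant element\<close>

text \<open>Squares are 0, 1 or 4 modulo 8, so numerator and denominator of a root would both be even.\<close>
lemma no_rational_sqrt_3mod8:
  fixes k :: int assumes k: "k mod 8 = 3" and y: "(y::real) \<in> \<rat>"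
  shows "y\<^sup>2 \<noteq> of_int k"
proof
  assume eq: "y\<^sup>2 = of_int k"
  obtain m n :: nat where mn: "n \<noteq> 0" "\<bar>y\<bar> = real m / real n" "coprime m n"
    using Rats_abs_nat_div_natE[OF y] by metis
  have "y\<^sup>2 = (real m / real n)\<^sup>2" using mn(2) by (metis power2_abs)
  hence "real m ^ 2 = of_int k * real n ^ 2" using eq mn(1) by (simp add: power_divide field_simps)
  hence "(of_int ((int m)\<^sup>2) :: real) = of_int (k * (int n)\<^sup>2)" by simp
  hence z: "(int m)\<^sup>2 = k * (int n)\<^sup>2" unfolding of_int_eq_iff .
  have sq: "(j::int)\<^sup>2 mod 8 = 0 \<or> j\<^sup>2 mod 8 = 1 \<or> j\<^sup>2 mod 8 = 4" "odd j \<Longrightarrow> j\<^sup>2 mod 8 = 1" for j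
  proof -
    have e: "j\<^sup>2 mod 8 = (j mod 8)\<^sup>2 mod 8" by (simp add: power_mod)
    have "j mod 8 \<in> {0..<8}" by simp
    hence c: "j mod 8 \<in> {0,1,2,3,4,5,6,7}" by auto
    thus "j\<^sup>2 mod 8 = 0 \<or> j\<^sup>2 mod 8 = 1 \<or> j\<^sup>2 mod 8 = 4" unfolding e by auto
    assume "odd j"
    hence "odd (j mod 8)" by presburger
    thus "j\<^sup>2 mod 8 = 1" unfolding e using c by auto
  qed
  have "(int m)\<^sup>2 mod 8 = (3 * ((int n)\<^sup>2 mod 8)) mod 8" unfolding z using k by (metis mod_mult_eq mod_mod_trivial)
  hence m8: "(int n)\<^sup>2 mod 8 = 1 \<Longrightarrow> (int m)\<^sup>2 mod 8 = 3" by simp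
  have n2: "even (int n)"
  proof (rule ccontr)
    assume "odd (int n)"
    hence "(int m)\<^sup>2 mod 8 = 3" using sq(2) m8 by blast
    thus False using sq(1)[of "int m"] by auto
  qed
  hence "even ((int m)\<^sup>2)" unfolding z by simp
  hence "2 dvd n" "2 dvd m" using n2 by auto
  thus False using mn(3) coprime_common_divisor[of m n 2] by auto
qed

text \<open>The square of \<open>w\<close> times the conjugate of \<open>u\<close> would be \<open>-k\<close> times the square of a positive rational, so
  the imaginary part of this product would yield a rational root of \<open>k\<close>.\<close>
lemma gauss_rats_no_sqrt:
  fixes k :: int
  assumes k: "k mod 8 = 3" "k > 0" and u: "u \<in> gauss_rats" "w \<in> gauss_rats" "u \<noteq> 0"
  shows "w\<^sup>2 \<noteq> - of_int k * u\<^sup>2"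
proof
  assume eq: "w\<^sup>2 = - of_int k * u\<^sup>2"
  obtain u1 u2 where u1: "u = u1 + u2*\<i>" "u1 \<in> \<rat>" "u2 \<in> \<rat>" using u by (auto simp: gauss_rats_def)
  obtain w1 w2 where w1: "w = w1 + w2*\<i>" "w1 \<in> \<rat>" "w2 \<in> \<rat>" using u by (auto simp: gauss_rats_def)
  obtain p1 p2 q1 q2 :: real where r: "u1 = of_real p1" "u2 = of_real p2" "w1 = of_real q1" "w2 = of_real q2" and
     rat: "p1 \<in> \<rat>" "p2 \<in> \<rat>" "q1 \<in> \<rat>" "q2 \<in> \<rat>"
  proof -
    have *: "\<exists>p\<in>\<rat>. v = complex_of_real p" if v: "v \<in> \<rat>" for v
    proof -
      obtain f where "v = of_rat f" by (rule Rats_cases[OF v])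
      moreover have "complex_of_real (of_rat f) = of_rat f"
        by (cases f) (simp add: of_rat_rat)
      ultimately have "v = complex_of_real (of_rat f)" by simp
      thus ?thesis by auto
    qed
    from *[OF u1(2)] *[OF u1(3)] *[OF w1(2)] *[OF w1(3)] show ?thesis using that by blast
  qed
  define N where "N = p1\<^sup>2 + p2\<^sup>2"
  have N: "N > 0" using u(3) unfolding u1 r N_def by (auto simp: sum_power2_gt_zero_iff)
  define x where "x = q1*p1 + q2*p2"
  define y where "y = q2*p1 - q1*p2"
  \<comment> \<open>After division by the norm of \<open>u\<close> the equation says that \<open>-k\<close> is a square of a Gaussian rational.\<close>
  have "(w * cnj u)\<^sup>2 = - of_int k * (u * cnj u)\<^sup>2" using eq by (simp add: power_mult_distrib)
  moreover have "w * cnj u = Complex x y" unfolding u1 w1 r x_def y_def by (simp add: complex_eq_iff algebra_simps)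
  moreover have "u * cnj u = of_real N" unfolding u1 r N_def by (simp add: complex_eq_iff power2_eq_square)
  ultimately have c: "(Complex x y)\<^sup>2 = - of_int k * (of_real N)\<^sup>2" by simp
  have "Re ((Complex x y)\<^sup>2) = - of_int k * N\<^sup>2" "Im ((Complex x y)\<^sup>2) = 0" unfolding c by (simp_all add: power2_eq_square)
  hence xy: "x\<^sup>2 - y\<^sup>2 = - of_int k * N\<^sup>2" "x * y = 0" by (simp_all add: power2_eq_square)
  have "x = 0"
  proof (rule ccontr)
    assume "x \<noteq> 0"
    hence "y = 0" using xy by simp
    hence "x\<^sup>2 = - (of_int k * N\<^sup>2)" using xy by simp
    moreover have "of_int k * N\<^sup>2 > 0" using k N by simp
    ultimately show False using zero_le_power2[of x] by linarith
  qed
  hence "(y/N)\<^sup>2 = of_int k" using xy N by (simp add: power_divide field_simps)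
  moreover have "y/N \<in> \<rat>" unfolding y_def N_def using rat by simp
  ultimately show False using no_rational_sqrt_3mod8[OF k(1)] by blast
qed

text \<open>The case in which the smaller regular extension is the constant \<open>a\<close> itself.\<close>
locale quad_self_extension = quad +
  fixes \<theta> :: "complex poly"
  assumes a0: "degree a = 0" and dth: "degree \<theta> = 0" and th: "\<theta>\<^sup>2 = 1 + 2*a*\<theta>"
   and cdef: "c = \<theta>\<^sup>2*b + 2*\<theta>" and sdef: "s = \<theta>*r" and tdef: "t = \<theta>*b + 1"
begin

text \<open>The inverse of \<open>\<theta>\<close>. When \<open>b\<close> and \<open>c\<close> change places, \<open>-\<phi>\<close> takes the role of \<open>\<theta>\<close>.\<close>
definition \<phi> where "\<phi> = \<theta> - 2*a"

definition p where "p = \<theta> - a"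

lemma theta: "\<theta> * \<phi> = 1" "\<theta> \<noteq> 0" "\<phi> \<noteq> 0" "p\<^sup>2 = a\<^sup>2+1" "2*a = \<theta> - \<phi>" "2*p = \<theta> + \<phi>"
  "degree \<phi> = 0" "degree p = 0"
proof -
  show *: "\<theta> * \<phi> = 1" unfolding \<phi>_def using th by algebra
  thus "\<theta> \<noteq> 0" "\<phi> \<noteq> 0" by auto
  show "p\<^sup>2 = a\<^sup>2+1" unfolding p_def using th by algebra
  show "2*a = \<theta> - \<phi>" "2*p = \<theta> + \<phi>" unfolding p_def \<phi>_def by algebra+
  show "degree \<phi> = 0" "degree p = 0" unfolding \<phi>_def p_def using a0 dth by (auto intro!: deg0_simps)
qed

text \<open>With \<open>\<theta> \<phi> = 1\<close> the parameters become constants modulo \<open>c\<close>: \<open>t\<close> is \<open>-1\<close> and \<open>b\<close> is \<open>-2\<phi>\<close>.\<close>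
lemma subst_mod: "t = c*\<phi> - 1" "b = c*\<phi>\<^sup>2 - 2*\<phi>" "r*s = \<phi>*s\<^sup>2"
proof -
  show "t = c*\<phi> - 1" unfolding tdef cdef using theta(1) by algebra
  show "b = c*\<phi>\<^sup>2 - 2*\<phi>" unfolding cdef using theta(1) by algebra
  show "r*s = \<phi>*s\<^sup>2" unfolding sdef using theta(1) by algebra
qed

lemma degree_relations: "degree c = degree b" "2 * degree r = degree b" "degree s = degree r" "degree t = degree b" "degree r > 0" "s \<noteq> 0" "r \<noteq> 0"
proof -
  have "degree (\<theta>\<^sup>2*b) = degree b" using dth theta(2) by (intro deg0_scale_eq deg0_simps) auto
  thus "degree c = degree b" unfolding cdef using dth deg(3) by (subst degree_add_eq_left) (auto simp: deg0_simps)
  thus r: "2 * degree r = degree b" "degree t = degree b" using root_degrees a0 by auto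
  show "degree s = degree r" unfolding sdef using dth theta(2) by (intro deg0_scale_eq)
  show "degree r > 0" using r deg(3) by simp
  thus "r \<noteq> 0" by auto
  thus "s \<noteq> 0" unfolding sdef using theta(2) by simp
qed

lemma small_extension_self: assumes "D1_regular a b c d0" "degree d0 < degree c" shows "d0 = a"
proof -
  let ?D = "a+b+c+2*a*b*c"
  have "D1_regular a b c a" unfolding D1_regular_def cdef using th by algebra
  hence "(d0 - ?D)\<^sup>2 = (a - ?D)\<^sup>2" using assms(1) unfolding D1_regular_iff by simp
  hence "(d0 - a) * (d0 - (2*?D - a)) = 0" by algebra
  moreover have "d0 \<noteq> 2*?D - a"
  proof
    assume e: "d0 = 2*?D - a"
    have "degree (2*a*b*c) = 2*degree b" using nz a0 degree_relations(1) by (simp add: degree_mult_eq mult.assoc)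
    moreover have "degree (a+b+c) < 2*degree b" using a0 degree_relations(1) deg(3) by (intro degree_add_less) auto
    ultimately have "degree ?D = 2*degree b" by (subst degree_add_eq_right) auto
    hence "degree (2*?D) = 2*degree b" by (simp only: degree_numeral_mult)
    hence "degree (2*?D + (-a)) = 2*degree b" using a0 deg(3) by (subst degree_add_eq_left) auto
    moreover have "2*?D + (-a) = d0" unfolding e by simp
    ultimately have "degree d0 = 2*degree b" by simp
    thus False using assms(2) degree_relations(1) by simp
  qed
  ultimately show ?thesis by auto
qed

text \<open>Since \<open>t\<close> is \<open>-1\<close> modulo \<open>c\<close>, this sign makes all members of the orbit congruent to 1.\<close>
definition unit_orbit where "unit_orbit N = (if even N then orbit_z t c 1 1 N else - orbit_z t c 1 1 N)"

lemma unit_orbit_mod: "c\<^sup>2 dvd 2*unit_orbit N - (2 + c*(-2*\<phi>*(of_int N)\<^sup>2 - 2*of_int N))"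
proof (cases "even N")
  case True
  have "c\<^sup>2 dvd 2*unit_orbit N - (2 + c*(b*(of_int N)\<^sup>2+2*of_int N*t))"
    using orbit_z_mod(1)[OF tt True, of 1 1] True by (simp add: unit_orbit_def)
  hence "c\<^sup>2 dvd (2*unit_orbit N - (2 + c*(b*(of_int N)\<^sup>2+2*of_int N*t))) + c\<^sup>2*(\<phi>\<^sup>2*(of_int N)\<^sup>2 + 2*of_int N*\<phi>)"
    by (rule dvd_add) simp
  moreover have "(2*unit_orbit N - (2 + c*(b*(of_int N)\<^sup>2+2*of_int N*t))) + c\<^sup>2*(\<phi>\<^sup>2*(of_int N)\<^sup>2 + 2*of_int N*\<phi>)
    = 2*unit_orbit N - (2 + c*(-2*\<phi>*(of_int N)\<^sup>2 - 2*of_int N))"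
    unfolding subst_mod(1,2) by algebra
  ultimately show ?thesis by (simp only:)
next
  case False
  have "c\<^sup>2 dvd 2*(- unit_orbit N) - (2*t + c*(b*t*((of_int N)\<^sup>2-1)+2*of_int N))"
    using orbit_z_mod(2)[OF tt False, of 1 1] False by (simp add: unit_orbit_def)
  hence "c\<^sup>2 dvd -(2*(- unit_orbit N) - (2*t + c*(b*t*((of_int N)\<^sup>2-1)+2*of_int N)))
     + c\<^sup>2*(-(c*\<phi>^3*((of_int N)\<^sup>2-1)) + 3*\<phi>\<^sup>2*((of_int N)\<^sup>2-1))"
    by (intro dvd_add iffD2[OF dvd_minus_iff]) simp_all
  moreover have "-(2*(- unit_orbit N) - (2*t + c*(b*t*((of_int N)\<^sup>2-1)+2*of_int N)))
     + c\<^sup>2*(-(c*\<phi>^3*((of_int N)\<^sup>2-1)) + 3*\<phi>\<^sup>2*((of_int N)\<^sup>2-1)) = 2*unit_orbit N - (2 + c*(-2*\<phi>*(of_int N)\<^sup>2 - 2*of_int N))"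
    unfolding subst_mod(1,2) by algebra
  ultimately show ?thesis by (simp only:)
qed

text \<open>The root \<open>s\<close> is nonconstant but smaller than \<open>c\<close>.\<close>
lemma const_eq:
  assumes "c dvd v*s + u" "degree u = 0" "degree v = 0"
  shows "u = 0" "v = 0"
proof -
  have "degree (v*s + u) < degree c" using assms degree_relations deg(3) by (intro degree_add_less deg0_scale_less) auto
  from small_multiple_zero[OF assms(1) this] have z: "0*s\<^sup>2 + v*s + u = 0" by simp
  have "degree s > 0" using degree_relations by simp
  from quadratic_zero(2,3)[OF _ assms(3,2) this z] show "u = 0" "v = 0" by simp_all
qed

lemma no_orbit_0_0:
  assumes w: "w\<^sup>2 = c*d+1" and "even M" "w = orbit_z s c 1 1 M" "w = unit_orbit N" shows False
proof -
  define m n :: "complex poly" where mn: "m = of_int M" "n = of_int N"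
  have A: "c\<^sup>2 dvd 2*w - (2 + c*(a*m\<^sup>2+2*m*s))" using orbit_z_mod(1)[OF ss assms(2), of 1 1] assms(3) mn by simp
  have B: "c\<^sup>2 dvd 2*w - (2 + c*(-2*\<phi>*n\<^sup>2 - 2*n))" using unit_orbit_mod[of N] assms(4) mn by simp
  from cong_quotient[OF A B nz(3)] have "c dvd (a*m\<^sup>2+2*m*s) - (-2*\<phi>*n\<^sup>2 - 2*n)" .
  moreover have "(a*m\<^sup>2+2*m*s) - (-2*\<phi>*n\<^sup>2 - 2*n) = (2*m)*s + (a*m\<^sup>2 + 2*\<phi>*n\<^sup>2 + 2*n)" by algebra
  ultimately have "c dvd (2*m)*s + (a*m\<^sup>2 + 2*\<phi>*n\<^sup>2 + 2*n)" by (simp only:)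
  from const_eq(2)[OF this] have "2*m = 0" using a0 theta(7) mn by (simp add: deg0_simps)
  hence "M = 0" using mn by simp
  thus False using assms(3) w nz by (simp add: orbit_z_def)
qed

lemma no_orbit_0_a:
  assumes "odd M" "even N" "w = orbit_z s c 1 1 M" "w = orbit_z t c s r N" shows False
proof -
  define m n :: "complex poly" where mn: "m = of_int M" "n = of_int N"
  have A: "c\<^sup>2 dvd 2*w - (2*s + c*(a*s*(m\<^sup>2-1)+2*m))" using orbit_z_mod(2)[OF ss assms(1), of 1 1] assms(3) mn by simp
  have B: "c\<^sup>2 dvd 2*w - (2*s + c*(b*s*n\<^sup>2+2*n*t*r))" using orbit_z_mod(1)[OF tt assms(2), of s r] assms(4) mn by simp
  from cong_quotient[OF A B nz(3)] have "c dvd (a*s*(m\<^sup>2-1)+2*m) - (b*s*n\<^sup>2+2*n*t*r)" .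
  hence "c dvd s*((a*s*(m\<^sup>2-1)+2*m) - (b*s*n\<^sup>2+2*n*t*r))" by simp
  moreover have "s*((a*s*(m\<^sup>2-1)+2*m) - (b*s*n\<^sup>2+2*n*t*r)) = ((2*m)*s + (a*(m\<^sup>2-1) + 2*\<phi>*n\<^sup>2 + 2*\<phi>*n))
     + c*(a*(a*(m\<^sup>2-1) + 2*\<phi>*n\<^sup>2 + 2*\<phi>*n) - s\<^sup>2*\<phi>\<^sup>2*n\<^sup>2 - 2*n*\<phi>\<^sup>2*s\<^sup>2)"
  proof -
    have "s*((a*s*(m\<^sup>2-1)+2*m) - (b*s*n\<^sup>2+2*n*t*r)) = 2*m*s + s\<^sup>2*(a*(m\<^sup>2-1) - b*n\<^sup>2) - 2*n*t*(r*s)" by algebra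
    also have "\<dots> = 2*m*s + s\<^sup>2*(a*(m\<^sup>2-1) + 2*\<phi>*n\<^sup>2 + 2*\<phi>*n) - c*s\<^sup>2*\<phi>\<^sup>2*n\<^sup>2 - c*2*n*\<phi>\<^sup>2*s\<^sup>2"
      unfolding subst_mod(3) unfolding subst_mod(1,2) by algebra
    finally show ?thesis using ss by algebra
  qed
  ultimately have "c dvd (2*m)*s + (a*(m\<^sup>2-1) + 2*\<phi>*n\<^sup>2 + 2*\<phi>*n)" by (metis dvd_add_left_iff dvd_triv_left)
  from const_eq(2)[OF this] have "2*m = 0" using a0 theta(7) mn by (simp add: deg0_simps)
  hence "M = 0" using mn by simp
  thus False using assms(1) by simp
qed

text \<open>No term linear in \<open>s\<close> occurs here, so the congruence yields only one equation between constants.\<close>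
lemma ident_a_0:
  assumes "odd M" "w = orbit_z s c s p M" "w = unit_orbit N"
  shows "\<theta>\<^sup>2*(of_int M+1)\<^sup>2 + 4*of_int N*\<theta> + 4*(of_int N)\<^sup>2 - (of_int M-1)\<^sup>2 = 0"
proof -
  define m n :: "complex poly" where mn: "m = of_int M" "n = of_int N"
  have A: "c\<^sup>2 dvd 2*w - (2*s*s + c*(a*s*s*(m\<^sup>2-1)+2*m*p))" using orbit_z_mod(2)[OF ss assms(1), of s p] assms(2) mn by (simp add: mult.assoc)
  have e: "2*s*s + c*(a*s*s*(m\<^sup>2-1)+2*m*p) = 2 + c*(2*a + a*s*s*(m\<^sup>2-1)+2*m*p)" using ss by algebra
  have B: "c\<^sup>2 dvd 2*w - (2 + c*(-2*\<phi>*n\<^sup>2 - 2*n))" using unit_orbit_mod[of N] assms(3) mn by simp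
  from cong_quotient[OF A[unfolded e] B nz(3)] have "c dvd (2*a + a*s*s*(m\<^sup>2-1)+2*m*p) - (-2*\<phi>*n\<^sup>2 - 2*n)" .
  moreover have "(2*a + a*s*s*(m\<^sup>2-1)+2*m*p) - (-2*\<phi>*n\<^sup>2 - 2*n)
    = (0*s + (a*(m\<^sup>2+1) + 2*m*p + 2*\<phi>*n\<^sup>2 + 2*n)) + c*(a\<^sup>2*(m\<^sup>2-1))" using ss by algebra
  ultimately have "c dvd 0*s + (a*(m\<^sup>2+1) + 2*m*p + 2*\<phi>*n\<^sup>2 + 2*n)" by (metis dvd_add_left_iff dvd_triv_left)
  from const_eq(1)[OF this] have z: "a*(m\<^sup>2+1) + 2*m*p + 2*\<phi>*n\<^sup>2 + 2*n = 0" using a0 theta(7,8) mn by (simp add: deg0_simps)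
  have "2*(\<theta>*(a*(m\<^sup>2+1) + 2*m*p + 2*\<phi>*n\<^sup>2 + 2*n)) = \<theta>*((2*a)*(m\<^sup>2+1) + 2*m*(2*p) + 4*\<phi>*n\<^sup>2 + 4*n)" by algebra
  also have "\<dots> = \<theta>\<^sup>2*(m+1)\<^sup>2 + 4*n*\<theta> + 4*n\<^sup>2 - (m-1)\<^sup>2" unfolding theta(5,6) using theta(1) by algebra
  finally show ?thesis unfolding z mult_zero_right by (simp only: mn)
qed

lemma ident_a_a:
  assumes "even M" "even N" "w = orbit_z s c s p M" "w = orbit_z t c s r N"
  shows "\<theta>\<^sup>2*((of_int M)\<^sup>2 + 2*of_int M) - ((of_int M)\<^sup>2 - 2*of_int M) + 4*((of_int N)\<^sup>2 + of_int N) = 0"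
proof -
  define m n :: "complex poly" where mn: "m = of_int M" "n = of_int N"
  have A: "c\<^sup>2 dvd 2*w - (2*s + c*(a*s*m\<^sup>2+2*m*s*p))" using orbit_z_mod(1)[OF ss assms(1), of s p] assms(3) mn by simp
  have B: "c\<^sup>2 dvd 2*w - (2*s + c*(b*s*n\<^sup>2+2*n*t*r))" using orbit_z_mod(1)[OF tt assms(2), of s r] assms(4) mn by simp
  from cong_quotient[OF A B nz(3)] have "c dvd (a*s*m\<^sup>2+2*m*s*p) - (b*s*n\<^sup>2+2*n*t*r)" .
  hence "c dvd s*((a*s*m\<^sup>2+2*m*s*p) - (b*s*n\<^sup>2+2*n*t*r))" by simp
  moreover have "s*((a*s*m\<^sup>2+2*m*s*p) - (b*s*n\<^sup>2+2*n*t*r)) = (0*s + (a*m\<^sup>2 + 2*m*p + 2*\<phi>*n\<^sup>2 + 2*\<phi>*n))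
     + c*(a*(a*m\<^sup>2 + 2*m*p + 2*\<phi>*n\<^sup>2 + 2*\<phi>*n) - s\<^sup>2*\<phi>\<^sup>2*n\<^sup>2 - 2*n*\<phi>\<^sup>2*s\<^sup>2)"
  proof -
    have "s*((a*s*m\<^sup>2+2*m*s*p) - (b*s*n\<^sup>2+2*n*t*r)) = s\<^sup>2*(a*m\<^sup>2 + 2*m*p - b*n\<^sup>2) - 2*n*t*(r*s)" by algebra
    also have "\<dots> = s\<^sup>2*(a*m\<^sup>2 + 2*m*p + 2*\<phi>*n\<^sup>2 + 2*\<phi>*n) - c*s\<^sup>2*\<phi>\<^sup>2*n\<^sup>2 - c*2*n*\<phi>\<^sup>2*s\<^sup>2"
      unfolding subst_mod(3) unfolding subst_mod(1,2) by algebra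
    finally show ?thesis using ss by algebra
  qed
  ultimately have "c dvd 0*s + (a*m\<^sup>2 + 2*m*p + 2*\<phi>*n\<^sup>2 + 2*\<phi>*n)" by (metis dvd_add_left_iff dvd_triv_left)
  from const_eq(1)[OF this] have z: "a*m\<^sup>2 + 2*m*p + 2*\<phi>*n\<^sup>2 + 2*\<phi>*n = 0" using a0 theta(7,8) mn by (simp add: deg0_simps)
  have "2*(\<theta>*(a*m\<^sup>2 + 2*m*p + 2*\<phi>*n\<^sup>2 + 2*\<phi>*n)) = \<theta>*((2*a)*m\<^sup>2 + 2*m*(2*p) + 4*\<phi>*n\<^sup>2 + 4*\<phi>*n)" by algebra
  also have "\<dots> = \<theta>\<^sup>2*(m\<^sup>2 + 2*m) - (m\<^sup>2 - 2*m) + 4*(n\<^sup>2 + n)" unfolding theta(5,6) using theta(1) by algebra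
  finally show ?thesis unfolding z mult_zero_right by (simp only: mn)
qed

lemma degree_a_orbit: "degree (orbit_z s c s p M) = nat (\<bar>M\<bar> + 1) * degree r"
proof -
  have pa: "s*s + c*p = \<theta>*c + 1" "s*s - c*p = -(\<phi>*c) + 1"
  proof -
    have "s*s + c*p = c*(a+p) + 1" "s*s - c*p = c*(a-p) + 1" using ss by algebra+
    moreover have "a + p = \<theta>" "a - p = -\<phi>" by (simp_all add: p_def \<phi>_def)
    ultimately show "s*s + c*p = \<theta>*c + 1" "s*s - c*p = -(\<phi>*c) + 1" by simp_all
  qed
  have "degree (\<theta>*c) = degree c" "degree (-(\<phi>*c)) = degree c"
    using deg0_scale_eq(1)[OF dth theta(2), of c] deg0_scale_eq(1)[OF theta(7,3), of c] by simp_all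
  hence d: "degree (s*s + c*p) = 2*degree r" "degree (s*s - c*p) = 2*degree r"
    unfolding pa using degree_relations deg(3) degree_add_eq_left[of 1 "\<theta>*c"] degree_add_eq_left[of 1 "-(\<phi>*c)"] by simp_all
  hence n: "s*s + c*p \<noteq> 0" "s*s - c*p \<noteq> 0" using degree_relations(5) by auto
  consider "M = 0" | "M \<ge> 1" | "M \<le> -1" by linarith
  thus ?thesis
  proof cases
    case 1 thus ?thesis using degree_relations by (simp add: orbit_z_def)
  next
    case 2
    have "degree (orbit_z s c s p M) = 2*degree r + nat (M-1) * degree s"
      using orbit_z_degree_pos[OF ss _ _ n(1) 2] d degree_relations by simp
    moreover have "nat (\<bar>M\<bar>+1) = 2 + nat (M-1)" using 2 by simp
    ultimately show ?thesis using degree_relations by (simp add: algebra_simps)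
  next
    case 3
    have "degree (orbit_z s c s p M) = 2*degree r + nat (-M-1) * degree s"
      using orbit_z_degree_neg[OF ss _ _ n(2) 3] d degree_relations by simp
    moreover have "nat (\<bar>M\<bar>+1) = 2 + nat (-M-1)" using 3 by simp
    ultimately show ?thesis using degree_relations by (simp add: algebra_simps)
  qed
qed

lemma degree_unit_orbit: "degree (unit_orbit N) = nat (2*\<bar>N\<bar>) * degree r"
proof -
  have th1: "\<theta> + 1 \<noteq> 0" "1 - \<theta> \<noteq> 0"
  proof -
    have "\<theta>\<^sup>2 \<noteq> 1" using th theta(2) nz(1) by auto
    thus "\<theta> + 1 \<noteq> 0" "1 - \<theta> \<noteq> 0" by (auto simp: eq_neg_iff_add_eq_0[symmetric])
  qed
  have e: "t*1 + c*1 = (\<theta>*(\<theta>+1))*b + (2*\<theta>+1)" "t*1 - c*1 = (\<theta>*(1-\<theta>))*b + (1-2*\<theta>)"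
    unfolding tdef cdef by algebra+
  have d0: "degree (\<theta>*(\<theta>+1)) = 0" "degree (\<theta>*(1-\<theta>)) = 0" "degree (2*\<theta>+1) = 0" "degree (1-2*\<theta>) = 0"
    using dth by (auto intro!: deg0_simps)
  have "degree (t*1 + c*1) = degree b"
    unfolding e using deg0_scale_eq(1)[OF d0(1), of b] theta(2) th1 d0 deg(3) by (subst degree_add_eq_left) auto
  moreover have "degree (t*1 - c*1) = degree b"
    unfolding e using deg0_scale_eq(1)[OF d0(2), of b] theta(2) th1 d0 deg(3) by (subst degree_add_eq_left) auto
  ultimately have d: "degree (t*1 + c*1) = 2*degree r" "degree (t*1 - c*1) = 2*degree r" using degree_relations by simp_all
  hence n: "t*1 + c*1 \<noteq> 0" "t*1 - c*1 \<noteq> 0" using degree_relations(5) by (metis degree_0 mult_is_0 less_irrefl zero_neq_numeral)+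
  have "degree (unit_orbit N) = degree (orbit_z t c 1 1 N)" by (simp add: unit_orbit_def)
  also have "\<dots> = nat (2*\<bar>N\<bar>) * degree r"
  proof -
    consider "N = 0" | "N \<ge> 1" | "N \<le> -1" by linarith
    thus ?thesis
    proof cases
      case 1 thus ?thesis by (simp add: orbit_z_def)
    next
      case 2
      have "degree (orbit_z t c 1 1 N) = 2*degree r + nat (N-1) * degree t"
        using orbit_z_degree_pos[OF tt _ _ n(1) 2] d degree_relations deg(3) by simp
      moreover have "nat (2*\<bar>N\<bar>) = 2 + 2*nat (N-1)" using 2 by simp
      ultimately show ?thesis using degree_relations(2,4) by (simp add: algebra_simps)
    next
      case 3
      have "degree (orbit_z t c 1 1 N) = 2*degree r + nat (-N-1) * degree t"
        using orbit_z_degree_neg[OF tt _ _ n(2) 3] d degree_relations deg(3) by simp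
      moreover have "nat (2*\<bar>N\<bar>) = 2 + 2*nat (-N-1)" using 3 by simp
      ultimately show ?thesis using degree_relations(2,4) by (simp add: algebra_simps)
    qed
  qed
  finally show ?thesis .
qed

lemma degree_sr_orbit: "degree (orbit_z t c s r N) = nat (if N \<ge> 0 then 2*N+1 else -2*N-1) * degree r"
proof -
  have e: "t*s + c*r = r*((2*\<theta>\<^sup>2)*b + 3*\<theta>)" "t*s - c*r = r*(-\<theta>)"
    unfolding tdef cdef sdef by algebra+
  have d0: "degree (2*\<theta>\<^sup>2) = 0" "degree (3*\<theta>) = 0" using dth by (auto intro!: deg0_simps)
  have "degree ((2*\<theta>\<^sup>2)*b + 3*\<theta>) = degree b"
    using deg0_scale_eq(1)[OF d0(1), of b] theta(2) d0 deg(3) by (subst degree_add_eq_left) auto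
  moreover from this have "(2*\<theta>\<^sup>2)*b + 3*\<theta> \<noteq> 0" using deg(3) by auto
  ultimately have d: "degree (t*s + c*r) = 3*degree r" unfolding e using degree_relations by (simp add: degree_mult_eq)
  have d': "degree (t*s - c*r) = degree r" unfolding e using dth theta(2) degree_relations by (simp add: degree_mult_eq)
  have n: "t*s + c*r \<noteq> 0" "t*s - c*r \<noteq> 0" using d d' degree_relations(5) by auto
  consider "N = 0" | "N \<ge> 1" | "N \<le> -1" by linarith
  thus ?thesis
  proof cases
    case 1 thus ?thesis using degree_relations by (simp add: orbit_z_def)
  next
    case 2
    have "degree (orbit_z t c s r N) = 3*degree r + nat (N-1) * degree t"
      using orbit_z_degree_pos[OF tt _ _ n(1) 2] d degree_relations deg(3) by simp
    moreover have "nat (2*N+1) = 3 + 2*nat (N-1)" using 2 by simp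
    ultimately show ?thesis using degree_relations(2,4) 2 by (simp add: algebra_simps)
  next
    case 3
    have "degree (orbit_z t c s r N) = degree r + nat (-N-1) * degree t"
      using orbit_z_degree_neg[OF tt _ _ n(2) 3] d' degree_relations deg(3) by simp
    moreover have "nat (-2*N-1) = 1 + 2*nat (-N-1)" using 3 by simp
    ultimately show ?thesis using degree_relations(2,4) 3 by (simp add: algebra_simps)
  qed
qed

text \<open>The quotient of the leading coefficients of \<open>s\<close> and \<open>r\<close> is \<open>\<theta>\<close>, so \<open>\<theta>\<close> lies in \<open>\<rat>(\<i>)\<close>. The
  discriminant \<open>n\<^sup>2(5 - 8n)\<close> of the equation would have to be a square there.\<close>
lemma theta_no_root:
  assumes n: "n \<ge> 1" "\<bar>N\<bar> = n" and eq: "(of_int n)\<^sup>2*\<theta>\<^sup>2 + of_int N*\<theta> + (2*of_int n - 1) = 0"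
  shows False
proof -
  define u where "u = lead_coeff r"
  define v where "v = lead_coeff s"
  obtain h where h: "\<theta> = [:h:]" using dth degree_eq_zeroE by blast
  have v: "v = h * u" unfolding v_def u_def sdef h by (simp add: lead_coeff_mult)
  have gr: "u \<in> gauss_rats" "v \<in> gauss_rats" using gp unfolding u_def v_def gauss_rat_polys_def by auto
  have u0: "u \<noteq> 0" unfolding u_def using degree_relations by simp
  have "[:of_int (n\<^sup>2) * h\<^sup>2 + of_int N * h + of_int (2*n-1):] = 0"
    using eq unfolding h by (simp add: of_int_poly power2_eq_square one_pCons numeral_poly algebra_simps)
  hence "of_int (n\<^sup>2) * h\<^sup>2 + of_int N * h + of_int (2*n-1) = 0" by simp
  hence e1: "(of_int n)\<^sup>2 * h\<^sup>2 + of_int N * h + (2*of_int n - 1) = 0" by simp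
  have NN: "(of_int N :: complex)\<^sup>2 = (of_int n)\<^sup>2" using n(2) by (metis of_int_power power2_abs)
  define w where "w = 2*(of_int n)\<^sup>2*v + of_int N*u"
  have oi: "of_int k \<in> gauss_rats" for k by (intro gauss_rats_Rats) simp
  have "of_int (2*n\<^sup>2) * v + of_int N*u \<in> gauss_rats" using gr oi by (intro gauss_rats_closed)
  hence w: "w \<in> gauss_rats" unfolding w_def by simp
  have nu: "of_int n * u \<in> gauss_rats" "of_int n * u \<noteq> 0" using gr u0 n oi by (auto intro!: gauss_rats_closed)
  \<comment> \<open>The discriminant of the quadratic equation for \<open>\<theta> = v/u\<close> is \<open>n\<^sup>2(5 - 8n)\<close>, and \<open>w\<close> is \<open>u\<close> times
    the derivative of the quadratic at \<open>\<theta>\<close>.\<close>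
  have "w\<^sup>2 = - (8*of_int n - 5)*(of_int n * u)\<^sup>2"
  proof -
    have "w\<^sup>2 = u\<^sup>2*(4*(of_int n)\<^sup>2*((of_int n)\<^sup>2 * h\<^sup>2 + of_int N * h) + (of_int N)\<^sup>2)" unfolding w_def v by algebra
    also have "(of_int n)\<^sup>2 * h\<^sup>2 + of_int N * h = -(2*of_int n - 1)" using e1 by algebra
    finally show ?thesis unfolding NN by algebra
  qed
  hence "w\<^sup>2 = - of_int (8*n-5) * (of_int n * u)\<^sup>2" by simp
  moreover have "(8*n-5) mod 8 = 3" "8*n-5 > 0" using n by presburger+
  ultimately show False using gauss_rats_no_sqrt[OF _ _ nu(1) w nu(2)] by blast
qed

lemma regular_orbit: assumes "w\<^sup>2 = c*d+1" "w = orbit_z t c s r (-2)" shows "D1_regular a b c d"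
proof -
  have "cheb_T t (-2) = 2*t\<^sup>2-1" "cheb_U t (-2) = -(2*t)" using cheb_Suc[of t 1] cheb_neg[of t 2] by (simp_all add: power2_eq_square algebra_simps)
  hence w: "w = (2*t\<^sup>2-1)*s + c*(-(2*t))*r" using assms(2) by (simp add: orbit_z_def)
  have "c*r + s*t = -((2*t\<^sup>2-1)*s + c*(-(2*t))*r)" unfolding tdef cdef sdef by algebra
  hence "w\<^sup>2 = (c*r+s*t)\<^sup>2" unfolding w by (simp only: power2_minus)
  thus ?thesis using assms(1) by (intro regular_from_root) auto
qed

text \<open>Degrees determine \<open>\<bar>M\<bar>\<close> by \<open>\<bar>N\<bar>\<close>. One sign of \<open>M\<close> is excluded by \<open>theta_no_root\<close>; for the other one the
  equation is linear in \<open>\<theta>\<close>, with solution \<open>(n-1)\<^sup>2 \<theta> = -N\<close>.\<close>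
lemma outcome_odd:
  assumes "odd M" "w = orbit_z s c s p M" "w = unit_orbit N"
  shows "\<exists>n\<ge>1. degree w = nat (2*n) * degree r \<and> (((of_int n - 1)\<^sup>2*\<theta>)\<^sup>2 = (of_int n)\<^sup>2)"
proof -
  have "nat (\<bar>M\<bar>+1) * degree r = nat (2*\<bar>N\<bar>) * degree r" using degree_a_orbit degree_unit_orbit assms by metis
  hence MN: "\<bar>M\<bar> + 1 = 2*\<bar>N\<bar>" using degree_relations(5) by auto
  define n where "n = \<bar>N\<bar>"
  have n: "n \<ge> 1" "\<bar>N\<bar> = n" "\<bar>M\<bar> = 2*n - 1" using MN n_def by auto
  have NN: "(of_int N :: complex poly)\<^sup>2 = (of_int n)\<^sup>2" using n(2) by (metis of_int_power power2_abs)
  note eq = ident_a_0[OF assms]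
  have "M = 1 - 2*n"
  proof (rule ccontr)
    assume "M \<noteq> 1 - 2*n"
    hence "M = 2*n - 1" using n(3) by linarith
    hence "(of_int M :: complex poly) = 2*of_int n - 1" by simp
    hence "4*((of_int n)\<^sup>2*\<theta>\<^sup>2 + of_int N*\<theta> + (2*of_int n - 1)) = 0" using eq unfolding NN by algebra
    hence "(of_int n)\<^sup>2*\<theta>\<^sup>2 + of_int N*\<theta> + (2*of_int n - 1) = 0" unfolding mult_eq_0_iff by simp
    thus False using theta_no_root n by blast
  qed
  hence "(of_int M :: complex poly) = 1 - 2*of_int n" by simp
  hence "4*(\<theta>*((of_int n - 1)\<^sup>2*\<theta> + of_int N)) = 0" using eq unfolding NN by algebra
  hence "(of_int n - 1)\<^sup>2*\<theta> + of_int N = 0" unfolding mult_eq_0_iff using theta(2) by simp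
  hence "((of_int n - 1)\<^sup>2*\<theta>)\<^sup>2 = (of_int N)\<^sup>2" by algebra
  moreover have "degree w = nat (2*n) * degree r" unfolding assms(3) n_def by (rule degree_unit_orbit)
  ultimately show ?thesis using n NN by auto
qed

text \<open>Again degrees determine \<open>\<bar>M\<bar>\<close>. The regular extension is met at \<open>N = -2\<close>.\<close>
lemma outcome_even:
  assumes w: "w\<^sup>2 = c*d+1" and "even M" "even N" "w = orbit_z s c s p M" "w = orbit_z t c s r N"
  shows "D1_regular a b c d \<or> (\<exists>n\<ge>2. degree w = nat (2*n+1) * degree r \<and> \<theta>\<^sup>2*(of_int n+1) = -2)"
proof -
  define n where "n = (if N \<ge> 0 then N else -1-N)"
  have n0: "n \<ge> 0" unfolding n_def by auto
  have dw: "degree w = nat (2*n+1) * degree r" using degree_sr_orbit[of N] assms(5) unfolding n_def by (auto split: if_splits)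
  hence "nat (\<bar>M\<bar>+1) * degree r = nat (2*n+1) * degree r" using degree_a_orbit[of M] assms(4) by metis
  hence M: "\<bar>M\<bar> = 2*n" using degree_relations(5) n0 by auto
  have N2: "(of_int N :: complex poly)\<^sup>2 + of_int N = (of_int n)\<^sup>2 + of_int n"
    unfolding n_def by (auto simp: power2_eq_square algebra_simps)
  note eq = ident_a_a[OF assms(2-5), unfolded N2]
  have "N \<noteq> 0"
  proof
    assume "N = 0"
    hence "w = s" using assms(5) by (simp add: orbit_z_def)
    hence "c * d + 1 = a * c + 1" using w ss by metis
    hence "c * (d - a) = 0" by algebra
    thus False using nz by simp
  qed
  hence n1: "n \<ge> 1" using assms(3) unfolding n_def by (auto split: if_splits; presburger)
  show ?thesis
  proof (cases "N = -2")
    case True thus ?thesis using regular_orbit[OF w] assms(5) by simp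
  next
    case False
    hence n2: "n \<ge> 2" using assms(3) n1 \<open>N \<noteq> 0\<close> unfolding n_def by (auto split: if_splits; presburger)
    have "M = 2*n"
    proof (rule ccontr)
      assume "M \<noteq> 2*n"
      hence "M = -2*n" using M by linarith
      hence "(of_int M :: complex poly) = -2*of_int n" by simp
      hence "4*(\<theta>\<^sup>2*((of_int n)*(of_int n-1))) = 0" using eq by algebra
      hence "(of_int n :: complex poly)*(of_int n-1) = 0" unfolding mult_eq_0_iff using theta(2) by simp
      hence "(of_int (n*(n-1)) :: complex poly) = 0" by simp
      thus False using n2 unfolding of_int_eq_0_iff by simp
    qed
    hence "(of_int M :: complex poly) = 2*of_int n" by simp
    hence "4*(of_int n*(\<theta>\<^sup>2*(of_int n+1) + 2)) = 0" using eq by algebra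
    hence "\<theta>\<^sup>2*(of_int n+1) + 2 = 0" unfolding mult_eq_0_iff using n2 by simp
    hence "\<theta>\<^sup>2*(of_int n+1) = -2" by (simp add: eq_neg_iff_add_eq_0)
    thus ?thesis using dw n2 by blast
  qed
qed

text \<open>The congruence modulo \<open>c\<close> leaves two irregular possibilities, with a special constant \<open>\<theta>\<close> each. The degree of \<open>z\<close>
  identifies \<open>n\<close>, and its parity the possibility.\<close>
lemma orbit_outcomes:
  "D1_regular a b c d
   \<or> (\<exists>n\<ge>1. degree z = nat (2*n) * degree r \<and> ((of_int n - 1)\<^sup>2*\<theta>)\<^sup>2 = (of_int n)\<^sup>2)
   \<or> (\<exists>n\<ge>2. degree z = nat (2*n+1) * degree r \<and> \<theta>\<^sup>2*(of_int n+1) = -2)"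
  (is "?R \<or> ?O \<or> ?E")
proof -
  have cpos: "degree c > 0" using degree_relations(1) deg(3) by simp
  have ds: "degree s < degree c" "degree s > 0" using degree_relations deg(3) by linarith+
  obtain M z0 x0 d0 N z1 y1 d1 where
    A: "z = orbit_z s c z0 x0 M" "z0\<^sup>2 = c*d0+1" "x0\<^sup>2 = a*d0+1"
    "(even M \<and> degree z0 < degree c \<and> c dvd z - z0)
     \<or> (odd M \<and> c dvd z - s * z0 \<and> degree d0 = 0 \<and> (d0 = 0 \<or> d0 = a \<and> degree a = 0))" and
    B: "z = orbit_z t c z1 y1 N" "z1\<^sup>2 = c*d1+1" "y1\<^sup>2 = b*d1+1"
    "(even N \<and> degree z1 < degree c \<and> c dvd z - z1)
     \<or> (odd N \<and> c dvd z - t * z1 \<and> d1 = 0)" and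
    EE: "even M \<Longrightarrow> even N \<Longrightarrow> z0 = z1 \<and> d0 = d1 \<and> (d0 = 0 \<or> d0 = a \<and> degree a = 0 \<or> D1_regular a b c d0)" and
    d01: "degree d0 < degree c" "degree d1 < degree c"
    by (rule descents) (rule that, assumption+)
  have wz: "(\<sigma>*z)\<^sup>2 = c*d+1" "degree (\<sigma>*z) = degree z" if "\<sigma> = 1 \<or> \<sigma> = -1" for \<sigma>
    using sign_sq[OF that] sign_deg[OF that] zz by simp_all
  have t_m: "c dvd z + z1" if "c dvd z - t*z1"
  proof -
    have "c dvd (z - t*z1) + c*(\<phi>*z1)" using that by (intro dvd_add) auto
    moreover have "(z - t*z1) + c*(\<phi>*z1) = z + z1" unfolding subst_mod(1) by algebra
    ultimately show ?thesis by simp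
  qed
  have ss1: "c dvd z - \<sigma>" if "c dvd z - s*(\<sigma>*s)" for \<sigma>
  proof -
    have "c dvd (z - s*(\<sigma>*s)) + c*(a*\<sigma>)" using that by (intro dvd_add) auto
    moreover have "(z - s*(\<sigma>*s)) + c*(a*\<sigma>) = z - \<sigma>" using ss by algebra
    ultimately show ?thesis by simp
  qed
  have root_s: "d' = a \<and> x'\<^sup>2 = f*a+1" if "z' = \<sigma>*s" "\<sigma> = 1 \<or> \<sigma> = -1" "z'\<^sup>2 = c*d'+1" "x'\<^sup>2 = f*d'+1" for z' \<sigma> d' x' f
  proof -
    have "c*d'+1 = a*c+1" using that(1-3) sign_sq ss by metis
    hence "c*(d'-a) = 0" by algebra
    thus ?thesis using nz that(4) by simp
  qed
  have root_1: "d' = 0 \<and> x'\<^sup>2 = 1\<^sup>2" if "z' = \<sigma>*1" "\<sigma> = 1 \<or> \<sigma> = -1" "z'\<^sup>2 = c*d'+1" "x'\<^sup>2 = f*d'+1" for z' \<sigma> d' x' f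
  proof -
    have "z'\<^sup>2 = 1" using that(1,2) by auto
    hence "d' = 0" using that(3) nz by simp
    thus ?thesis using that(4) by simp
  qed
  have d0z: "z0\<^sup>2 = 1\<^sup>2 \<and> x0\<^sup>2 = 1\<^sup>2" if "d0 = 0" using A(2,3) that by simp
  have d1z: "z1\<^sup>2 = 1\<^sup>2 \<and> y1\<^sup>2 = 1\<^sup>2" if "d1 = 0" using B(2,3) that by simp
  have d0a: "z0\<^sup>2 = s\<^sup>2 \<and> x0\<^sup>2 = p\<^sup>2" if "d0 = a"
    using A(2,3) that ss theta(4) by (simp add: mult.commute power2_eq_square)
  have sgn_ds: "degree (\<sigma>*s) < degree c" "degree (\<sigma>::complex poly) < degree c" if "\<sigma> = 1 \<or> \<sigma> = -1" for \<sigma>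
    using that ds by auto
  show ?thesis
  proof (cases "even N")
    case odd: False
    hence d1: "d1 = 0" "c dvd z + z1" using B(4) t_m by auto
    obtain \<sigma> where sg: "\<sigma> = 1 \<or> \<sigma> = -1" "z1 = \<sigma>*1" using sign_cases d1z[OF d1(1)] by blast
    have ms: "-\<sigma> = 1 \<or> -\<sigma> = -1" using sg by auto
    obtain N' where N': "even N' = even N" "\<sigma>*z = orbit_z t c 1 1 N'"
      using orbit_start_fixed_sign[OF B(1) conjunct2[OF d1z[OF d1(1)]] sg(2,1) one_neq_zero] by blast
    hence wN: "(-\<sigma>)*z = unit_orbit N'" using odd by (simp add: unit_orbit_def)
    have dv: "c dvd z - (-\<sigma>)" using d1(2) sg(2) by simp
    show ?thesis
    proof (cases "even M")
      case True
      hence "z0 = -\<sigma>" using A(4) by (intro cong_eq[OF _ dv _ sgn_ds(2)[OF ms]]) auto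
      hence z0: "z0 = (-\<sigma>)*1" by simp
      obtain M' where M': "even M' = even M" "(-\<sigma>)*z = orbit_z s c 1 1 M'"
        using orbit_start_fixed_sign[OF A(1) conjunct2[OF root_1[OF z0 ms A(2,3)]] z0 ms one_neq_zero] by blast
      have "even M'" using M' True by simp
      from no_orbit_0_0[OF wz(1)[OF ms] this M'(2) wN] show ?thesis ..
    next
      case False
      hence c0: "c dvd z - s*z0" "d0 = 0 \<or> d0 = a \<and> degree a = 0" using A(4) by auto
      from c0(2) show ?thesis
      proof
        assume "d0 = 0"
        obtain \<tau> where tau: "\<tau> = 1 \<or> \<tau> = -1" "z0 = \<tau>*1" using sign_cases d0z[OF \<open>d0=0\<close>] by blast
        have "c dvd z - \<tau>*s" using c0(1) tau(2) by (simp add: mult.commute)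
        hence "\<tau>*s = -\<sigma>" by (rule cong_eq[OF _ dv sgn_ds(1)[OF tau(1)] sgn_ds(2)[OF ms]])
        hence "degree s = degree (-\<sigma>)" using sign_deg[OF tau(1)] by metis
        moreover have "degree (-\<sigma>) = 0" using sg(1) by auto
        ultimately show ?thesis using ds by simp
      next
        assume d0: "d0 = a \<and> degree a = 0"
        obtain \<tau> where tau: "\<tau> = 1 \<or> \<tau> = -1" "z0 = \<tau>*s" using sign_cases d0a d0 by blast
        have "c dvd z - \<tau>" using c0(1) unfolding tau(2) by (rule ss1)
        hence "\<tau> = -\<sigma>" by (rule cong_eq[OF _ dv sgn_ds(2)[OF tau(1)] sgn_ds(2)[OF ms]])
        hence z0: "z0 = (-\<sigma>)*s" using tau(2) by simp
        obtain M' where M': "even M' = even M" "(-\<sigma>)*z = orbit_z s c s p M'"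
          using orbit_start_fixed_sign[OF A(1) conjunct2[OF d0a[OF conjunct1[OF d0]]] z0 ms degree_relations(6)] by blast
        have "odd M'" using M' False by simp
        from outcome_odd[OF this M'(2) wN] have ?O unfolding wz(2)[OF ms] .
        thus ?thesis by blast
      qed
    qed
  next
    case even: True
    hence z1: "c dvd z - z1" "degree z1 < degree c" using B(4) by auto
    show ?thesis
    proof (cases "even M")
      case True
      hence z: "z0 = z1" "d0 = d1" and d0: "d0 = 0 \<or> d0 = a \<and> degree a = 0 \<or> D1_regular a b c d0" using EE even by auto
      have "d0 = 0 \<or> d0 = a" using d0 small_extension_self d01 by blast
      thus ?thesis
      proof
        assume "d0 = 0"
        obtain \<tau> where tau: "\<tau> = 1 \<or> \<tau> = -1" "z0 = \<tau>*1" using sign_cases d0z[OF \<open>d0=0\<close>] by blast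
        have d1: "d1 = 0" "z1 = \<tau>*1" using z \<open>d0 = 0\<close> tau by auto
        obtain M' where M': "even M' = even M" "\<tau>*z = orbit_z s c 1 1 M'"
          using orbit_start_fixed_sign[OF A(1) conjunct2[OF d0z[OF \<open>d0 = 0\<close>]] tau(2,1) one_neq_zero] by blast
        obtain N' where N': "even N' = even N" "\<tau>*z = orbit_z t c 1 1 N'"
          using orbit_start_fixed_sign[OF B(1) conjunct2[OF d1z[OF d1(1)]] d1(2) tau(1) one_neq_zero] by blast
        have "even M'" "\<tau>*z = unit_orbit N'" using M' N' True even by (auto simp: unit_orbit_def)
        from no_orbit_0_0[OF wz(1)[OF tau(1)] this(1) M'(2) this(2)] show ?thesis ..
      next
        assume d0: "d0 = a"
        obtain \<tau> where tau: "\<tau> = 1 \<or> \<tau> = -1" "z0 = \<tau>*s" using sign_cases d0a d0 by blast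
        have d1: "d1 = a" "z1 = \<tau>*s" using z d0 tau by auto
        have y1: "y1\<^sup>2 = r\<^sup>2" using B(3) d1 rr by (simp add: mult.commute)
        obtain M' where M': "even M' = even M" "\<tau>*z = orbit_z s c s p M'"
          using orbit_start_fixed_sign[OF A(1) conjunct2[OF d0a[OF d0]] tau(2,1) degree_relations(6)] by blast
        obtain N' where N': "even N' = even N" "\<tau>*z = orbit_z t c s r N'"
          using orbit_start_fixed_sign[OF B(1) y1 d1(2) tau(1) degree_relations(6)] by blast
        have "even M'" "even N'" using M' N' True even by auto
        from outcome_even[OF wz(1)[OF tau(1)] this M'(2) N'(2)]
        have "?R \<or> ?E" unfolding wz(2)[OF tau(1)] .
        thus ?thesis by blast
      qed
    next
      case False
      hence c0: "c dvd z - s*z0" "d0 = 0 \<or> d0 = a \<and> degree a = 0" using A(4) by auto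
      from c0(2) show ?thesis
      proof
        assume "d0 = 0"
        obtain \<tau> where tau: "\<tau> = 1 \<or> \<tau> = -1" "z0 = \<tau>*1" using sign_cases d0z[OF \<open>d0=0\<close>] by blast
        have "c dvd z - \<tau>*s" using c0(1) tau(2) by (simp add: mult.commute)
        hence z1s: "z1 = \<tau>*s" by (rule cong_eq[OF z1(1) _ z1(2) sgn_ds(1)[OF tau(1)]])
        from root_s[OF this tau(1) B(2,3)] rr have y1: "y1\<^sup>2 = r\<^sup>2" by (simp add: mult.commute)
        obtain M' where M': "even M' = even M" "\<tau>*z = orbit_z s c 1 1 M'"
          using orbit_start_fixed_sign[OF A(1) conjunct2[OF d0z[OF \<open>d0 = 0\<close>]] tau(2,1) one_neq_zero] by blast
        obtain N' where N': "even N' = even N" "\<tau>*z = orbit_z t c s r N'"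
          using orbit_start_fixed_sign[OF B(1) y1 z1s tau(1) degree_relations(6)] by blast
        have "odd M'" "even N'" using M' N' False even by auto
        from no_orbit_0_a[OF this M'(2) N'(2)] show ?thesis ..
      next
        assume d0: "d0 = a \<and> degree a = 0"
        obtain \<tau> where tau: "\<tau> = 1 \<or> \<tau> = -1" "z0 = \<tau>*s" using sign_cases d0a d0 by blast
        have "c dvd z - \<tau>" using c0(1) unfolding tau(2) by (rule ss1)
        hence z1t: "z1 = \<tau>*1" using cong_eq[OF z1(1) _ z1(2) sgn_ds(2)[OF tau(1)]] by simp
        obtain M' where M': "even M' = even M" "\<tau>*z = orbit_z s c s p M'"
          using orbit_start_fixed_sign[OF A(1) conjunct2[OF d0a[OF conjunct1[OF d0]]] tau(2,1) degree_relations(6)] by blast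
        obtain N' where N': "even N' = even N" "\<tau>*z = orbit_z t c 1 1 N'"
          using orbit_start_fixed_sign[OF B(1) conjunct2[OF root_1[OF z1t tau(1) B(2,3)]] z1t tau(1) one_neq_zero] by blast
        have "odd M'" "\<tau>*z = unit_orbit N'" using M' N' False even by (auto simp: unit_orbit_def)
        from outcome_odd[OF this(1) M'(2) this(2)] have ?O unfolding wz(2)[OF tau(1)] .
        thus ?thesis by blast
      qed
    qed
  qed
qed

text \<open>The configuration is symmetric in \<open>b\<close> and \<open>c\<close>, up to replacing \<open>\<theta>\<close> by \<open>-\<phi>\<close>, and \<open>y\<close> has the degree of
  \<open>z\<close>. So \<open>\<theta>\<close> and \<open>-\<phi>\<close> satisfy the same condition with the same \<open>n\<close>. As \<open>\<theta>\<phi> = 1\<close>, multiplying the two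
  conditions leaves \<open>(n-1)\<^sup>8 = n\<^sup>4\<close> or \<open>(n+1)\<^sup>2 = 4\<close>.\<close>
lemma regular: "D1_regular a b c d"
proof (rule ccontr)
  assume nr: "\<not> D1_regular a b c d"
  have D1_regular_swap: "D1_regular a c b e \<longleftrightarrow> D1_regular a b c e" for e unfolding D1_regular_def by (rule iffI; algebra)
  interpret S: quad_self_extension a c b d s "-r" "-t" x z y "-\<phi>"
  proof
    show "(- r)\<^sup>2 = a*b+1" "s\<^sup>2 = a*c+1" "(-t)\<^sup>2 = c*b+1" using rr ss tt by (simp_all add: mult.commute)
    show "degree a \<le> degree c" "degree c \<le> degree b" "0 < degree c" using degree_relations(1) deg by auto
    show "-r \<in> gauss_rat_polys" "-t \<in> gauss_rat_polys" using gp gauss_polys_closed(4) by auto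
    show "d0 = 0 \<or> d0 = a \<or> D1_regular a c b d0"
      if "d0 \<in> gauss_rat_polys" "x0 \<in> gauss_rat_polys" "y0 \<in> gauss_rat_polys" "z0 \<in> gauss_rat_polys"
        "x0\<^sup>2 = a*d0+1" "y0\<^sup>2 = c*d0+1" "z0\<^sup>2 = b*d0+1" "degree d0 < degree b" for d0 x0 y0 z0
      using IH[OF that(1,2,4,3,5,7,6)] that(8) degree_relations(1) D1_regular_swap by simp
    show "degree (-\<phi>) = 0" using theta(7) by simp
    show "(-\<phi>)\<^sup>2 = 1 + 2*a*(-\<phi>)" unfolding \<phi>_def using th by algebra
    show "b = (-\<phi>)\<^sup>2*c + 2*(-\<phi>)" using subst_mod(2) by (simp add: mult.commute)
    show "-r = (-\<phi>)*s" unfolding sdef using theta(1) by algebra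
    show "-t = (-\<phi>)*c + 1" unfolding subst_mod(1) by algebra
  qed (fact nz nz[symmetric] xx yy zz gp a0)+
  have yz: "degree y = degree z"
  proof -
    have "d \<noteq> 0" by (fact nz)
    hence "2*degree y = degree b + degree d" "2*degree z = degree c + degree d"
      using deg_root[OF yy] deg_root[OF zz] nz degree_relations(1) deg(3) by auto
    thus ?thesis using degree_relations(1) by simp
  qed
  have dr: "degree s = degree r" "degree r > 0" using degree_relations by auto
  have ci: "of_int i = (of_int j :: complex poly) \<Longrightarrow> i = j" for i j by simp
  note O1 = orbit_outcomes and O2 = S.orbit_outcomes[unfolded D1_regular_swap yz dr(1)]
  consider (oo) n m where "n \<ge> 1" "m \<ge> 1" "degree z = nat (2*n) * degree r" "degree z = nat (2*m) * degree r"
      "((of_int n - 1)\<^sup>2*\<theta>)\<^sup>2 = (of_int n)\<^sup>2" "((of_int m - 1)\<^sup>2*(-\<phi>))\<^sup>2 = (of_int m)\<^sup>2"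
    | (oe) n m where "n \<ge> 1" "m \<ge> 1" "degree z = nat (2*n) * degree r" "degree z = nat (2*m+1) * degree r"
    | (ee) n m where "n \<ge> 2" "m \<ge> 2" "degree z = nat (2*n+1) * degree r" "degree z = nat (2*m+1) * degree r"
      "\<theta>\<^sup>2*(of_int n+1) = -2" "(-\<phi>)\<^sup>2*(of_int m+1) = -2"
  proof -
    have w: "\<exists>m\<ge>1. degree z = nat (2*m+1) * degree r" if "m \<ge> 2" "degree z = nat (2*m+1) * degree r" for m :: int
      using that by (intro exI[of _ m]) auto
    show thesis using O1 O2 nr oo oe ee w by metis
  qed
  thus False
  proof cases
    case oo
    have "nat (2*n) * degree r = nat (2*m) * degree r" by (rule trans[OF sym[OF oo(3)] oo(4)])
    hence mn: "m = n" using dr(2) oo(1,2) by auto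
    have "((of_int n - 1)\<^sup>2*\<theta>)\<^sup>2 * ((of_int n - 1)\<^sup>2*(-\<phi>))\<^sup>2 = (of_int n)\<^sup>2*(of_int n)\<^sup>2"
      using oo(5,6) unfolding mn by simp
    hence "(of_int n - 1)^8 = (of_int n :: complex poly)^4" using theta(1) by algebra
    hence "of_int ((n-1)^8) = (of_int (n^4) :: complex poly)" by simp
    hence "(n-1)^8 = n^4" by (rule ci)
    hence "((n-1)\<^sup>2)^4 = n^4" by (simp add: power_mult[symmetric])
    hence "(n-1)\<^sup>2 = n" using oo(1) power_eq_imp_eq_base[of "(n-1)\<^sup>2" 4 n] by simp
    hence e: "n*(n-3) = -1" by (simp add: power2_eq_square algebra_simps)
    hence "n dvd 1" by (metis dvd_triv_left dvd_minus_iff)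
    hence "n = 1" using oo(1) by simp
    thus False using e by simp
  next
    case oe
    have "nat (2*n) * degree r = nat (2*m+1) * degree r" by (rule trans[OF sym[OF oe(3)] oe(4)])
    hence "2*n = 2*m+1" using dr(2) oe(1,2) by auto
    thus False by presburger
  next
    case ee
    have "nat (2*n+1) * degree r = nat (2*m+1) * degree r" by (rule trans[OF sym[OF ee(3)] ee(4)])
    hence mn: "m = n" using dr(2) ee(1,2) by auto
    have "(\<theta>\<^sup>2*(of_int n+1)) * ((-\<phi>)\<^sup>2*(of_int n+1)) = (-2)*(-2)" using ee(5,6) unfolding mn by (simp only:)
    hence "(of_int n + 1)^2 = (4::complex poly)" using theta(1) by algebra
    hence "of_int ((n+1)^2) = (of_int 4 :: complex poly)" by simp
    hence "(n+1)^2 = 4" by (rule ci)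
    moreover have "(n+1)^2 \<ge> 3^2" using ee(1) by (intro power_mono) auto
    ultimately show False by simp
  qed
qed

end

section \<open>All quadruples\<close>

lemma D1_regular_perm: "D1_regular a c b d \<longleftrightarrow> D1_regular a b c d" "D1_regular c b a d \<longleftrightarrow> D1_regular a b c d"
  unfolding D1_regular_def by (rule iffI; algebra)+

lemma degree_diff_lead: "degree p = degree q \<Longrightarrow> lead_coeff p \<noteq> lead_coeff q \<Longrightarrow> degree (p - q) = degree q"
  for p q :: "complex poly"
  using le_degree[of "p - q" "degree q"] degree_diff_le[of p "degree q" q] by auto

context quad begin

lemma regular_if_triple:
  assumes eq: "degree b = degree c" and triple: "(a+b-c)\<^sup>2 = 4*(a*b+1)"
    and lc: "degree a < degree c \<or> degree (a-c) = degree c \<and> degree (b-c) = degree c"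
  shows "D1_regular a b c d"
proof -
  have "(c-a-b)\<^sup>2 = (2*r)\<^sup>2" using triple rr by algebra
  then obtain \<rho> where \<rho>: "\<rho> = r \<or> \<rho> = -r" "c-a-b = 2*\<rho>" using square_eq_cases[of "c-a-b" "2*r"] by force
  have cdef: "c = a+b+2*\<rho>" using \<rho>(2) by algebra
  have r2: "\<rho>\<^sup>2 = a*b+1" using \<rho>(1) rr by auto
  have rgp: "\<rho> \<in> gauss_rat_polys" using \<rho>(1) gp gauss_polys_closed(4) by auto
  interpret R: quad_regular_triple a b c d \<rho> "a+\<rho>" "b+\<rho>" x y z
  proof
    show "(a+\<rho>)\<^sup>2 = a*c+1" "(b+\<rho>)\<^sup>2 = b*c+1" unfolding cdef using r2 by algebra+
    show "a+\<rho> \<in> gauss_rat_polys" "b+\<rho> \<in> gauss_rat_polys" using gp rgp by (auto intro: gauss_polys_closed)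
  qed (fact nz xx yy zz deg gp IH rgp r2 cdef eq refl)+
  show ?thesis
  proof (cases "degree a < degree c")
    case True thus ?thesis by (rule R.regular_if_small)
  next
    case False thus ?thesis using R.regular_if_equal lc deg by auto
  qed
qed

text \<open>The argument for equal degrees needs a modulus whose leading coefficient differs from the other two. If \<open>c\<close>
  does not qualify, the leading coefficients are in the ratio \<open>1 : 1 : 4\<close>, and the element with the exceptional one
  qualifies.\<close>
lemma regular_if_balanced:
  assumes eq: "degree a = degree c" and triple: "(a+b-c)\<^sup>2 = 4*(a*b+1)"
  shows "D1_regular a b c d"
proof -
  have eqb: "degree b = degree c" using eq deg by simp
  have pos: "degree a > 0" "degree c > 0" using eq eqb deg by auto
  have IH': "d0 = 0 \<or> D1_regular a b c d0" if "d0 \<in> gauss_rat_polys" "x0 \<in> gauss_rat_polys" "y0 \<in> gauss_rat_polys" "z0 \<in> gauss_rat_polys"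
        "x0\<^sup>2 = a*d0+1" "y0\<^sup>2 = b*d0+1" "z0\<^sup>2 = c*d0+1" "degree d0 < degree c" for d0 x0 y0 z0
    using IH[OF that] self_partner_const[of x0 a] that(5) pos by auto
  \<comment> \<open>Compare the leading coefficients on both sides of \<open>(u+v-w)\<^sup>2 = 4(uv+1)\<close>.\<close>
  have lead: "lead_coeff v = 4*lead_coeff u"
    if "degree u = degree c" "degree v = degree c" "lead_coeff u = lead_coeff w" "degree w = degree c"
      "(u+v-w)\<^sup>2 = 4*(u*v+1)" "v \<noteq> 0" "u \<noteq> 0" for u v w :: "complex poly"
  proof -
    let ?n = "degree c"
    have cf: "coeff (u+v-w) ?n = lead_coeff v" using that by simp
    moreover have "lead_coeff v \<noteq> 0" using that(6) by (simp only: leading_coeff_0_iff not_False_eq_True)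
    ultimately have "degree (u+v-w) \<ge> ?n" by (intro le_degree) argo
    moreover have "degree (u+v-w) \<le> ?n" using that by (intro degree_diff_le degree_add_le) auto
    ultimately have l: "lead_coeff (u+v-w) = lead_coeff v" using cf by simp
    have "lead_coeff (4*(u*v+1)) = 4*lead_coeff (u*v+1)" by (simp only: lead_coeff_mult lead_coeff_numeral)
    also have "lead_coeff (u*v+1) = lead_coeff (u*v)"
    proof -
      have "degree (u*v) > 0" using that pos by (simp add: degree_mult_eq)
      moreover from this have "degree (u*v+1) = degree (u*v)" by (intro degree_add_eq_left) simp
      ultimately show ?thesis by (simp add: coeff_eq_0)
    qed
    finally have "lead_coeff v ^2 = 4*(lead_coeff u * lead_coeff v)"
      using l that(5) by (metis lead_coeff_power lead_coeff_mult)
    thus ?thesis using that(6) by (simp add: power2_eq_square)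
  qed
  consider "lead_coeff a \<noteq> lead_coeff c" "lead_coeff b \<noteq> lead_coeff c" | (ac) "lead_coeff a = lead_coeff c" | (bc) "lead_coeff b = lead_coeff c" by blast
  thus ?thesis
  proof cases
    case 1 thus ?thesis using regular_if_triple[OF eqb triple] degree_diff_lead[of a c] degree_diff_lead[of b c] eq eqb by blast
  next
    case ac
    have 4: "lead_coeff b = 4*lead_coeff a" using lead[of a b c] eq eqb ac triple nz by auto
    hence ne: "lead_coeff a \<noteq> lead_coeff b" "lead_coeff c \<noteq> lead_coeff b" using nz ac by auto
    interpret Q: quad a c b d s r t x z y
    proof
      show "t\<^sup>2 = c*b+1" using tt by (simp add: mult.commute)
      show "degree a \<le> degree c" "degree c \<le> degree b" "0 < degree c" using eq eqb pos by auto
      show "d0 = 0 \<or> d0 = a \<or> D1_regular a c b d0"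
        if "d0 \<in> gauss_rat_polys" "x0 \<in> gauss_rat_polys" "y0 \<in> gauss_rat_polys" "z0 \<in> gauss_rat_polys"
          "x0\<^sup>2 = a*d0+1" "y0\<^sup>2 = c*d0+1" "z0\<^sup>2 = b*d0+1" "degree d0 < degree b" for d0 x0 y0 z0
        using IH'[OF that(1,2,4,3,5,7,6)] that(8) eqb D1_regular_perm(1)[of a c b d0] by auto
    qed (fact nz nz[symmetric] rr ss xx yy zz gp)+
    have "(a+c-b)\<^sup>2 = 4*(a*c+1)" using triple by algebra
    from Q.regular_if_triple[OF sym[OF eqb] this] show ?thesis
      using degree_diff_lead[OF _ ne(1)] degree_diff_lead[OF _ ne(2)] eq eqb D1_regular_perm(1)[of a c b d] by auto
  next
    case bc
    have "(b+a-c)\<^sup>2 = 4*(b*a+1)" using triple by algebra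
    hence 4: "lead_coeff a = 4*lead_coeff b" using lead[of b a c] eq eqb bc nz by auto
    hence ne: "lead_coeff c \<noteq> lead_coeff a" "lead_coeff b \<noteq> lead_coeff a" using nz bc by auto
    interpret Q: quad c b a d t s r z y x
    proof
      show "t\<^sup>2 = c*b+1" "s\<^sup>2 = c*a+1" "r\<^sup>2 = b*a+1" using rr ss tt by (simp_all add: mult.commute)
      show "degree c \<le> degree b" "degree b \<le> degree a" "0 < degree b" using eq eqb pos by auto
      show "d0 = 0 \<or> d0 = c \<or> D1_regular c b a d0"
        if "d0 \<in> gauss_rat_polys" "x0 \<in> gauss_rat_polys" "y0 \<in> gauss_rat_polys" "z0 \<in> gauss_rat_polys"
          "x0\<^sup>2 = c*d0+1" "y0\<^sup>2 = b*d0+1" "z0\<^sup>2 = a*d0+1" "degree d0 < degree a" for d0 x0 y0 z0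
        using IH'[OF that(1,4,3,2,7,6,5)] that(8) eq D1_regular_perm(2)[of c b a d0] by auto
    qed (fact nz nz[symmetric] xx yy zz gp)+
    have "(c+b-a)\<^sup>2 = 4*(c*b+1)" using triple by algebra
    from Q.regular_if_triple[OF _ this] show ?thesis
      using degree_diff_lead[OF _ ne(1)] degree_diff_lead[OF _ ne(2)] eq eqb D1_regular_perm(2)[of c b a d] by auto
  qed
qed

lemma regular_if_self_extension:
  assumes "degree a = 0" and self: "D1_regular a b c a" and q: "q\<^sup>2 = a*a+1" "q \<in> gauss_rat_polys"
  shows "D1_regular a b c d"
proof -
  \<comment> \<open>Solving the quadratic equation \<open>self\<close> for \<open>c\<close>: its discriminant is \<open>16 (a\<^sup>2+1)(ab+1)\<^sup>2\<close>.\<close>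
  have "(c - (b + 2*a\<^sup>2*b + 2*a))\<^sup>2 = (2*q*(a*b+1))\<^sup>2"
    using self q(1) unfolding D1_regular_def by algebra
  then obtain \<kappa> where k: "\<kappa> = q \<or> \<kappa> = -q" "c - (b + 2*a\<^sup>2*b + 2*a) = 2*\<kappa>*(a*b+1)"
    using square_eq_cases[of "c - (b + 2*a\<^sup>2*b + 2*a)" "2*q*(a*b+1)"] by force
  have k2: "\<kappa>\<^sup>2 = a*a+1" "\<kappa> \<in> gauss_rat_polys" using k(1) q gauss_polys_closed(4) by auto
  have "degree (\<kappa>\<^sup>2) = 0" unfolding k2 using assms(1) by (intro deg0_simps) auto
  hence dk: "degree \<kappa> = 0" by (simp add: degree_square_complex)
  define \<theta> where "\<theta> = a + \<kappa>"
  have th: "\<theta>\<^sup>2 = 1 + 2*a*\<theta>" unfolding \<theta>_def using k2 by algebra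
  have cdef: "c = \<theta>\<^sup>2*b + 2*\<theta>" using k(2) k2 unfolding \<theta>_def by algebra
  have tgp: "\<theta> \<in> gauss_rat_polys" unfolding \<theta>_def using gp k2 by (auto intro: gauss_polys_closed)
  interpret T: quad_self_extension a b c d r "\<theta>*r" "\<theta>*b+1" x y z \<theta>
  proof
    show "(\<theta>*r)\<^sup>2 = a*c+1" unfolding cdef using rr th by algebra
    show "(\<theta>*b+1)\<^sup>2 = b*c+1" unfolding cdef by algebra
    show "\<theta>*r \<in> gauss_rat_polys" "\<theta>*b+1 \<in> gauss_rat_polys" using gp tgp by (auto intro: gauss_polys_intros)
    show "degree \<theta> = 0" unfolding \<theta>_def using assms(1) dk by (intro deg0_simps)
  qed (fact nz xx yy zz deg gp IH rr cdef th refl assms)+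
  show ?thesis by (rule T.regular)
qed

text \<open>The larger regular extension has the degree of \<open>abc\<close>, and the product of both has at most twice the degree of
  \<open>c\<close>. So if \<open>b\<close> and \<open>c\<close> have equal degree, the smaller extension \<open>e\<close> is 0, or \<open>a\<close> and \<open>e\<close> are constant and then equal.\<close>
theorem regular: "D1_regular a b c d"
proof (cases "degree b < degree c")
  case True thus ?thesis by (rule regular_if_lt)
next
  case False
  hence eq: "degree b = degree c" using deg by simp
  obtain \<rho> where \<rho>: "\<rho> = r \<or> \<rho> = -r" "degree (a+b+c+2*a*b*c + 2*\<rho>*s*t) = degree a + degree b + degree c"
    by (rule large_extension[OF rr ss tt nz(1-3)]) (use deg in auto)
  have r2: "\<rho>\<^sup>2 = a*b+1" using \<rho>(1) rr by auto
  have rgp: "\<rho> \<in> gauss_rat_polys" using \<rho>(1) gp gauss_polys_closed(4) by auto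
  obtain e where e: "e = a+b+c+2*a*b*c - 2*\<rho>*s*t" by blast
  note ext = extension_roots[OF r2 ss tt e]
  have "D1_regular a b c e" unfolding D1_regular_iff e using r2 ss tt by algebra
  show ?thesis
  proof (cases "e = 0")
    case True
    have triple: "(a+b-c)\<^sup>2 = 4*(a*b+1)" using \<open>D1_regular a b c e\<close> unfolding True D1_regular_def by simp
    show ?thesis
    proof (cases "degree a = degree c")
      case True thus ?thesis using triple by (rule regular_if_balanced)
    next
      case False thus ?thesis using regular_if_triple[OF eq triple] deg by simp
    qed
  next
    case False
    let ?Q = "a\<^sup>2+b\<^sup>2+c\<^sup>2-2*a*b-2*a*c-2*b*c-4"
    have "a+b+c+2*a*b*c + 2*\<rho>*s*t \<noteq> 0" using \<rho>(2) deg by auto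
    hence "degree ?Q = degree e + (degree a + degree b + degree c)"
      using degree_mult_eq[OF False] \<rho>(2) ext(4) by metis
    moreover have "degree ?Q \<le> 2*degree c"
      using deg eq by (intro degree_diff_le degree_add_le order_trans[OF degree_mult_le])
        (auto simp: degree_square_complex)
    ultimately have d0: "degree a = 0" "degree e = 0" using eq by auto
    have "(c*\<rho>-s*t)\<^sup>2 = e*c+1" using ext(3) by (simp add: mult.commute)
    hence ea: "e = a" using const_partner_unique[OF d0(2,1) False nz(1) _ _ ss] eq deg by simp
    have "(a*t-\<rho>*s)\<^sup>2 = a*a+1" using ext(1) ea by simp
    moreover have "a*t-\<rho>*s \<in> gauss_rat_polys" using gp rgp by (auto intro: gauss_polys_intros)
    moreover have "D1_regular a b c a" using \<open>D1_regular a b c e\<close> ea by simp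
    ultimately show ?thesis using d0 by (intro regular_if_self_extension)
  qed
qed

end

text \<open>Regularity written in symmetric functions of the four polynomials, so that a quadruple can be treated as a set
  and be sorted at will.\<close>
definition regular_set :: "complex poly set \<Rightarrow> bool" where
  "regular_set S \<longleftrightarrow> 2*(\<Sum>p\<in>S. p\<^sup>2) - (\<Sum>p\<in>S. p)\<^sup>2 - 4*(\<Prod>p\<in>S. p) - 4 = 0"

lemma regular_set_iff:
  assumes "distinct [a,b,c,d]"
  shows "regular_set {a,b,c,d} \<longleftrightarrow> D1_regular a b c d"
proof -
  have "regular_set {a,b,c,d} \<longleftrightarrow> 2*(a\<^sup>2+b\<^sup>2+c\<^sup>2+d\<^sup>2) - (a+b+c+d)\<^sup>2 - 4*(a*b*c*d) - 4 = 0"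
    using assms unfolding regular_set_def by (simp add: add.assoc mult.assoc)
  also have "\<dots> \<longleftrightarrow> D1_regular a b c d" unfolding D1_regular_def by (rule iffI; algebra)
  finally show ?thesis .
qed

text \<open>Induction on the sum of the degrees. An extension of \<open>{a, b, c}\<close> of smaller degree than \<open>c\<close> that is neither 0 nor \<open>a\<close>
  replaces \<open>d\<close>, the element of largest degree, and thus yields a smaller quadruple.\<close>
theorem D1_quadruple_regular:
  assumes "D_quadruple 1 S" "\<exists>p\<in>S. degree p > 0"
  shows "regular_set S"
  using assms
proof (induction "\<Sum>p\<in>S. degree p" arbitrary: S rule: less_induct)
  case (less S)
  have S: "S \<subseteq> gauss_rat_polys" "card S = 4" "0 \<notin> S" using less.prems(1) by (auto simp: D_quadruple_def)
  have root: "\<exists>r\<in>gauss_rat_polys. r\<^sup>2 = p*q+1" if "p \<in> S" "q \<in> S" "p \<noteq> q" for p q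
    using less.prems(1) that unfolding D_quadruple_def by (metis of_int_1)
  have fin: "finite S" using S(2) by (metis card.infinite zero_neq_numeral)
  obtain xs where xs: "set xs = S" "distinct xs" using finite_distinct_list[OF fin] by blast
  define ys where "ys = sort_key degree xs"
  have ys: "set ys = S" "distinct ys" "length ys = 4" "sorted (map degree ys)"
    using xs S(2) distinct_card[OF xs(2)] by (auto simp: ys_def)
  obtain a b c d where "ys = [a,b,c,d]"
  proof -
    have "length ys = Suc (Suc (Suc (Suc 0)))" using ys(3) by simp
    thus thesis using that unfolding length_Suc_conv by blast
  qed
  hence abcd: "S = {a,b,c,d}" "distinct [a,b,c,d]" and sorted: "degree a \<le> degree b" "degree b \<le> degree c" "degree c \<le> degree d"
    using ys by auto
  have ne: "a \<noteq> b" "a \<noteq> c" "b \<noteq> c" "d \<noteq> a" "d \<noteq> b" "d \<noteq> c" using abcd(2) by auto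
  have nz: "a \<noteq> 0" "b \<noteq> 0" "c \<noteq> 0" "d \<noteq> 0" using S(3) abcd(1) by auto
  have gp: "a \<in> gauss_rat_polys" "b \<in> gauss_rat_polys" "c \<in> gauss_rat_polys" "d \<in> gauss_rat_polys" using S(1) abcd(1) by auto
  obtain r s t x y z where roots: "r\<^sup>2 = a*b+1" "s\<^sup>2 = a*c+1" "t\<^sup>2 = b*c+1" "x\<^sup>2 = a*d+1" "y\<^sup>2 = b*d+1" "z\<^sup>2 = c*d+1"
    and rgp: "r \<in> gauss_rat_polys" "s \<in> gauss_rat_polys" "t \<in> gauss_rat_polys" "x \<in> gauss_rat_polys" "y \<in> gauss_rat_polys" "z \<in> gauss_rat_polys"
  proof -
    have "\<exists>r\<in>gauss_rat_polys. r\<^sup>2 = a*b+1" "\<exists>r\<in>gauss_rat_polys. r\<^sup>2 = a*c+1" "\<exists>r\<in>gauss_rat_polys. r\<^sup>2 = b*c+1"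
      "\<exists>r\<in>gauss_rat_polys. r\<^sup>2 = a*d+1" "\<exists>r\<in>gauss_rat_polys. r\<^sup>2 = b*d+1" "\<exists>r\<in>gauss_rat_polys. r\<^sup>2 = c*d+1"
      using root ne abcd(1) by auto
    thus thesis using that by blast
  qed
  have dpos: "degree d > 0" using less.prems(2) abcd(1) sorted by auto
  have bpos: "degree b > 0"
  proof (rule ccontr)
    assume "\<not> degree b > 0"
    hence "degree a = 0" "degree b = 0" using sorted by auto
    from const_partner_unique[OF this nz(1,2) dpos roots(4,5)] ne(1) show False by blast
  qed
  interpret quad a b c d r s t x y z
  proof
    fix d0 x0 y0 z0
    assume d0: "d0 \<in> gauss_rat_polys" "x0 \<in> gauss_rat_polys" "y0 \<in> gauss_rat_polys" "z0 \<in> gauss_rat_polys"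
        "x0\<^sup>2 = a*d0+1" "y0\<^sup>2 = b*d0+1" "z0\<^sup>2 = c*d0+1" "degree d0 < degree c"
    show "d0 = 0 \<or> d0 = a \<or> D1_regular a b c d0"
    proof (rule ccontr)
      assume "\<not> (d0 = 0 \<or> d0 = a \<or> D1_regular a b c d0)"
      hence n: "d0 \<noteq> 0" "d0 \<noteq> a" "\<not> D1_regular a b c d0" by auto
      have "d0 \<noteq> b" using self_partner_const[of y0 b] d0(6) bpos by auto
      moreover have "d0 \<noteq> c" using d0(8) by auto
      ultimately have ds: "distinct [a,b,c,d0]" using ne n by auto
      have "\<exists>r\<in>gauss_rat_polys. p * q + of_int 1 = r\<^sup>2" if "p \<in> {a,b,c,d0}" "q \<in> {a,b,c,d0}" "p \<noteq> q" for p q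
      proof -
        have eq: "r\<^sup>2 = a*b+1" "s\<^sup>2 = a*c+1" "t\<^sup>2 = b*c+1" by (fact roots)+
        have "\<exists>r\<in>gauss_rat_polys. r\<^sup>2 = p * q + 1"
          using that(1,2) that(3) bexI[where P="\<lambda>w. w\<^sup>2 = p*q+1", OF _ rgp(1)] bexI[where P="\<lambda>w. w\<^sup>2 = p*q+1", OF _ rgp(2)]
           bexI[where P="\<lambda>w. w\<^sup>2 = p*q+1", OF _ rgp(3)] bexI[where P="\<lambda>w. w\<^sup>2 = p*q+1", OF _ d0(2)]
           bexI[where P="\<lambda>w. w\<^sup>2 = p*q+1", OF _ d0(3)] bexI[where P="\<lambda>w. w\<^sup>2 = p*q+1", OF _ d0(4)]
          unfolding eq d0(5-7) by (elim insertE emptyE) (simp_all add: mult.commute)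
        thus ?thesis by (simp add: eq_commute)
      qed
      hence "D_quadruple 1 {a,b,c,d0}" using ds n(1) gp nz d0(1) unfolding D_quadruple_def by auto
      moreover have "(\<Sum>p\<in>{a,b,c,d0}. degree p) < (\<Sum>p\<in>S. degree p)"
        using ds abcd d0(8) sorted by simp
      moreover have "\<exists>p\<in>{a,b,c,d0}. degree p > 0" using bpos by blast
      ultimately have "regular_set {a,b,c,d0}" using less.hyps by blast
      thus False using n(3) regular_set_iff[OF ds] by simp
    qed
  qed (fact ne nz roots gp rgp sorted bpos)+
  show ?case using regular regular_set_iff[OF abcd(2)] abcd(1) by simp
qed

theorem corollary1p1:
  fixes a b c d :: "complex poly"
  assumes "D_quadruple 4 {a, b, c, d}"
    and "\<exists>p\<in>{a, b, c, d}. degree p > 0"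
  shows "D4_regular a b c d"
proof -
  define h :: "complex poly" where "h = [:1/2:]"
  have h: "2*h = 1" by (simp add: h_def numeral_poly one_pCons)
  have hgp: "h \<in> gauss_rat_polys" unfolding h_def by (intro gauss_polys_const gauss_rats_Rats) simp
  have h0: "h \<noteq> 0" "degree h = 0" by (simp_all add: h_def)
  have inj: "inj_on ((*) h) A" for A using h0 by (auto simp: inj_on_def)
  let ?S = "{a,b,c,d}" let ?H = "(*) h ` ?S"
  have D: "?S \<subseteq> gauss_rat_polys" "card ?S = 4" "0 \<notin> ?S"
    "\<And>p q. p \<in> ?S \<Longrightarrow> q \<in> ?S \<Longrightarrow> p \<noteq> q \<Longrightarrow> \<exists>r\<in>gauss_rat_polys. p * q + of_int 4 = r\<^sup>2"
    using assms(1) unfolding D_quadruple_def by blast+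
  have "D_quadruple 1 ?H" unfolding D_quadruple_def
  proof (intro conjI ballI impI)
    show "?H \<subseteq> gauss_rat_polys" using D(1) hgp gauss_polys_closed by auto
    show "card ?H = 4" using card_image[OF inj, of ?S] D(2) by argo
    show "0 \<notin> ?H" using D(3) h0 by auto
    fix p q assume "p \<in> ?H" "q \<in> ?H" "p \<noteq> q"
    then obtain p' q' where pq: "p = h*p'" "q = h*q'" "p' \<in> ?S" "q' \<in> ?S" "p' \<noteq> q'" by blast
    obtain r where r: "r \<in> gauss_rat_polys" "p'*q' + of_int 4 = r\<^sup>2" using D(4)[OF pq(3-5)] by blast
    have "p'*q' + 4 = r\<^sup>2" using r(2) by simp
    hence "(h*p')*(h*q') + 1 = (h*r)\<^sup>2" using h by algebra
    hence "p*q + of_int 1 = (h*r)\<^sup>2" unfolding pq by simp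
    thus "\<exists>r\<in>gauss_rat_polys. p*q + of_int 1 = r\<^sup>2" using hgp r(1) gauss_polys_closed by blast
  qed
  moreover have "\<exists>p\<in>?H. degree p > 0"
  proof -
    obtain p where "p \<in> ?S" "degree p > 0" using assms(2) by blast
    moreover from this have "degree (h*p) = degree p" using h0 by (subst degree_mult_eq) auto
    ultimately show ?thesis by force
  qed
  ultimately have "regular_set ?H" by (rule D1_quadruple_regular)
  moreover have "?H = {h*a,h*b,h*c,h*d}" by simp
  moreover have "distinct [h*a,h*b,h*c,h*d]"
  proof -
    have "card (set [a,b,c,d]) = length [a,b,c,d]" using D(2) by simp
    hence "distinct [a,b,c,d]" by (rule card_distinct)
    thus ?thesis using h0 by simp
  qed
  ultimately have "D1_regular (h*a) (h*b) (h*c) (h*d)" using regular_set_iff by simp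
  thus ?thesis unfolding D4_regular_def D1_regular_def using h by algebra
qed

end
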